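(* Let $a,b$ be non-zero real numbers with $ab=2$ and let $A=\mathrm{diag}(2,b,a,1)\in GL(4,\mathbb{R})$. Let $\mathcal{S}\subset\mathbb{R}^{\ast}$ be a measurable set which is dilation congruent to $[-1,-1/2)\cup(1/2,1]$, translation congruent to $(0,1]$, and satisfies $\mathcal{S}\subseteq[-1,1]$. Let $f\in\mathbf{H}_{\mathcal{S}}$ be such that $\mathbf{P}f(\lambda)=u_{\lambda}\otimes v_{\lambda}$ for $\lambda\in\mathcal{S}$, where $u_\lambda,v_\lambda\in L^2(\mathbb{R})$ are such that, for $d\lambda$-almost every $\lambda\in\mathcal{S}$, the Gabor system $\mathcal{G}(|\lambda|^{1/4}u_{\lambda},\mathbb{Z}\times\lambda\mathbb{Z})$ is a Parseval frame in $L^2(\mathbb{R})$ and the Gabor system $\mathcal{G}(|\lambda|^{1/4}\overline{v}_{\lambda},\mathbb{Z}\times\lambda\mathbb{Z})$ is a Parseval frame in $L^2(\mathbb{R})$ (here $\overline{v}_\lambda$ is the complex conjugate of $v_\lambda$). Then the system $$\left\{D_{A^{m}}\tau(\gamma,\eta)f:m\in\mathbb{Z},\ (\gamma,\eta)\in\Lambda\right\}$$ is a Parseval frame in $L^{2}(\mathbb{H})$.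
   Context: **Heisenberg group.** For $x,y,z\in\mathbb{R}$ put $$M(x,y,z)=\begin{bmatrix}1&x&-y&z\\0&1&0&y\\0&0&1&0\\0&0&0&1\end{bmatrix},\qquad \mathbb{H}=\{M(x,y,z):x,y,z\in\mathbb{R}\}\subset GL(4,\mathbb{R}),$$ a realization of the three-dimensional Heisenberg group, with $M(x,y,z)M(w,v,u)=M(x+w,y+v,z+u+xv)$. It is endowed with the Haar measure $dn=dx\,dy\,dz$ (Lebesgue measure on $\mathbb{R}^3$). **Biregular representation.** $\tau:\mathbb{H}\times\mathbb{H}\to\mathcal{U}(L^2(\mathbb{H}))$ is $\tau(u,v)f=L(u)R(v)f$, where $L(u)f(x)=f(u^{-1}x)$ and $R(v)f(x)=f(xv)$. **Index set.** $\Lambda=\{(M(k_3,k_2,k_1),M(m_3,m_2,0)):k_1,k_2,k_3,m_2,m_3\in\mathbb{Z}\}\subset\mathbb{H}\times\mathbb{H}$. **Dilations.** For $A=\mathrm{diag}(2,b,a,1)$ with $ab=2$, conjugation $n\mapsto AnA^{-1}$ is an automorphism of $\mathbb{H}$, namely $AM(x,y,z)A^{-1}=M(ax,by,2z)$. The unitary representation $D$ of the group generated by $A$ on $L^2(\mathbb{H})$ is $$D_{A^m}f(n)=|\delta(A)|^{-m/2}f(A^{-m}nA^{m}),\quad m\in\mathbb{Z},$$ where $d(A^mnA^{-m})=|\delta(A)|^m\,dn$ (so $|\delta(A)|=4$). **Plancherel transform.** $\mathbb{R}^{\ast}=\mathbb{R}\setminus\{0\}$. For $\lambda\in\mathbb{R}^{\ast}$,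 $\pi_\lambda$ is the irreducible unitary representation of $\mathbb{H}$ on $L^2(\mathbb{R})$ given by $\pi_\lambda(M(x,y,z))\phi(t)=e^{2\pi i\lambda z}e^{-2\pi i\lambda yt}\phi(t-x)$. For $f\in L^1(\mathbb{H})\cap L^2(\mathbb{H})$ the Fourier transform is $\mathcal{F}f(\lambda)=\int_{\mathbb{H}}f(n)\pi_\lambda(n)\,dn$ (weakly defined). It is a Hilbert-Schmidt operator on $L^2(\mathbb{R})$ for almost every $\lambda$, and $\mathcal{F}$ extends to a unitary operator, the Plancherel transform, $$\mathbf{P}:L^2(\mathbb{H})\to\int_{\mathbb{R}^{\ast}}^{\oplus}L^2(\mathbb{R})\otimes L^2(\mathbb{R})\,|\lambda|d\lambda,\qquad \|f\|^2_{L^2(\mathbb{H})}=\int_{\mathbb{R}^{\ast}}\|\mathbf{P}f(\lambda)\|^2_{\mathcal{HS}}\,|\lambda|d\lambda,$$ where $L^2(\mathbb{R})\otimes L^2(\mathbb{R})$ denotes the Hilbert space of Hilbert-Schmidt operators on $L^2(\mathbb{R})$ with norm $\|\cdot\|_{\mathcal{HS}}$ and $d\lambda$ is Lebesgue measure. For $u,v\in L^2(\mathbb{R})$, $u\otimes v$ is the rank-one operator $w\mapsto\langle w,v\rangle u$. For measurable $\mathcal{S}\subset\mathbb{R}^{\ast}$, $\mathbf{H}_{\mathcal{S}}=\mathbf{P}^{-1}\left(\int_{\mathcal{S}}^{\oplus}L^2(\mathbb{R})\otimes L^2(\mathbb{R})\,|\lambda|d\lambda\right)$, i.e. the closed subspace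 of those $f\in L^2(\mathbb{H})$ with $\mathbf{P}f(\lambda)=0$ for a.e. $\lambda\notin\mathcal{S}$. **Congruences.** Measurable sets $I,J\subset\mathbb{R}$ are translation congruent if there is a bijection $\rho:I\to J$ and an integer-valued (measurable) function $k$ on $I$ with $\rho(\lambda)=\lambda+k(\lambda)$; they are dilation congruent if there is a bijection $\delta:I\to J$ and an integer-valued (measurable) function $j$ on $I$ with $\delta(\lambda)=2^{j(\lambda)}\lambda$. All sets and functions are measurable and sets are identified when their symmetric difference has Lebesgue measure zero. **Gabor systems and frames.** For non-zero real $\alpha,\beta$ and $g\in L^2(\mathbb{R})$, $\mathcal{G}(g,\alpha\mathbb{Z}\times\beta\mathbb{Z})=\{e^{2\pi ikx}g(x-n):k\in\beta\mathbb{Z},\ n\in\alpha\mathbb{Z}\}$. A countable family $\{f_i\}_{i\in I}$ in a Hilbert space $\mathbf{H}$ is a Parseval frame in $\mathbf{H}$ if $\sum_{i\in I}|\langle h,f_i\rangle|^2=\|h\|^2$ for all $h\in\mathbf{H}$. *)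

theory Defs
  imports "HOL-Analysis.Analysis"
begin

subsection \<open>Square-integrable functions and frames\<close>

text \<open>Elements of \<open>L\<^sup>2\<close> are represented by measurable functions; equality in \<open>L\<^sup>2\<close> is
  equality almost everywhere.\<close>

definition L2 :: "'a measure \<Rightarrow> ('a \<Rightarrow> complex) set" where
  "L2 M = {f \<in> borel_measurable M. integrable M (\<lambda>x. (cmod (f x))\<^sup>2)}"

definition inner_L2 :: "'a measure \<Rightarrow> ('a \<Rightarrow> complex) \<Rightarrow> ('a \<Rightarrow> complex) \<Rightarrow> complex" where
  "inner_L2 M f g = (LINT x|M. f x * cnj (g x))"

definition norm_L2 :: "'a measure \<Rightarrow> ('a \<Rightarrow> complex) \<Rightarrow> real" where
  "norm_L2 M f = sqrt (LINT x|M. (cmod (f x))\<^sup>2)"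

definition parseval_frame :: "'a measure \<Rightarrow> 'i set \<Rightarrow> ('i \<Rightarrow> 'a \<Rightarrow> complex) \<Rightarrow> bool" where
  "parseval_frame M I F \<longleftrightarrow>
     countable I \<and> (\<forall>i\<in>I. F i \<in> L2 M) \<and>
     (\<forall>h\<in>L2 M. ((\<lambda>i. (cmod (inner_L2 M h (F i)))\<^sup>2) has_sum (norm_L2 M h)\<^sup>2) I)"

definition lattice_Z :: "real \<Rightarrow> real set" where
  "lattice_Z \<alpha> = range (\<lambda>j::int. \<alpha> * of_int j)"

text \<open>The Gabor system \<open>\<G>(g, \<alpha>\<int> \<times> \<beta>\<int>)\<close> is the family \<open>gabor g\<close> indexed by
  \<open>lattice_Z \<alpha> \<times> lattice_Z \<beta>\<close>: first translation, then modulation parameter.\<close>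

definition gabor :: "(real \<Rightarrow> complex) \<Rightarrow> real \<times> real \<Rightarrow> real \<Rightarrow> complex" where
  "gabor g = (\<lambda>(n, k) x. cis (2 * pi * k * x) * g (x - n))"

subsection \<open>The Heisenberg group\<close>

definition heis :: "real \<Rightarrow> real \<Rightarrow> real \<Rightarrow> real^4^4" where
  "heis x y z = vector [vector [1, x, - y, z],
                        vector [0, 1, 0, y],
                        vector [0, 0, 1, 0],
                        vector [0, 0, 0, 1]]"

text \<open>Haar measure is the image of Lebesgue measure on \<open>\<real>\<^sup>3\<close>, regarded as a Borel measure on
  all 4 by 4 matrices concentrated on the (closed) group. Hence functions on the group are
  represented by functions on matrices, and their values off the group are irrelevant.\<close>

definition haar :: "(real^4^4) measure" where
  "haar = distr (lborel :: (real \<times> real \<times> real) measure) borel (\<lambda>(x, y, z). heis x y z)"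

definition left_reg :: "real^4^4 \<Rightarrow> (real^4^4 \<Rightarrow> complex) \<Rightarrow> real^4^4 \<Rightarrow> complex" where
  "left_reg u f = (\<lambda>x. f (matrix_inv u ** x))"

definition right_reg :: "real^4^4 \<Rightarrow> (real^4^4 \<Rightarrow> complex) \<Rightarrow> real^4^4 \<Rightarrow> complex" where
  "right_reg v f = (\<lambda>x. f (x ** v))"

definition bireg :: "real^4^4 \<Rightarrow> real^4^4 \<Rightarrow> (real^4^4 \<Rightarrow> complex) \<Rightarrow> real^4^4 \<Rightarrow> complex" where
  "bireg u v f = left_reg u (right_reg v f)"

definition Lambda :: "((real^4^4) \<times> (real^4^4)) set" where
  "Lambda = {(heis (of_int k3) (of_int k2) (of_int k1), heis (of_int m3) (of_int m2) 0)
              | k1 k2 k3 m2 m3 :: int. True}"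

definition dil_matrix :: "real \<Rightarrow> real \<Rightarrow> real^4^4" where
  "dil_matrix a b = vector [vector [2, 0, 0, 0],
                            vector [0, b, 0, 0],
                            vector [0, 0, a, 0],
                            vector [0, 0, 0, 1]]"

definition matrix_powi :: "real^'n^'n \<Rightarrow> int \<Rightarrow> real^'n^'n" where
  "matrix_powi A m =
     (if 0 \<le> m then (((**) A) ^^ nat m) (mat 1) else (((**) (matrix_inv A)) ^^ nat (- m)) (mat 1))"

text \<open>The constant 4 is the factor by which conjugation with \<open>A = dil_matrix a b\<close>, \<open>a * b = 2\<close>,
  scales Haar measure: it is \<open>(x, y, z) \<mapsto> (a * x, b * y, 2 * z)\<close> in coordinates.\<close>

definition dilation :: "real^4^4 \<Rightarrow> int \<Rightarrow> (real^4^4 \<Rightarrow> complex) \<Rightarrow> real^4^4 \<Rightarrow> complex" where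
  "dilation A m f =
     (\<lambda>n. of_real (4 powr (- of_int m / 2)) * f (matrix_powi A (- m) ** n ** matrix_powi A m))"

subsection \<open>Hilbert-Schmidt operators on the line\<close>

text \<open>An operator acts on representatives; only its values on \<open>L2 lborel\<close>, up to null sets,
  are relevant.\<close>

type_synonym oper = "(real \<Rightarrow> complex) \<Rightarrow> real \<Rightarrow> complex"

definition oper_eq :: "oper \<Rightarrow> oper \<Rightarrow> bool" where
  "oper_eq S T \<longleftrightarrow> (\<forall>\<phi>\<in>L2 lborel. AE t in lborel. S \<phi> t = T \<phi> t)"

definition bounded_oper :: "oper \<Rightarrow> bool" where
  "bounded_oper T \<longleftrightarrow>
     (\<forall>\<phi>\<in>L2 lborel. T \<phi> \<in> L2 lborel) \<and>
     (\<forall>\<phi>\<in>L2 lborel. \<forall>\<psi>\<in>L2 lborel. AE t in lborel. T (\<lambda>s. \<phi> s + \<psi> s) t = T \<phi> t + T \<psi> t) \<and>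
     (\<forall>c. \<forall>\<phi>\<in>L2 lborel. AE t in lborel. T (\<lambda>s. c * \<phi> s) t = c * T \<phi> t) \<and>
     (\<exists>C. \<forall>\<phi>\<in>L2 lborel. norm_L2 lborel (T \<phi>) \<le> C * norm_L2 lborel \<phi>)"

definition orthonormal_basis :: "(nat \<Rightarrow> real \<Rightarrow> complex) \<Rightarrow> bool" where
  "orthonormal_basis e \<longleftrightarrow>
     (\<forall>i. e i \<in> L2 lborel) \<and>
     (\<forall>i j. inner_L2 lborel (e i) (e j) = (if i = j then 1 else 0)) \<and>
     (\<forall>\<phi>\<in>L2 lborel. (\<forall>i. inner_L2 lborel \<phi> (e i) = 0) \<longrightarrow> (AE t in lborel. \<phi> t = 0))"

text \<open>The value does not depend on the basis when the operator is bounded.\<close>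

definition hs_norm_sq :: "oper \<Rightarrow> ennreal" where
  "hs_norm_sq T = (\<Sum>i. ennreal ((norm_L2 lborel (T ((SOME e. orthonormal_basis e) i)))\<^sup>2))"

definition hilbert_schmidt :: "oper \<Rightarrow> bool" where
  "hilbert_schmidt T \<longleftrightarrow> bounded_oper T \<and> hs_norm_sq T < \<infinity>"

definition rank_one :: "(real \<Rightarrow> complex) \<Rightarrow> (real \<Rightarrow> complex) \<Rightarrow> oper" where
  "rank_one u v = (\<lambda>w t. inner_L2 lborel w v * u t)"

subsection \<open>The Plancherel transform\<close>

text \<open>Lemma \<open>schroedinger_heis\<close> below gives this in the coordinates of the group.\<close>

definition schroedinger :: "real \<Rightarrow> real^4^4 \<Rightarrow> oper" where
  "schroedinger \<xi> n = (\<lambda>\<phi> t. let x = n $ 1 $ 2; y = n $ 2 $ 4; z = n $ 1 $ 4 in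
     cis (2 * pi * \<xi> * z) * cis (- 2 * pi * \<xi> * y * t) * \<phi> (t - x))"

definition heis_fourier :: "(real^4^4 \<Rightarrow> complex) \<Rightarrow> real \<Rightarrow> oper" where
  "heis_fourier f \<xi> = (\<lambda>\<phi>. SOME \<zeta>. \<zeta> \<in> L2 lborel \<and>
     (\<forall>\<psi>\<in>L2 lborel. inner_L2 lborel \<zeta> \<psi> =
        (LINT n|haar. f n * inner_L2 lborel (schroedinger \<xi> n \<phi>) \<psi>)))"

text \<open>The direct integral of the Hilbert-Schmidt operators with respect to \<open>\<bar>\<xi>\<bar> d\<xi>\<close>; the point
  \<open>\<xi> = 0\<close> is negligible.\<close>

definition hs_fields :: "(real \<Rightarrow> oper) set" where
  "hs_fields = {T.
     (AE \<xi> in lebesgue. hilbert_schmidt (T \<xi>)) \<and>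
     (\<forall>\<phi>\<in>L2 lborel. \<forall>\<psi>\<in>L2 lborel.
        (\<lambda>\<xi>. inner_L2 lborel (T \<xi> \<phi>) \<psi>) \<in> borel_measurable lebesgue) \<and>
     (\<integral>\<^sup>+\<xi>. hs_norm_sq (T \<xi>) * ennreal \<bar>\<xi>\<bar> \<partial>lebesgue) < \<infinity>}"

text \<open>\<open>plancherel f T\<close>: the field \<open>T\<close> represents \<open>\<P>f\<close>, the continuous extension of the Fourier
  transform from \<open>L\<^sup>1 \<inter> L\<^sup>2\<close> to \<open>L\<^sup>2\<close>. It is a relation because \<open>\<P>f\<close> is only determined up to
  \<open>oper_eq\<close> at almost every \<open>\<xi>\<close>.\<close>

definition plancherel :: "(real^4^4 \<Rightarrow> complex) \<Rightarrow> (real \<Rightarrow> oper) \<Rightarrow> bool" where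
  "plancherel f T \<longleftrightarrow> f \<in> L2 haar \<and> T \<in> hs_fields \<and>
     (\<exists>g. (\<forall>n. g n \<in> L2 haar \<and> integrable haar (g n)) \<and>
        (\<lambda>n. norm_L2 haar (\<lambda>x. g n x - f x)) \<longlonglongrightarrow> 0 \<and>
        (\<lambda>n. \<integral>\<^sup>+\<xi>. hs_norm_sq (\<lambda>\<phi> t. heis_fourier (g n) \<xi> \<phi> t - T \<xi> \<phi> t)
                * ennreal \<bar>\<xi>\<bar> \<partial>lebesgue) \<longlonglongrightarrow> 0)"

definition H_space :: "real set \<Rightarrow> (real^4^4 \<Rightarrow> complex) set" where
  "H_space S = {f. \<exists>T. plancherel f T \<and>
     (AE \<xi> in lebesgue. \<xi> \<notin> S \<longrightarrow> oper_eq (T \<xi>) (\<lambda>\<phi> t. 0))}"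

subsection \<open>Congruence of sets\<close>

text \<open>The sets \<open>I'\<close> and \<open>J'\<close> implement the identification of sets modulo null sets.\<close>

definition null_equal :: "real set \<Rightarrow> real set \<Rightarrow> bool" where
  "null_equal I J \<longleftrightarrow> sym_diff I J \<in> null_sets lebesgue"

definition translation_congruent :: "real set \<Rightarrow> real set \<Rightarrow> bool" where
  "translation_congruent I J \<longleftrightarrow>
     (\<exists>I'\<in>sets lebesgue. \<exists>J'\<in>sets lebesgue. null_equal I I' \<and> null_equal J J' \<and>
       (\<exists>\<rho> (k :: real \<Rightarrow> int). k \<in> measurable (restrict_space lebesgue I') (count_space UNIV) \<and>
          bij_betw \<rho> I' J' \<and> (\<forall>\<xi>\<in>I'. \<rho> \<xi> = \<xi> + of_int (k \<xi>))))"

definition dilation_congruent :: "real set \<Rightarrow> real set \<Rightarrow> bool" where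
  "dilation_congruent I J \<longleftrightarrow>
     (\<exists>I'\<in>sets lebesgue. \<exists>J'\<in>sets lebesgue. null_equal I I' \<and> null_equal J J' \<and>
       (\<exists>\<delta> (j :: real \<Rightarrow> int). j \<in> measurable (restrict_space lebesgue I') (count_space UNIV) \<and>
          bij_betw \<delta> I' J' \<and> (\<forall>\<xi>\<in>I'. \<delta> \<xi> = 2 powi (j \<xi>) * \<xi>)))"

subsection \<open>Coordinate formulas\<close>

lemma UNIV_4: "(UNIV :: 4 set) = {1, 2, 3, 4}"
proof -
  have "card {1, 2, 3, 4 :: 4} = CARD(4)" by simp
  then show ?thesis by (metis card_subset_eq finite subset_UNIV)
qed

lemma forall_4: "(\<forall>i::4. P i) \<longleftrightarrow> P 1 \<and> P 2 \<and> P 3 \<and> P 4"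
proof -
  have "(\<forall>i::4. P i) \<longleftrightarrow> (\<forall>i\<in>{1, 2, 3, 4}. P i)" using UNIV_4 by blast
  then show ?thesis by simp
qed

lemma sum_4: "sum f (UNIV :: 4 set) = f 1 + f 2 + f 3 + f 4"
  unfolding UNIV_4 by (simp add: add.assoc)

lemma vector_4 [simp]:
  "(vector [p, q, r, s] :: ('a::zero)^4) $ 1 = p"
  "(vector [p, q, r, s] :: ('a::zero)^4) $ 2 = q"
  "(vector [p, q, r, s] :: ('a::zero)^4) $ 3 = r"
  "(vector [p, q, r, s] :: ('a::zero)^4) $ 4 = s"
  by (simp_all add: vector_def)

lemma heis_mult: "heis x y z ** heis w v u = heis (x + w) (y + v) (z + u + x * v)"
  by (simp add: heis_def matrix_matrix_mult_def vec_eq_iff forall_4 sum_4)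

lemma dil_matrix_heis:
  assumes "a * b = 2"
  shows "dil_matrix a b ** heis x y z = heis (a * x) (b * y) (2 * z) ** dil_matrix a b"
  using assms mult.commute[of b a]
  by (simp add: heis_def dil_matrix_def matrix_matrix_mult_def vec_eq_iff forall_4 sum_4)

lemma schroedinger_heis:
  "schroedinger \<xi> (heis x y z) \<phi> t =
     cis (2 * pi * \<xi> * z) * cis (- 2 * pi * \<xi> * y * t) * \<phi> (t - x)"
  by (simp add: schroedinger_def heis_def)

end

theory Submission
  imports Defs
begin

text \<open>
  In coordinates, \<open>\<pi>\<^sub>\<lambda>(f)\<close> is the integral operator whose kernel at \<open>(t, s)\<close> is the Euclidean Fourier transform of
  \<open>f\<close> in its last two variables at \<open>(t - s, \<lambda>t, -\<lambda>)\<close>, so that the Plancherel theorem of the group reduces to the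
  one on the line. The latter, in \<open>[0, \<infinity>]\<close> and for all integrable functions, follows from Fourier series by
  periodization.

  Translation by \<open>\<gamma>\<close> and \<open>\<eta>\<close> turns the kernel \<open>u\<^sub>\<lambda> \<otimes> v\<^sub>\<lambda>\<close> into \<open>exp(2\<pi>i\<lambda>k)\<close> times a tensor product of two
  Gabor atoms. As \<open>S\<close> tiles the line by integer translations, summing over \<open>k\<close> is Parseval's identity on \<open>S\<close>, and
  summing over the Gabor indices recovers the Hilbert-Schmidt norm at each \<open>\<lambda> \<in> S\<close>, the weight \<open>\<bar>\<lambda>\<bar>\<close> being
  absorbed by the two factors \<open>\<bar>\<lambda>\<bar> powr (1/4)\<close>. Dilations rescale \<open>\<lambda>\<close> by powers of two, and \<open>S\<close> tiles the line
  by these as well.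
\<close>

section \<open>Square-integrable functions\<close>

text \<open>\<open>plancherel\<close> describes the transform only through approximating sequences
  and Hilbert-Schmidt norms in a chosen basis, which is awkward to compute with. The work is done
  with a second relation, \<open>ktransform\<close>, between functions on three-dimensional space
  and weighted kernels. It is shown to be total on L2, isometric and covariant, and an arbitrary
  test function enters only through it. The two relations are compared once, for the single function
  f, by way of countably many matrix coefficients.

  Two further choices shape the proof. Squared norms are kept as \<open>energy\<close>, with values
  in \<open>ennreal\<close>: Tonelli and Parseval then apply before finiteness is known, whereas the
  Bochner integral inside \<open>norm_L2\<close> returns 0 for a function that is not square
  integrable. And the function of \<lambda> that is expanded in a Fourier series is a fibrewise
  inner product of two L2 kernels, hence a priori only integrable; this is why Parseval is needed
  beyond L2.\<close>

definition energy :: "'a measure \<Rightarrow> ('a \<Rightarrow> complex) \<Rightarrow> ennreal" where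
  "energy M f = (\<integral>\<^sup>+x. ennreal ((cmod (f x))\<^sup>2) \<partial>M)"

lemma L2_iff: "f \<in> L2 M \<longleftrightarrow> f \<in> borel_measurable M \<and> energy M f < \<infinity>"
  unfolding L2_def energy_def by (auto simp: integrable_iff_bounded)

lemma L2_measurable: "f \<in> L2 M \<Longrightarrow> f \<in> borel_measurable M"
  by (simp add: L2_def)

lemma energy_L2: "f \<in> L2 M \<Longrightarrow> energy M f = ennreal ((norm_L2 M f)\<^sup>2)"
  unfolding L2_def energy_def norm_L2_def
  by (auto simp: nn_integral_eq_integral)

lemma norm_L2_sq: "(norm_L2 M f)\<^sup>2 = enn2real (energy M f)" if "f \<in> borel_measurable M"
  unfolding norm_L2_def energy_def using that
  by (simp add: integral_eq_nn_integral)

lemma norm_L2_nonneg: "norm_L2 M f \<ge> 0"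
  by (simp add: norm_L2_def)

lemma energy_cong_AE: "AE x in M. f x = g x \<Longrightarrow> energy M f = energy M g"
  unfolding energy_def by (rule nn_integral_cong_AE) auto

lemma energy_eq_0_iff:
  "f \<in> borel_measurable M \<Longrightarrow> energy M f = 0 \<longleftrightarrow> (AE x in M. f x = 0)"
  unfolding energy_def by (subst nn_integral_0_iff_AE) auto

lemma energy_cmult: "f \<in> borel_measurable M \<Longrightarrow> energy M (\<lambda>x. c * f x) = ennreal ((cmod c)\<^sup>2) * energy M f"
  unfolding energy_def
  by (subst nn_integral_cmult[symmetric])
     (auto simp: norm_mult power_mult_distrib ennreal_mult)

lemma energy_minus_commute: "energy M (\<lambda>x. f x - g x) = energy M (\<lambda>x. g x - f x)"
  unfolding energy_def by (simp add: norm_minus_commute)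

lemma cmod_add_sq_le: "(cmod (a + b))\<^sup>2 \<le> 2 * (cmod a)\<^sup>2 + 2 * (cmod b)\<^sup>2"
proof -
  have "(cmod (a + b))\<^sup>2 \<le> (cmod a + cmod b)\<^sup>2"
    by (intro power_mono norm_triangle_ineq) auto
  also have "\<dots> \<le> 2 * (cmod a)\<^sup>2 + 2 * (cmod b)\<^sup>2"
    using sum_squares_bound[of "cmod a" "cmod b"] by (simp add: power2_sum)
  finally show ?thesis .
qed

text \<open>The factor 2 comes from (a + b)^2 \<le> 2 a^2 + 2 b^2. It is harmless in limits and
  spares square roots in \<open>ennreal\<close>, so this takes the place of the triangle
  inequality.\<close>

lemma energy_add_le:
  assumes [measurable]: "f \<in> borel_measurable M" "g \<in> borel_measurable M"
  shows "energy M (\<lambda>x. f x + g x) \<le> 2 * energy M f + 2 * energy M g"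
proof -
  have "energy M (\<lambda>x. f x + g x) \<le> (\<integral>\<^sup>+x. 2 * ennreal ((cmod (f x))\<^sup>2) + 2 * ennreal ((cmod (g x))\<^sup>2) \<partial>M)"
    unfolding energy_def
  proof (rule nn_integral_mono)
    fix x
    show "ennreal ((cmod (f x + g x))\<^sup>2) \<le> 2 * ennreal ((cmod (f x))\<^sup>2) + 2 * ennreal ((cmod (g x))\<^sup>2)"
      using ennreal_leI[OF cmod_add_sq_le[of "f x" "g x"]]
      by (simp add: ennreal_plus ennreal_mult)
  qed
  also have "\<dots> = 2 * energy M f + 2 * energy M g"
    unfolding energy_def by (subst nn_integral_add) (auto simp: nn_integral_cmult)
  finally show ?thesis .
qed

lemma energy_uminus: "energy M (\<lambda>x. - f x) = energy M f"
  by (simp add: energy_def)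

lemma energy_diff_triangle:
  assumes "f \<in> borel_measurable M" "g \<in> borel_measurable M" "h \<in> borel_measurable M"
  shows "energy M (\<lambda>x. f x - h x) \<le> 2 * energy M (\<lambda>x. f x - g x) + 2 * energy M (\<lambda>x. g x - h x)"
  using energy_add_le[of "\<lambda>x. f x - g x" M "\<lambda>x. g x - h x"] assms by simp

lemma L2_add: "f \<in> L2 M \<Longrightarrow> g \<in> L2 M \<Longrightarrow> (\<lambda>x. f x + g x) \<in> L2 M"
  unfolding L2_iff using energy_add_le[of f M g]
  by (auto simp: ennreal_mult_less_top order_le_less_trans)

lemma L2_cmult: "f \<in> L2 M \<Longrightarrow> (\<lambda>x. c * f x) \<in> L2 M"
  unfolding L2_iff by (auto simp: energy_cmult ennreal_mult_less_top)

lemma L2_uminus: "f \<in> L2 M \<Longrightarrow> (\<lambda>x. - f x) \<in> L2 M"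
  unfolding L2_iff by (auto simp: energy_uminus)

lemma L2_diff: "f \<in> L2 M \<Longrightarrow> g \<in> L2 M \<Longrightarrow> (\<lambda>x. f x - g x) \<in> L2 M"
  using L2_add[OF _ L2_uminus, of f M g] by simp

lemma L2_zero: "(\<lambda>x. 0) \<in> L2 M"
  by (simp add: L2_iff energy_def)

lemma L2_sum: "(\<And>i. i \<in> A \<Longrightarrow> f i \<in> L2 M) \<Longrightarrow> (\<lambda>x. \<Sum>i\<in>A. f i x) \<in> L2 M"
  by (induction A rule: infinite_finite_induct) (auto simp: L2_zero L2_add)

lemma L2_cnj: "f \<in> L2 M \<Longrightarrow> (\<lambda>x. cnj (f x)) \<in> L2 M"
  unfolding L2_def by (auto intro: borel_measurable_continuous_on continuous_on_cnj)

lemma cnj_borel_measurable [measurable (raw)]: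
  "f \<in> borel_measurable M \<Longrightarrow> (\<lambda>x. cnj (f x)) \<in> borel_measurable M"
  by (rule borel_measurable_continuous_on[where f=cnj]) (auto intro: continuous_intros)

lemma cis_borel_measurable [measurable (raw)]:
  "f \<in> borel_measurable M \<Longrightarrow> (\<lambda>x. cis (f x)) \<in> borel_measurable M"
  by (rule borel_measurable_continuous_on[where f=cis]) (auto intro: continuous_intros)

lemma Cauchy_Schwarz_nn:
  assumes [measurable]: "f \<in> borel_measurable M" "g \<in> borel_measurable M"
  shows "(\<integral>\<^sup>+x. ennreal (cmod (f x * g x)) \<partial>M)\<^sup>2 \<le> energy M f * energy M g"
proof -
  have "(\<integral>\<^sup>+x. ennreal (cmod (f x)) * ennreal (cmod (g x)) \<partial>M)\<^sup>2 \<le>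
      (\<integral>\<^sup>+x. (ennreal (cmod (f x)))^2 \<partial>M) * (\<integral>\<^sup>+x. (ennreal (cmod (g x)))^2 \<partial>M)"
    by (rule Cauchy_Schwarz_nn_integral) auto
  then show ?thesis
    by (simp add: energy_def norm_mult ennreal_mult ennreal_power)
qed

lemma integrable_L2_mult:
  assumes "f \<in> L2 M" "g \<in> L2 M"
  shows "integrable M (\<lambda>x. f x * g x)"
proof -
  have [measurable]: "f \<in> borel_measurable M" "g \<in> borel_measurable M"
    using assms by (auto simp: L2_def)
  have "(\<integral>\<^sup>+x. ennreal (cmod (f x * g x)) \<partial>M)\<^sup>2 < \<infinity>"
    using Cauchy_Schwarz_nn[of f M g] assms
    by (auto simp: L2_iff ennreal_mult_less_top intro: le_less_trans)
  then have "(\<integral>\<^sup>+x. ennreal (cmod (f x * g x)) \<partial>M) < \<infinity>"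
    unfolding infinity_ennreal_def less_top[symmetric] by (metis power_eq_top_ennreal zero_neq_numeral)
  then show ?thesis by (simp add: integrable_iff_bounded)
qed

lemma integrable_L2_inner: "f \<in> L2 M \<Longrightarrow> g \<in> L2 M \<Longrightarrow> integrable M (\<lambda>x. f x * cnj (g x))"
  by (rule integrable_L2_mult) (auto intro: L2_cnj)

text \<open>Measurability alone suffices: if the product is not integrable, the Bochner integral on
  the left is 0.\<close>

lemma Cauchy_Schwarz_integral:
  assumes [measurable]: "f \<in> borel_measurable M" "g \<in> borel_measurable M"
  shows "ennreal ((cmod (LINT x|M. f x * g x))\<^sup>2) \<le> energy M f * energy M g"
proof (cases "integrable M (\<lambda>x. f x * g x)")
  case True
  have "ennreal (cmod (LINT x|M. f x * g x)) \<le> (\<integral>\<^sup>+x. ennreal (cmod (f x * g x)) \<partial>M)"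
    by (rule integral_norm_bound_ennreal[OF True])
  then have "(ennreal (cmod (LINT x|M. f x * g x)))\<^sup>2 \<le> (\<integral>\<^sup>+x. ennreal (cmod (f x * g x)) \<partial>M)\<^sup>2"
    by (rule power_mono) auto
  also have "\<dots> \<le> energy M f * energy M g"
    by (rule Cauchy_Schwarz_nn) auto
  finally show ?thesis by (simp add: ennreal_power)
qed (simp add: not_integrable_integral_eq)

lemma energy_cnj: "energy M (\<lambda>x. cnj (f x)) = energy M f"
  by (simp add: energy_def)

lemma Cauchy_Schwarz_inner:
  assumes [measurable]: "f \<in> borel_measurable M" "g \<in> borel_measurable M"
  shows "ennreal ((cmod (inner_L2 M f g))\<^sup>2) \<le> energy M f * energy M g"
  using Cauchy_Schwarz_integral[of f M "\<lambda>x. cnj (g x)"] by (simp add: inner_L2_def energy_cnj)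

lemma inner_L2_add_left: "f \<in> L2 M \<Longrightarrow> g \<in> L2 M \<Longrightarrow> h \<in> L2 M \<Longrightarrow>
   inner_L2 M (\<lambda>x. f x + g x) h = inner_L2 M f h + inner_L2 M g h"
  by (simp add: inner_L2_def ring_distribs integrable_L2_inner)

lemma inner_L2_diff_left: "f \<in> L2 M \<Longrightarrow> g \<in> L2 M \<Longrightarrow> h \<in> L2 M \<Longrightarrow>
   inner_L2 M (\<lambda>x. f x - g x) h = inner_L2 M f h - inner_L2 M g h"
  by (simp add: inner_L2_def ring_distribs integrable_L2_inner)

lemma inner_L2_cmult_left: "inner_L2 M (\<lambda>x. c * f x) h = c * inner_L2 M f h"
  by (simp add: inner_L2_def mult.assoc)

lemma inner_L2_cnj_commute: "inner_L2 M f g = cnj (inner_L2 M g f)"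
proof -
  have "cnj (inner_L2 M g f) = (LINT x|M. cnj (g x * cnj (f x)))"
    unfolding inner_L2_def by (rule Bochner_Integration.integral_cnj[symmetric])
  then show ?thesis by (simp add: inner_L2_def mult.commute)
qed

lemma inner_L2_add_right: "f \<in> L2 M \<Longrightarrow> g \<in> L2 M \<Longrightarrow> h \<in> L2 M \<Longrightarrow>
   inner_L2 M h (\<lambda>x. f x + g x) = inner_L2 M h f + inner_L2 M h g"
  by (subst (1 2 3) inner_L2_cnj_commute) (simp add: inner_L2_add_left)

lemma inner_L2_cmult_right: "inner_L2 M h (\<lambda>x. c * f x) = cnj c * inner_L2 M h f"
  by (subst (1 2) inner_L2_cnj_commute) (simp add: inner_L2_cmult_left)

lemma inner_L2_zero_left: "inner_L2 M (\<lambda>x. 0) h = 0"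
  by (simp add: inner_L2_def)

lemma inner_L2_sum_left: "(\<And>i. i \<in> A \<Longrightarrow> f i \<in> L2 M) \<Longrightarrow> h \<in> L2 M \<Longrightarrow>
   inner_L2 M (\<lambda>x. \<Sum>i\<in>A. f i x) h = (\<Sum>i\<in>A. inner_L2 M (f i) h)"
  by (induction A rule: infinite_finite_induct) (auto simp: inner_L2_zero_left inner_L2_add_left L2_sum)

lemma inner_L2_cong_AE:
  assumes "f \<in> borel_measurable M" "f' \<in> borel_measurable M" "g \<in> borel_measurable M" "g' \<in> borel_measurable M"
    and "AE x in M. f x = f' x" "AE x in M. g x = g' x"
  shows "inner_L2 M f g = inner_L2 M f' g'"
  unfolding inner_L2_def using assms
  by (intro integral_cong_AE) (auto intro: AE_mp)

lemma inner_L2_self: "inner_L2 M f f = of_real ((norm_L2 M f)\<^sup>2)"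
  by (simp add: inner_L2_def norm_L2_def complex_norm_square[symmetric] flip: of_real_power)

lemma norm_L2_add_sq:
  assumes "f \<in> L2 M" "g \<in> L2 M"
  shows "(norm_L2 M (\<lambda>x. f x + g x))\<^sup>2 = (norm_L2 M f)\<^sup>2 + (norm_L2 M g)\<^sup>2 + 2 * Re (inner_L2 M f g)"
proof -
  have "complex_of_real ((norm_L2 M (\<lambda>x. f x + g x))\<^sup>2) = inner_L2 M (\<lambda>x. f x + g x) (\<lambda>x. f x + g x)"
    by (simp only: inner_L2_self)
  also have "\<dots> = inner_L2 M f f + inner_L2 M f g + (inner_L2 M g f + inner_L2 M g g)"
    using assms by (simp add: inner_L2_add_left inner_L2_add_right L2_add)
  also have "\<dots> = of_real ((norm_L2 M f)\<^sup>2 + (norm_L2 M g)\<^sup>2) + (inner_L2 M f g + cnj (inner_L2 M f g))"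
    by (subst (2) inner_L2_cnj_commute) (simp add: inner_L2_self)
  also have "\<dots> = of_real ((norm_L2 M f)\<^sup>2 + (norm_L2 M g)\<^sup>2 + 2 * Re (inner_L2 M f g))"
    by (simp add: complex_add_cnj)
  finally show ?thesis by (simp only: of_real_eq_iff)
qed

lemma norm_L2_cmult_sq: "(norm_L2 M (\<lambda>x. c * f x))\<^sup>2 = (cmod c)\<^sup>2 * (norm_L2 M f)\<^sup>2"
  by (simp add: norm_L2_def norm_mult power_mult_distrib)

text \<open>Polarization. Together with \<open>Im_inner_eq_Re\<close> it expresses inner products
  through norms, so that a linear map preserving norms preserves inner products.\<close>

lemma Re_inner_polarization:
  assumes "f \<in> L2 M" "g \<in> L2 M"
  shows "Re (inner_L2 M f g) = ((norm_L2 M (\<lambda>x. f x + g x))\<^sup>2 - (norm_L2 M f)\<^sup>2 - (norm_L2 M g)\<^sup>2) / 2"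
  by (simp add: norm_L2_add_sq[OF assms])

lemma Im_inner_eq_Re:
  shows "Im (inner_L2 M f g) = Re (inner_L2 M f (\<lambda>x. \<i> * g x))"
  by (simp add: inner_L2_cmult_right)

lemma tendsto_0_le_ennreal:
  fixes f :: "'a \<Rightarrow> ennreal"
  assumes "\<And>e. e > 0 \<Longrightarrow> \<forall>\<^sub>F n in F. f n \<le> ennreal e"
  shows "(f \<longlongrightarrow> 0) F"
proof (rule order_tendstoI)
  fix c :: ennreal assume "0 < c"
  then obtain d where d: "0 < d" "d < c" by (meson dense)
  then have "d \<noteq> top" by auto
  then obtain e where "d = ennreal e" "e \<ge> 0" by (cases d) auto
  with d have "0 < e" "ennreal e < c" by (auto simp: less_le)
  then show "\<forall>\<^sub>F n in F. f n < c"
    using assms[of e] by (auto elim!: eventually_mono intro: le_less_trans)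
qed auto


subsection \<open>Completeness\<close>

lemma energy_Fatou:
  assumes "\<And>n. g n \<in> borel_measurable M"
    and "AE x in M. (\<lambda>n. g n x) \<longlonglongrightarrow> g' x" and "\<And>n. n \<ge> n0 \<Longrightarrow> energy M (g n) \<le> C"
  shows "energy M g' \<le> C"
proof -
  have "energy M g' = (\<integral>\<^sup>+x. liminf (\<lambda>n. ennreal ((cmod (g n x))\<^sup>2)) \<partial>M)"
    unfolding energy_def
  proof (rule nn_integral_cong_AE, use assms(2) in eventually_elim)
    case (elim x)
    have "(\<lambda>n. ennreal ((cmod (g n x))\<^sup>2)) \<longlonglongrightarrow> ennreal ((cmod (g' x))\<^sup>2)"
      by (intro tendsto_ennrealI tendsto_intros elim)
    from lim_imp_Liminf[OF _ this] show ?case by simp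
  qed
  also have "\<dots> \<le> liminf (\<lambda>n. \<integral>\<^sup>+x. ennreal ((cmod (g n x))\<^sup>2) \<partial>M)"
    using assms(1) by (intro nn_integral_liminf) auto
  also have "\<dots> \<le> limsup (\<lambda>n. energy M (g n))"
    unfolding energy_def by (rule Liminf_le_Limsup) simp
  also have "\<dots> \<le> C"
    by (rule Limsup_bounded) (use assms(3) in \<open>auto simp: eventually_sequentially\<close>)
  finally show ?thesis .
qed

lemma L2_complete:
  fixes f :: "nat \<Rightarrow> 'a \<Rightarrow> complex"
  assumes f: "\<And>n. f n \<in> L2 M"
    and cauchy: "\<And>e. e > 0 \<Longrightarrow> \<exists>N. \<forall>m\<ge>N. \<forall>n\<ge>N. energy M (\<lambda>x. f m x - f n x) < ennreal e"
  obtains g where "g \<in> L2 M" "(\<lambda>n. energy M (\<lambda>x. f n x - g x)) \<longlonglongrightarrow> 0"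
proof -
  have fm [measurable]: "\<And>n. f n \<in> borel_measurable M" using f by (auto simp: L2_def)
  obtain N where N: "\<And>e m n. e > 0 \<Longrightarrow> m \<ge> N e \<Longrightarrow> n \<ge> N e \<Longrightarrow> energy M (\<lambda>x. f m x - f n x) < ennreal e"
    using cauchy by metis
  \<comment> \<open>Summing the thresholds keeps \<open>r k\<close> above
    \<open>N ((1/4)^k)\<close>; the summand k makes r strictly increasing.\<close>
  define r where "r k = (\<Sum>i\<le>k. N ((1/4)^i)) + k" for k
  have rN: "r k \<ge> N ((1/4)^k)" for k
    unfolding r_def by (intro trans_le_add1 member_le_sum) auto
  have rSuc: "r k < r (Suc k)" for k
    unfolding r_def by simp
  have rmono: "strict_mono r" using rSuc by (simp add: strict_mono_Suc_iff)
  define d where "d k x = f (r (Suc k)) x - f (r k) x" for k x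
  have dm [measurable]: "\<And>k. d k \<in> borel_measurable M" unfolding d_def by auto
  have dk: "energy M (d k) \<le> ennreal ((1/4)^k)" for k
    unfolding d_def using N[of "(1/4)^k" "r (Suc k)" "r k"] rN[of k] rSuc[of k]
    by (auto intro: less_imp_le)
  \<comment> \<open>The energies of \<open>d k\<close> are at most 4^-k, so the weight 2^k still
    leaves a convergent series. Its finiteness at almost every x then forces
    \<open>cmod (d k x)\<close> to decay geometrically.\<close>
  have "(\<integral>\<^sup>+x. (\<Sum>k. ennreal (2^k * (cmod (d k x))\<^sup>2)) \<partial>M) = (\<Sum>k. \<integral>\<^sup>+x. ennreal (2^k * (cmod (d k x))\<^sup>2) \<partial>M)"
    by (rule nn_integral_suminf) auto
  also have "\<dots> = (\<Sum>k. ennreal (2^k) * energy M (d k))"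
    unfolding energy_def by (simp add: ennreal_mult nn_integral_cmult)
  also have "\<dots> \<le> (\<Sum>k. ennreal ((1/2)^k))"
  proof (intro suminf_le)
    fix k
    have "ennreal (2^k) * energy M (d k) \<le> ennreal (2^k) * ennreal ((1/4)^k)"
      by (intro mult_left_mono dk) auto
    also have "\<dots> = ennreal ((1/2)^k)"
      by (simp add: ennreal_mult[symmetric] power_mult_distrib[symmetric])
    finally show "ennreal (2^k) * energy M (d k) \<le> ennreal ((1/2)^k)" .
  qed auto
  also have "\<dots> < \<infinity>"
    unfolding infinity_ennreal_def less_top[symmetric]
    by (rule ennreal_suminf_neq_top[OF summable_geometric]) auto
  finally have "AE x in M. (\<Sum>k. ennreal (2^k * (cmod (d k x))\<^sup>2)) \<noteq> \<infinity>"
    by (intro nn_integral_noteq_infinite) auto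
  then have conv: "AE x in M. convergent (\<lambda>k. f (r k) x)"
  proof eventually_elim
    case (elim x)
    then have "summable (\<lambda>k. 2^k * (cmod (d k x))\<^sup>2)"
      by (intro summable_suminf_not_top) auto
    then have "Bseq (\<lambda>k. 2^k * (cmod (d k x))\<^sup>2)"
      by (intro convergent_imp_Bseq) (auto simp: convergent_def dest: summable_LIMSEQ_zero)
    then obtain C where C: "C > 0" "\<And>k. 2^k * (cmod (d k x))\<^sup>2 \<le> C"
      by (auto elim!: BseqE simp: abs_mult)
    have bnd: "cmod (d k x) \<le> sqrt C * (1 / sqrt 2)^k" for k
    proof -
      have "(cmod (d k x))\<^sup>2 \<le> C * (1/2)^k"
        using C(2)[of k] by (simp add: field_simps power_divide)
      then have "cmod (d k x) \<le> sqrt (C * (1/2)^k)"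
        by (rule real_le_rsqrt)
      then show ?thesis by (simp add: real_sqrt_mult real_sqrt_power real_sqrt_divide)
    qed
    have "summable (\<lambda>k. sqrt C * (1 / sqrt 2)^k)"
      by (intro summable_mult summable_geometric) auto
    then have "summable (\<lambda>k. d k x)"
      by (rule summable_comparison_test'[where N=0]) (use bnd in auto)
    then have "convergent (\<lambda>n. \<Sum>k<n. d k x)"
      by (simp add: summable_iff_convergent)
    then have "convergent (\<lambda>n. (\<Sum>k<n. d k x) + f (r 0) x)"
      by (intro convergent_add convergent_const)
    moreover have "(\<Sum>k<n. d k x) + f (r 0) x = f (r n) x" for n
      unfolding d_def by (subst sum_lessThan_telescope) simp
    ultimately show ?case by simp
  qed
  define g where "g x = lim (\<lambda>k. f (r k) x)" for x
  have gm [measurable]: "g \<in> borel_measurable M" unfolding g_def by measurable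
  have lim: "AE x in M. (\<lambda>k. f (r k) x) \<longlonglongrightarrow> g x"
    using conv by eventually_elim (simp add: g_def convergent_LIMSEQ_iff)
  \<comment> \<open>Fatou along the subsequence turns the Cauchy estimate into a bound for the whole
    sequence, with the same threshold.\<close>
  have close: "energy M (\<lambda>x. f n x - g x) \<le> ennreal e" if "e > 0" "n \<ge> N e" for e n
  proof (rule energy_Fatou[where g="\<lambda>k x. f n x - f (r k) x"])
    show "AE x in M. (\<lambda>k. f n x - f (r k) x) \<longlonglongrightarrow> f n x - g x"
      using lim by eventually_elim (intro tendsto_intros)
    fix k assume "k \<ge> N e"
    then have "r k \<ge> N e" using seq_suble[OF rmono, of k] by simp
    then show "energy M (\<lambda>x. f n x - f (r k) x) \<le> ennreal e"
      using N[OF that(1) that(2), of "r k"] by (simp add: less_imp_le)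
  qed auto
  show ?thesis
  proof (rule that)
    have "(\<lambda>x. f (N 1) x - g x) \<in> L2 M"
      using close[of 1 "N 1"] by (auto simp: L2_iff intro: le_less_trans)
    from L2_diff[OF f[of "N 1"] this] show "g \<in> L2 M" by simp
    show "(\<lambda>n. energy M (\<lambda>x. f n x - g x)) \<longlonglongrightarrow> 0"
    proof (rule tendsto_0_le_ennreal)
      fix e :: real assume "e > 0"
      then show "\<forall>\<^sub>F n in sequentially. energy M (\<lambda>x. f n x - g x) \<le> ennreal e"
        using close by (auto simp: eventually_sequentially)
    qed
  qed
qed

text \<open>Passes from the \<open>has_sum\<close> in \<open>parseval_frame\<close> to integrals
  over counting measure, where sums and Lebesgue integrals can be interchanged by Tonelli.\<close>

lemma has_sum_iff_nn_integral:
  fixes f :: "'i \<Rightarrow> real"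
  assumes nn: "\<And>i. i \<in> I \<Longrightarrow> 0 \<le> f i" and "0 \<le> c"
  shows "(f has_sum c) I \<longleftrightarrow> (\<integral>\<^sup>+i. ennreal (f i) \<partial>count_space I) = ennreal c"
proof -
  have ae: "AE i in count_space I. 0 \<le> f i" using nn by (simp add: AE_count_space)
  show ?thesis
  proof
    assume hs: "(f has_sum c) I"
    then have "f summable_on I" by (auto simp: summable_on_def)
    then have "(\<lambda>i. norm (f i)) summable_on I"
      by (rule summable_on_cong[THEN iffD1, rotated]) (use nn in auto)
    then have abs: "Infinite_Set_Sum.abs_summable_on f I" by (rule abs_summable_equivalent[THEN iffD1])
    then have int: "integrable (count_space I) f" by (simp add: abs_summable_on_def)
    have "(LINT i|count_space I. f i) = c"
      using infsetsum_infsum[OF abs] infsumI[OF hs] by (simp add: infsetsum_def)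
    then show "(\<integral>\<^sup>+i. ennreal (f i) \<partial>count_space I) = ennreal c"
      by (simp add: nn_integral_eq_integral[OF int ae])
  next
    assume eq: "(\<integral>\<^sup>+i. ennreal (f i) \<partial>count_space I) = ennreal c"
    have int: "integrable (count_space I) f"
      by (rule integrableI_nonneg) (use eq ae in auto)
    then have abs: "Infinite_Set_Sum.abs_summable_on f I" by (simp add: abs_summable_on_def)
    then have "(\<lambda>i. norm (f i)) summable_on I" by (rule abs_summable_equivalent[THEN iffD2])
    then have "f summable_on I"
      by (rule summable_on_cong[THEN iffD1, rotated]) (use nn in auto)
    then have hs: "(f has_sum infsum f I) I" by simp
    have "ennreal (LINT i|count_space I. f i) = ennreal c"
      using eq nn_integral_eq_integral[OF int ae] by simp
    moreover have "0 \<le> (LINT i|count_space I. f i)" by (rule integral_nonneg_AE[OF ae])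
    ultimately have "(LINT i|count_space I. f i) = c" using \<open>0 \<le> c\<close> by simp
    then have "infsum f I = c" using infsetsum_infsum[OF abs] by (simp add: infsetsum_def)
    with hs show "(f has_sum c) I" by simp
  qed
qed

subsection \<open>Orthonormal sequences\<close>

lemma norm_L2_diff_sq:
  assumes "f \<in> L2 M" "g \<in> L2 M"
  shows "(norm_L2 M (\<lambda>x. f x - g x))\<^sup>2 = (norm_L2 M f)\<^sup>2 + (norm_L2 M g)\<^sup>2 - 2 * Re (inner_L2 M f g)"
  using norm_L2_add_sq[OF assms(1) L2_cmult[OF assms(2), of "-1"]] norm_L2_cmult_sq[of M "-1" g]
    inner_L2_cmult_right[of M f "-1" g] by simp

locale orthonormal_seq =
  fixes M :: "'a measure" and e :: "nat \<Rightarrow> 'a \<Rightarrow> complex"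
  assumes L2: "e i \<in> L2 M"
    and orth: "inner_L2 M (e i) (e j) = (if i = j then 1 else 0)"
begin

definition psum :: "(nat \<Rightarrow> complex) \<Rightarrow> nat \<Rightarrow> 'a \<Rightarrow> complex" where
  "psum c n = (\<lambda>x. \<Sum>i<n. c i * e i x)"

lemma psum_L2: "psum c n \<in> L2 M"
  unfolding psum_def by (intro L2_sum L2_cmult L2)

lemma inner_psum: "h \<in> L2 M \<Longrightarrow> inner_L2 M (psum c n) h = (\<Sum>i<n. c i * inner_L2 M (e i) h)"
  unfolding psum_def by (subst inner_L2_sum_left) (auto intro: L2_cmult L2 simp: inner_L2_cmult_left)

lemma inner_psum_e: "inner_L2 M (psum c n) (e j) = (if j < n then c j else 0)"
  by (simp add: inner_psum[OF L2] orth if_distrib[where f="(*) _"] cong: if_cong)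

lemma norm_psum: "(norm_L2 M (psum c n))\<^sup>2 = (\<Sum>i<n. (cmod (c i))\<^sup>2)"
proof -
  have "complex_of_real ((norm_L2 M (psum c n))\<^sup>2) = (\<Sum>i<n. c i * inner_L2 M (e i) (psum c n))"
    by (simp only: inner_L2_self[symmetric] inner_psum[OF psum_L2])
  also have "\<dots> = (\<Sum>i<n. c i * cnj (c i))"
    by (intro sum.cong refl, subst inner_L2_cnj_commute) (simp add: inner_psum_e)
  also have "\<dots> = of_real (\<Sum>i<n. (cmod (c i))\<^sup>2)"
    by (simp add: complex_norm_square[symmetric] flip: of_real_power)
  finally show ?thesis by (simp only: of_real_eq_iff)
qed

text \<open>Requiring \<open>c i\<close> to be a coefficient of f only for i < n lets f be a longer
  partial sum, which gives the Cauchy estimate in \<open>Riesz_Fischer\<close>.\<close>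

lemma norm_diff_psum:
  assumes "f \<in> L2 M" "\<And>i. i < n \<Longrightarrow> c i = inner_L2 M f (e i)"
  shows "(norm_L2 M (\<lambda>x. f x - psum c n x))\<^sup>2 = (norm_L2 M f)\<^sup>2 - (\<Sum>i<n. (cmod (c i))\<^sup>2)"
proof -
  have "inner_L2 M f (psum c n) = cnj (\<Sum>i<n. c i * inner_L2 M (e i) f)"
    by (subst inner_L2_cnj_commute) (simp add: inner_psum[OF assms(1)])
  also have "\<dots> = (\<Sum>i<n. cnj (c i) * inner_L2 M f (e i))"
    by (simp, intro sum.cong refl, subst (2) inner_L2_cnj_commute) simp
  also have "\<dots> = of_real (\<Sum>i<n. (cmod (c i))\<^sup>2)"
    using assms(2) by (simp add: complex_norm_square[symmetric] mult.commute[of "cnj _"] flip: of_real_power)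
  finally have "inner_L2 M f (psum c n) = of_real (\<Sum>i<n. (cmod (c i))\<^sup>2)" .
  then show ?thesis
    using norm_L2_diff_sq[OF assms(1) psum_L2, of c n] by (simp add: norm_psum)
qed

lemma Bessel_sum:
  assumes "f \<in> L2 M"
  shows "(\<Sum>i<n. (cmod (inner_L2 M f (e i)))\<^sup>2) \<le> (norm_L2 M f)\<^sup>2"
  using norm_diff_psum[OF assms, of n "\<lambda>i. inner_L2 M f (e i)"]
  by (smt (verit) zero_le_power2)

lemma Bessel:
  assumes "f \<in> L2 M"
  shows "(\<Sum>i. ennreal ((cmod (inner_L2 M f (e i)))\<^sup>2)) \<le> energy M f"
proof -
  have "(\<Sum>i. ennreal ((cmod (inner_L2 M f (e i)))\<^sup>2)) \<le> ennreal ((norm_L2 M f)\<^sup>2)"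
    by (rule suminf_le_const) (use Bessel_sum[OF assms] in \<open>auto intro: ennreal_leI\<close>)
  then show ?thesis by (simp add: energy_L2[OF assms])
qed

lemma Riesz_Fischer:
  assumes "summable (\<lambda>i. (cmod (c i))\<^sup>2)"
  obtains g where "g \<in> L2 M" "\<And>i. inner_L2 M g (e i) = c i" "energy M g = (\<Sum>i. ennreal ((cmod (c i))\<^sup>2))"
proof -
  have diff: "energy M (\<lambda>x. psum c m x - psum c n x) = ennreal (\<Sum>i\<in>{n..<m}. (cmod (c i))\<^sup>2)" if "n \<le> m" for m n
  proof -
    have "energy M (\<lambda>x. psum c m x - psum c n x) = ennreal ((norm_L2 M (psum c m))\<^sup>2 - (\<Sum>i<n. (cmod (c i))\<^sup>2))"
      using that by (simp add: energy_L2 L2_diff psum_L2 norm_diff_psum inner_psum_e)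
    also have "(norm_L2 M (psum c m))\<^sup>2 - (\<Sum>i<n. (cmod (c i))\<^sup>2) = (\<Sum>i\<in>{n..<m}. (cmod (c i))\<^sup>2)"
      using that sum.atLeastLessThan_concat[of 0 n m "\<lambda>i. (cmod (c i))\<^sup>2"]
      by (simp add: norm_psum atLeast0LessThan)
    finally show ?thesis .
  qed
  have "\<exists>N. \<forall>m\<ge>N. \<forall>n\<ge>N. energy M (\<lambda>x. psum c m x - psum c n x) < ennreal d" if d: "d > 0" for d
  proof -
    obtain N where N: "\<And>m n. m \<ge> N \<Longrightarrow> norm (\<Sum>i\<in>{m..<n}. (cmod (c i))\<^sup>2) < d"
      using assms d unfolding summable_Cauchy by meson
    have *: "energy M (\<lambda>x. psum c m x - psum c n x) < ennreal d" if "n \<ge> N" "n \<le> m" for m n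
      using N[of n m] that \<open>d > 0\<close> by (simp add: diff sum_nonneg ennreal_less_iff)
    then have "energy M (\<lambda>x. psum c m x - psum c n x) < ennreal d" if "n \<ge> N" "m \<ge> N" for m n
      using *[of n m] *[of m n] that energy_minus_commute[of M "psum c m" "psum c n"]
      by (cases "n \<le> m") auto
    then show ?thesis by blast
  qed
  from L2_complete[OF psum_L2 this]
  obtain g where g: "g \<in> L2 M" "(\<lambda>n. energy M (\<lambda>x. psum c n x - g x)) \<longlonglongrightarrow> 0" by blast
  \<comment> \<open>As soon as n > i, the coefficient of \<open>psum c n\<close> at i is already
    \<open>c i\<close>. Its distance to the coefficient of g is bounded by Cauchy-Schwarz and tends
    to 0.\<close>
  have coeff: "inner_L2 M g (e i) = c i" for i
  proof -
    have "\<forall>\<^sub>F n in sequentially. ennreal ((cmod (c i - inner_L2 M g (e i)))\<^sup>2) \<le> energy M (\<lambda>x. psum c n x - g x) * energy M (e i)"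
      using eventually_gt_at_top[of i]
    proof eventually_elim
      case (elim n)
      have "c i - inner_L2 M g (e i) = inner_L2 M (\<lambda>x. psum c n x - g x) (e i)"
        using elim by (simp add: inner_L2_diff_left psum_L2 g L2 inner_psum_e)
      then show ?case
        using Cauchy_Schwarz_inner[of "\<lambda>x. psum c n x - g x" M "e i"] L2_measurable[OF L2]
          L2_measurable[OF L2_diff[OF psum_L2 g(1)]] by simp
    qed
    moreover have "energy M (e i) = 1"
      using orth[of i i] by (simp add: energy_L2[OF L2] inner_L2_self flip: of_real_power)
    ultimately have "ennreal ((cmod (c i - inner_L2 M g (e i)))\<^sup>2) \<le> 0"
      by (intro tendsto_lowerbound[OF g(2)]) auto
    then show ?thesis by simp
  qed
  \<comment> \<open>By Pythagoras this sequence is constantly \<open>energy M g\<close>, so its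
    limit computes that energy.\<close>
  have "(\<lambda>n. energy M (\<lambda>x. g x - psum c n x) + ennreal (\<Sum>i<n. (cmod (c i))\<^sup>2)) \<longlonglongrightarrow> 0 + (\<Sum>i. ennreal ((cmod (c i))\<^sup>2))"
  proof (rule tendsto_add)
    show "(\<lambda>n. energy M (\<lambda>x. g x - psum c n x)) \<longlonglongrightarrow> 0"
      using g(2) by (subst energy_minus_commute)
    show "(\<lambda>n. ennreal (\<Sum>i<n. (cmod (c i))\<^sup>2)) \<longlonglongrightarrow> (\<Sum>i. ennreal ((cmod (c i))\<^sup>2))"
      using summable_LIMSEQ[OF summableI, of "\<lambda>i. ennreal ((cmod (c i))\<^sup>2)"] by simp
  qed
  moreover have "energy M (\<lambda>x. g x - psum c n x) + ennreal (\<Sum>i<n. (cmod (c i))\<^sup>2) = energy M g" for n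
  proof -
    have "0 \<le> (norm_L2 M g)\<^sup>2 - (\<Sum>i<n. (cmod (c i))\<^sup>2)"
      using norm_diff_psum[OF g(1), of n c] coeff by (metis zero_le_power2)
    then show ?thesis
      by (simp add: energy_L2 L2_diff psum_L2 g norm_diff_psum coeff sum_nonneg flip: ennreal_plus)
  qed
  ultimately have "energy M g = (\<Sum>i. ennreal ((cmod (c i))\<^sup>2))"
    by (simp add: LIMSEQ_const_iff)
  with g coeff show ?thesis by (intro that)
qed

end

section \<open>Fourier analysis on the line\<close>

definition trig_null :: "(real \<Rightarrow> complex) \<Rightarrow> bool" where
  "trig_null F \<longleftrightarrow> integrable lborel F \<and> (\<forall>k::int. (LINT x|lborel. F x * cis (2 * pi * of_int k * x)) = 0)"

lemma cmod_mult_cis [simp]: "cmod (a * cis b) = cmod a"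
  by (simp add: norm_mult)

lemma integrable_mult_cis:
  assumes "integrable M F" "g \<in> borel_measurable M"
  shows "integrable M (\<lambda>x. F x * cis (g x))"
  by (rule Bochner_Integration.integrable_bound[OF assms(1)])
     (use assms in \<open>auto intro: borel_measurable_times borel_measurable_integrable\<close>)

lemma trig_null_add: "trig_null F \<Longrightarrow> trig_null G \<Longrightarrow> trig_null (\<lambda>x. F x + G x)"
  unfolding trig_null_def by (auto simp: ring_distribs integrable_mult_cis)

lemma trig_null_cmult: "trig_null F \<Longrightarrow> trig_null (\<lambda>x. c * F x)"
  unfolding trig_null_def by (auto simp: mult.assoc)

lemma trig_null_cis:
  assumes "trig_null F" shows "trig_null (\<lambda>x. F x * cis (2 * pi * of_int j * x))"
  unfolding trig_null_def
proof (intro conjI allI)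
  show "integrable lborel (\<lambda>x. F x * cis (2 * pi * of_int j * x))"
    using assms by (auto simp: trig_null_def intro: integrable_mult_cis)
  fix k
  have "(LINT x|lborel. F x * cis (2 * pi * of_int (j + k) * x)) = 0"
    using assms unfolding trig_null_def by blast
  then show "(LINT x|lborel. F x * cis (2 * pi * of_int j * x) * cis (2 * pi * of_int k * x)) = 0"
    by (simp add: mult.assoc cis_mult algebra_simps)
qed

text \<open>F stays arbitrary in the induction because in the product case multiplication by the
  first factor produces the F for the second. On the circle a linear functional is a combination of
  cis y and cis (-y) by Euler's formula, and these only shift the index of a coefficient.\<close>

lemma trig_null_polynomial:
  assumes "real_polynomial_function g" "trig_null F"
  shows "trig_null (\<lambda>x. F x * of_real (g (cis (2 * pi * x))))"
  using assms
proof (induction g arbitrary: F rule: real_polynomial_function.induct)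
  case prem: (linear g)
  interpret bounded_linear g by (rule prem(1))
  have eq: "of_real (g (cis y)) = cis y * of_real (g 1) / 2 + cis (-y) * of_real (g 1) / 2
      + cis y * (of_real (g \<i>) / (2 * \<i>)) - cis (-y) * (of_real (g \<i>) / (2 * \<i>))" for y
  proof -
    have "cis y = cos y *\<^sub>R 1 + sin y *\<^sub>R \<i>" by (simp add: complex_eq_iff)
    then have "g (cis y) = cos y * g 1 + sin y * g \<i>" by (metis add scaleR real_scaleR_def)
    moreover have "complex_of_real (cos y) = (cis y + cis (-y)) / 2"
      "complex_of_real (sin y) = (cis y - cis (-y)) / (2 * \<i>)" by (simp_all add: complex_eq_iff)
    ultimately show ?thesis
      by (simp only: of_real_add of_real_mult) (simp add: algebra_simps diff_divide_distrib add_divide_distrib)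
  qed
  have "F x * of_real (g (cis (2 * pi * x))) =
     (of_real (g 1) / 2 + of_real (g \<i>) / (2 * \<i>)) * (F x * cis (2 * pi * of_int 1 * x)) +
     (of_real (g 1) / 2 - of_real (g \<i>) / (2 * \<i>)) * (F x * cis (2 * pi * of_int (-1) * x))" for x
    by (simp only: eq) (simp add: algebra_simps)
  then show ?case
    by (simp only:) (intro trig_null_add trig_null_cmult trig_null_cis prem(2))
next
  case (const c)
  then show ?case by (subst mult.commute) (rule trig_null_cmult)
next
  case (add f g)
  then show ?case by (auto simp: ring_distribs intro!: trig_null_add)
next
  case (mult f g)
  from mult.IH(2)[OF mult.IH(1)[OF mult.prems]] show ?case by (simp add: mult.assoc)
qed

lemma trig_null_integral_0: "trig_null F \<Longrightarrow> (LINT x|lborel. F x) = 0"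
  unfolding trig_null_def by (elim conjE allE[where x=0]) simp

text \<open>Stone-Weierstrass on the unit circle: a polynomial within e of c integrates to 0 against
  F, so the integral is at most e times the L1 norm of F, for every e > 0.\<close>

lemma trig_null_continuous:
  assumes F: "trig_null F" and c: "continuous_on UNIV c"
  shows "(LINT x|lborel. F x * of_real (c (cis (2 * pi * x)) :: real)) = 0"
proof -
  have [measurable]: "c \<in> borel_measurable borel" using c by (rule borel_measurable_continuous_onI)
  have int: "integrable lborel F" using F by (simp add: trig_null_def)
  have Fm [measurable]: "F \<in> borel_measurable borel" using int by (auto dest: borel_measurable_integrable)
  let ?I = "LINT x|lborel. F x * of_real (c (cis (2 * pi * x)))"
  let ?N = "LINT x|lborel. cmod (F x)"
  have "cmod ?I \<le> e * ?N" if e: "e > 0" for e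
  proof -
    obtain g where g: "real_polynomial_function g" "\<And>x. x \<in> sphere 0 1 \<Longrightarrow> \<bar>c x - g x\<bar> < e"
      using Stone_Weierstrass_real_polynomial_function[OF _ _ e, of "sphere (0::complex) 1" c]
        continuous_on_subset[OF c] by auto
    have gnull: "trig_null (\<lambda>x. F x * of_real (g (cis (2 * pi * x))))"
      by (rule trig_null_polynomial[OF g(1) F])
    have gm: "integrable lborel (\<lambda>x. F x * of_real (g (cis (2 * pi * x))))"
      using gnull by (simp add: trig_null_def)
    have bnd: "cmod (F x * of_real (c (cis (2 * pi * x))) - F x * of_real (g (cis (2 * pi * x)))) \<le> e * cmod (F x)" for x
    proof -
      have "\<bar>c (cis (2 * pi * x)) - g (cis (2 * pi * x))\<bar> \<le> e" using g(2)[of "cis (2 * pi * x)"] by simp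
      then have "cmod (F x) * \<bar>c (cis (2 * pi * x)) - g (cis (2 * pi * x))\<bar> \<le> cmod (F x) * e"
        by (rule mult_left_mono) auto
      then show ?thesis
        by (simp add: right_diff_distrib[symmetric] norm_mult mult.commute flip: of_real_diff)
    qed
    have dint: "integrable lborel (\<lambda>x. F x * of_real (c (cis (2 * pi * x))) - F x * of_real (g (cis (2 * pi * x))))"
    proof (rule Bochner_Integration.integrable_bound)
      show "integrable lborel (\<lambda>x. e * cmod (F x))" using int by auto
      show "AE x in lborel. cmod (F x * of_real (c (cis (2 * pi * x))) - F x * of_real (g (cis (2 * pi * x)))) \<le> norm (e * cmod (F x))"
        using bnd e by (auto simp: abs_mult)
    qed (use borel_measurable_integrable[OF gm] in measurable)
    have "integrable lborel (\<lambda>x. F x * of_real (c (cis (2 * pi * x))))"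
      using Bochner_Integration.integrable_add[OF dint gm] by simp
    then have "?I = (LINT x|lborel. F x * of_real (c (cis (2 * pi * x))) - F x * of_real (g (cis (2 * pi * x))))"
      using gm trig_null_integral_0[OF gnull] by simp
    also have "cmod \<dots> \<le> (LINT x|lborel. e * cmod (F x))"
      by (rule Bochner_Integration.integral_norm_bound_integral) (use dint int bnd in auto)
    finally show ?thesis by simp
  qed
  then have "cmod ?I \<le> 0 * ?N"
    by (intro tendsto_lowerbound[where f="\<lambda>e. e * ?N" and F="at_right 0"] tendsto_intros)
       (auto simp: eventually_at_right_less eventually_mono[OF eventually_at_right_less])
  then show ?thesis by simp
qed

text \<open>The functions min 1 (n * infdist w (- U)) are continuous and increase to the indicator
  of U, and dominated convergence applies with bound |F|. The case U = UNIV stands apart because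
  \<open>infdist\<close> to the empty set is 0.\<close>

lemma trig_null_open:
  assumes F: "trig_null F" and U: "open U"
  shows "(LINT x|lborel. F x * indicator U (cis (2 * pi * x))) = 0"
proof (cases "U = UNIV")
  case True
  then show ?thesis using trig_null_integral_0[OF F] by simp
next
  case False
  then have ne: "- U \<noteq> {}" by auto
  have int: "integrable lborel F" using F by (simp add: trig_null_def)
  have Fm [measurable]: "F \<in> borel_measurable borel" using int by (auto dest: borel_measurable_integrable)
  define c where "c n w = min 1 (real n * infdist w (- U))" for n w
  have cc: "continuous_on UNIV (c n)" for n
    unfolding c_def by (intro continuous_intros)
  have [measurable]: "c n \<in> borel_measurable borel" for n using cc by (rule borel_measurable_continuous_onI)
  have [measurable]: "U \<in> sets borel" using U by simp
  have lim: "(\<lambda>n. c n w) \<longlonglongrightarrow> indicator U w" for w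
  proof (cases "w \<in> U")
    case True
    have "infdist w (- U) > 0"
      using True ne U infdist_nonneg[of w "- U"] in_closed_iff_infdist_zero[of "- U" w]
      by (auto simp: closed_Compl less_le)
    then obtain N where N: "1 \<le> real N * infdist w (- U)"
      using real_arch_simple[of "1 / infdist w (- U)"] by (auto simp: field_simps)
    have "c n w = 1" if "n \<ge> N" for n
    proof -
      have "real N * infdist w (- U) \<le> real n * infdist w (- U)"
        using that infdist_nonneg by (intro mult_right_mono) auto
      with N show ?thesis by (simp add: c_def)
    qed
    then have "\<forall>\<^sub>F n in sequentially. c n w = 1" by (auto simp: eventually_sequentially)
    then show ?thesis using True by (simp add: tendsto_eventually)
  next
    case False
    then show ?thesis by (simp add: c_def)
  qed
  have "(\<lambda>n. LINT x|lborel. F x * of_real (c n (cis (2 * pi * x)))) \<longlonglongrightarrow> (LINT x|lborel. F x * of_real (indicator U (cis (2 * pi * x))))"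
  proof (rule integral_dominated_convergence[where w="\<lambda>x. cmod (F x)"])
    show "AE x in lborel. (\<lambda>n. F x * of_real (c n (cis (2 * pi * x)))) \<longlonglongrightarrow> F x * of_real (indicator U (cis (2 * pi * x)))"
      by (intro AE_I2 tendsto_intros lim)
    show "AE x in lborel. cmod (F x * of_real (c n (cis (2 * pi * x)))) \<le> cmod (F x)" for n
      by (intro AE_I2) (auto simp: norm_mult c_def infdist_nonneg intro!: mult_right_le_one_le)
  qed (use int in auto)
  then have "(LINT x|lborel. F x * of_real (indicator U (cis (2 * pi * x)))) = 0"
    by (simp add: trig_null_continuous[OF F cc] LIMSEQ_const_iff)
  moreover have "complex_of_real (indicator U w) = indicator U w" for w
    by (simp add: indicator_def)
  ultimately show ?thesis by simp
qed

text \<open>It is enough that the integral of F over every Borel set vanishes. Open sets come from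
  \<open>trig_null_open\<close> by wrapping the unit interval around the circle; they are stable
  under intersection and generate the Borel sets.\<close>

lemma Fourier_unique:
  assumes F: "trig_null F" and supp: "\<And>x. x \<notin> {0..<1} \<Longrightarrow> F x = 0"
  shows "AE x in lborel. F x = 0"
proof (rule sigma_finite_measure.density_zero[OF sigma_finite_lborel])
  show int: "integrable lborel F" using F by (simp add: trig_null_def)
  have Fm [measurable]: "F \<in> borel_measurable borel" using int by (auto dest: borel_measurable_integrable)
  have intA: "set_integrable lborel A F" if "A \<in> sets borel" for A
    unfolding set_integrable_def using that int
    by (intro integrable_mult_indicator) auto
  have ae0: "AE x in lborel. x \<noteq> (0::real)" by (rule AE_lborel_singleton)
  have op: "(LINT x:A|lborel. F x) = 0" if A: "open A" for A
  proof -
    \<comment> \<open>The image of A on the circle, cut at the point 1, where \<open>Arg2pi\<close>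
      jumps. The cut corresponds to x = 0, a null set, and U is open because \<open>Arg2pi\<close>
      is continuous off the nonnegative reals.\<close>
    define U where "U = {w \<in> - \<real>\<^sub>\<ge>\<^sub>0. Arg2pi w \<in> (\<lambda>x. 2 * pi * x) ` A}"
    have "open ((*) (2 * pi) ` A)" using open_scaling[of "2 * pi" A] A by simp
    moreover have "continuous_on (- \<real>\<^sub>\<ge>\<^sub>0) Arg2pi"
      by (auto intro!: continuous_at_imp_continuous_on continuous_at_Arg2pi)
    moreover have "open (- \<real>\<^sub>\<ge>\<^sub>0 :: complex set)" by (intro open_Compl closed_nonneg_Reals_complex)
    ultimately have "open (- \<real>\<^sub>\<ge>\<^sub>0 \<inter> Arg2pi -` ((*) (2 * pi) ` A))"
      by (intro continuous_open_preimage)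
    also have "- \<real>\<^sub>\<ge>\<^sub>0 \<inter> Arg2pi -` ((*) (2 * pi) ` A) = U"
      by (auto simp: U_def)
    finally have "open U" .
    have "cis (2 * pi * x) \<in> U \<longleftrightarrow> x \<in> A" if "x \<in> {0<..<1}" for x
    proof -
      have arg: "Arg2pi (cis (2 * pi * x)) = 2 * pi * x"
        by (rule Arg2pi_unique[of 1]) (use that in \<open>auto simp: cis_conv_exp mult.commute\<close>)
      then have "cis (2 * pi * x) \<notin> \<real>\<^sub>\<ge>\<^sub>0"
        using that Arg2pi_eq_0[of "cis (2 * pi * x)"] by (auto simp: complex_nonneg_Reals_iff complex_is_Real_iff)
      then show ?thesis by (auto simp: U_def arg)
    qed
    then have eq: "AE x in lborel. F x * indicator U (cis (2 * pi * x)) = indicator A x *\<^sub>R F x"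
      using ae0
    proof (elim AE_mp, intro AE_I2 impI)
      fix x :: real assume *: "\<And>x. x \<in> {0<..<1} \<Longrightarrow> (cis (2 * pi * x) \<in> U) = (x \<in> A)" "x \<noteq> 0"
      then show "F x * indicator U (cis (2 * pi * x)) = indicator A x *\<^sub>R F x"
        using supp[of x] by (cases "x \<in> {0<..<1}") (auto simp: indicator_def)
    qed
    have [measurable]: "U \<in> sets borel" "A \<in> sets borel" using \<open>open U\<close> A by auto
    have "(LINT x:A|lborel. F x) = (LINT x|lborel. F x * indicator U (cis (2 * pi * x)))"
      unfolding set_lebesgue_integral_def using eq by (intro integral_cong_AE) auto
    with trig_null_open[OF F \<open>open U\<close>] show ?thesis by simp
  qed
  fix A :: "real set" assume "A \<in> sets lborel"
  then have "A \<in> sigma_sets UNIV {S. open S}" by (simp add: borel_def)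
  then show "(LINT x:A|lborel. F x) = 0"
  proof (induction A rule: sigma_sets_induct_disjoint[rotated 2, consumes 1, case_names basic empty compl union stable sub])
    case (compl A)
    then have A [measurable]: "A \<in> sets borel" by (simp add: borel_def)
    have "(LINT x:(A \<union> (UNIV - A))|lborel. F x) = (LINT x:A|lborel. F x) + (LINT x:(UNIV - A)|lborel. F x)"
      by (rule set_integral_Un) (auto intro!: intA)
    moreover have "(LINT x:(A \<union> (UNIV - A))|lborel. F x) = 0"
      using op[of UNIV] by simp
    ultimately show ?case using compl by simp
  next
    case (union A)
    then have A [measurable]: "A i \<in> sets borel" for i by (auto simp: borel_def)
    have "(LINT x:(\<Union>i. A i)|lborel. F x) = (\<Sum>i. (LINT x:(A i)|lborel. F x))"
      by (rule lebesgue_integral_countable_add) (use union in \<open>auto simp: disjoint_family_on_def intro!: intA\<close>)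
    then show ?case using union by simp
  qed (auto simp: Int_stable_def intro: op)
qed

subsection \<open>Fourier series\<close>

text \<open>The cut-off to one period keeps everything on \<open>lborel\<close>, so that the
  orthonormal system can be paired with functions on the whole line.\<close>

definition trig :: "int \<Rightarrow> real \<Rightarrow> complex" where
  "trig k x = indicator {0..<1} x * cis (2 * pi * of_int k * x)"

lemma trig_measurable [measurable]: "trig k \<in> borel_measurable borel"
  unfolding trig_def by measurable

lemma trig_L2: "trig k \<in> L2 lborel"
proof -
  have "energy lborel (trig k) = (\<integral>\<^sup>+x. indicator {0..<1::real} x \<partial>lborel)"
    unfolding energy_def trig_def by (intro nn_integral_cong) (auto simp: indicator_def)
  then show ?thesis by (simp add: L2_iff)
qed

lemma integral_trig: "(LINT x|lborel. trig k x) = (if k = 0 then 1 else 0)"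
proof -
  have ae: "AE x in lborel. x \<noteq> (1::real)" by (rule AE_lborel_singleton)
  have "(LINT x|lborel. trig k x) = (LINT x|lborel. indicator {0..1} x *\<^sub>R cis (2 * pi * of_int k * x))"
    by (intro integral_cong_AE) (use ae in \<open>auto simp: trig_def indicator_def elim!: eventually_mono\<close>)
  also have "\<dots> = (if k = 0 then 1 else 0)"
  proof (cases "k = 0")
    case True
    then show ?thesis using integral_FTC_Icc[of 0 1 "\<lambda>x. of_real x" "\<lambda>x. 1::complex"]
      by (auto intro!: derivative_eq_intros)
  next
    case False
    let ?F = "\<lambda>x. cis (2 * pi * of_int k * x) / (2 * pi * of_int k * \<i>)"
    have "(LINT x|lborel. indicator {0..1} x *\<^sub>R cis (2 * pi * of_int k * x)) = ?F 1 - ?F 0"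
    proof (rule integral_FTC_Icc)
      fix x :: real
      show "(?F has_vector_derivative cis (2 * pi * of_int k * x)) (at x within {0..1})"
        unfolding cis_conv_exp
        by (rule has_vector_derivative_real_field derivative_eq_intros refl | simp add: False)+
    qed (auto intro!: continuous_intros)
    also have "\<dots> = 0"
      using cis_multiple_2pi[of "of_int k"] by (simp add: mult.commute)
    finally show ?thesis using False by simp
  qed
  finally show ?thesis .
qed

lemma inner_trig: "inner_L2 lborel (trig j) (trig k) = (if j = k then 1 else 0)"
proof -
  have "trig j x * cnj (trig k x) = trig (j - k) x" for x
    by (auto simp: trig_def indicator_def cis_cnj cis_mult algebra_simps)
  then show ?thesis by (simp add: inner_L2_def integral_trig)
qed

lemma suminf_int_decode:
  fixes f :: "int \<Rightarrow> ennreal"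
  shows "(\<Sum>i. f (int_decode i)) = (\<integral>\<^sup>+k. f k \<partial>count_space UNIV)"
  using nn_integral_bij_count_space[OF bij_int_decode, of f] by (simp add: nn_integral_count_space_nat)

lemma nn_integral_uminus_int:
  fixes f :: "int \<Rightarrow> ennreal"
  shows "(\<integral>\<^sup>+k. f (- k) \<partial>count_space UNIV) = (\<integral>\<^sup>+k. f k \<partial>count_space UNIV)"
  by (rule nn_integral_bij_count_space) (auto simp: bij_betw_def inj_def intro: surjI[of _ uminus])

interpretation trig: orthonormal_seq lborel "\<lambda>i. trig (int_decode i)"
  by unfold_locales (auto simp: trig_L2 inner_trig int_decode_eq)

text \<open>Both sides may be infinite. If the coefficients are not square summable, Bessel's
  inequality excludes F from L2. If they are, Riesz-Fischer yields a g in L2 with the same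
  coefficients, and uniqueness identifies F with g on the interval.\<close>

lemma Fourier_series_Parseval:
  assumes F: "integrable lborel F" and supp: "\<And>x. x \<notin> {0..<1} \<Longrightarrow> F x = 0"
  shows "(\<integral>\<^sup>+k. ennreal ((cmod (LINT x|lborel. F x * cis (- 2 * pi * of_int k * x)))\<^sup>2) \<partial>count_space (UNIV :: int set)) = energy lborel F"
proof -
  define c where "c k = (LINT x|lborel. F x * cis (- 2 * pi * of_int k * x))" for k :: int
  have Fm [measurable]: "F \<in> borel_measurable borel" using F by (auto dest: borel_measurable_integrable)
  have inner_c: "inner_L2 lborel F (trig k) = c k" for k
    unfolding inner_L2_def c_def
    by (intro Bochner_Integration.integral_cong refl) (use supp in \<open>auto simp: trig_def cis_cnj indicator_def\<close>)
  have "(\<Sum>i. ennreal ((cmod (c (int_decode i)))\<^sup>2)) = energy lborel F"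
  proof (cases "summable (\<lambda>i. (cmod (c (int_decode i)))\<^sup>2)")
    case True
    from trig.Riesz_Fischer[OF this] obtain g where g: "g \<in> L2 lborel"
      "\<And>i. inner_L2 lborel g (trig (int_decode i)) = c (int_decode i)"
      "energy lborel g = (\<Sum>i. ennreal ((cmod (c (int_decode i)))\<^sup>2))" by blast
    have g2: "inner_L2 lborel g (trig k) = c k" for k
      using g(2)[of "int_encode k"] by simp
    have [measurable]: "g \<in> borel_measurable borel" using L2_measurable[OF g(1)] by simp
    define G where "G x = F x - indicator {0..<1} x * g x" for x
    have ind: "(\<lambda>x. indicator {0..<1} x * g x) = (\<lambda>x. g x * cnj (trig 0 x))"
      by (auto simp: trig_def indicator_def)
    have gi: "integrable lborel (\<lambda>x. indicator {0..<1} x * g x)"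
      unfolding ind by (rule integrable_L2_inner[OF g(1) trig_L2])
    have "trig_null G" unfolding trig_null_def
    proof (intro conjI allI)
      show "integrable lborel G" unfolding G_def using F gi by auto
      fix k
      have "(LINT x|lborel. G x * cis (2 * pi * of_int k * x)) =
        (LINT x|lborel. F x * cis (2 * pi * of_int k * x)) - (LINT x|lborel. indicator {0..<1} x * g x * cis (2 * pi * of_int k * x))"
        unfolding G_def using F gi by (simp add: left_diff_distrib integrable_mult_cis)
      also have "(LINT x|lborel. indicator {0..<1} x * g x * cis (2 * pi * of_int k * x)) = inner_L2 lborel g (trig (-k))"
        unfolding inner_L2_def
        by (intro Bochner_Integration.integral_cong refl) (auto simp: trig_def cis_cnj indicator_def)
      also have "(LINT x|lborel. F x * cis (2 * pi * of_int k * x)) = c (-k)"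
        by (simp add: c_def)
      finally show "(LINT x|lborel. G x * cis (2 * pi * of_int k * x)) = 0" by (simp add: g2)
    qed
    from Fourier_unique[OF this] have ae: "AE x in lborel. F x = indicator {0..<1} x * g x"
      by (auto simp: G_def supp)
    have "energy lborel F = energy lborel (\<lambda>x. indicator {0..<1} x * g x)"
      by (rule energy_cong_AE[OF ae])
    also have "\<dots> \<le> energy lborel g"
      unfolding energy_def by (intro nn_integral_mono) (auto simp: indicator_def)
    finally have le: "energy lborel F \<le> energy lborel g" .
    \<comment> \<open>Only now is F known to be square integrable, which makes Bessel's inequality
      available for the reverse estimate.\<close>
    then have "F \<in> L2 lborel" using g(1) by (auto simp: L2_iff intro: le_less_trans)
    from trig.Bessel[OF this] have "(\<Sum>i. ennreal ((cmod (c (int_decode i)))\<^sup>2)) \<le> energy lborel F"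
      unfolding inner_c .
    with le[unfolded g(3)] show ?thesis by (rule antisym[rotated])
  next
    case False
    then have top: "(\<Sum>i. ennreal ((cmod (c (int_decode i)))\<^sup>2)) = \<infinity>"
      by (metis infinity_ennreal_def summable_suminf_not_top zero_le_power2)
    have "F \<notin> L2 lborel"
    proof
      assume F2: "F \<in> L2 lborel"
      with trig.Bessel[OF F2] top show False unfolding inner_c L2_iff by auto
    qed
    then have "\<not> energy lborel F < \<infinity>" unfolding L2_iff by auto
    then have "energy lborel F = \<infinity>" unfolding infinity_ennreal_def less_top[symmetric] by blast
    with top show ?thesis by metis
  qed
  then show ?thesis using suminf_int_decode[of "\<lambda>k. ennreal ((cmod (c k))\<^sup>2)"] by (simp only: c_def)
qed

lemma Fourier_series_Parseval':
  assumes F: "integrable lborel F" and supp: "\<And>x. x \<notin> {0..<1} \<Longrightarrow> F x = 0"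
  shows "(\<integral>\<^sup>+k. ennreal ((cmod (LINT x|lborel. F x * cis (2 * pi * of_int k * x)))\<^sup>2) \<partial>count_space (UNIV :: int set)) = energy lborel F"
  using Fourier_series_Parseval[OF assms] nn_integral_uminus_int[of "\<lambda>k. ennreal ((cmod (LINT x|lborel. F x * cis (2 * pi * of_int k * x)))\<^sup>2)"]
  by simp

subsection \<open>Periodization\<close>

lemma floor_unique_iff: "x - of_int k \<in> {0..<1} \<longleftrightarrow> k = \<lfloor>x::real\<rfloor>"
  by (simp add: eq_commute[of k] floor_eq_iff) linarith

lemma nn_integral_periodize:
  fixes f :: "real \<Rightarrow> ennreal"
  assumes [measurable]: "f \<in> borel_measurable borel"
  shows "(\<integral>\<^sup>+x. f x \<partial>lborel) = (\<integral>\<^sup>+x. indicator {0..<1} x * (\<integral>\<^sup>+k. f (x + of_int k) \<partial>count_space (UNIV :: int set)) \<partial>lborel)"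
proof -
  have "(\<integral>\<^sup>+x. indicator {0..<1} x * (\<integral>\<^sup>+k. f (x + of_int k) \<partial>count_space (UNIV :: int set)) \<partial>lborel)
     = (\<integral>\<^sup>+x. (\<integral>\<^sup>+k. indicator {0..<1} x * f (x + of_int k) \<partial>count_space (UNIV :: int set)) \<partial>lborel)"
    by (simp add: nn_integral_cmult)
  also have "\<dots> = (\<integral>\<^sup>+k. \<integral>\<^sup>+x. indicator {0..<1} x * f (x + of_int k) \<partial>lborel \<partial>count_space (UNIV :: int set))"
    by (rule nn_integral_count_space_nn_integral) auto
  also have "\<dots> = (\<integral>\<^sup>+k. \<integral>\<^sup>+x. indicator {0..<1} (x - of_int k) * f x \<partial>lborel \<partial>count_space (UNIV :: int set))"
  proof (rule nn_integral_cong)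
    fix k :: int
    show "(\<integral>\<^sup>+x. indicator {0..<1} x * f (x + of_int k) \<partial>lborel) = (\<integral>\<^sup>+x. indicator {0..<1} (x - of_int k) * f x \<partial>lborel)"
      by (subst nn_integral_real_affine[where c=1 and t="of_int k"]) (auto simp: add.commute)
  qed
  also have "\<dots> = (\<integral>\<^sup>+x. \<integral>\<^sup>+k. indicator {0..<1} (x - of_int k) * f x \<partial>count_space (UNIV :: int set) \<partial>lborel)"
    by (rule nn_integral_count_space_nn_integral[symmetric]) auto
  also have "\<dots> = (\<integral>\<^sup>+x. f x \<partial>lborel)"
  proof (rule nn_integral_cong)
    fix x :: real
    have "indicator {0..<1} (x - of_int k) = (indicator {\<lfloor>x\<rfloor>} k :: ennreal)" for k
      using floor_unique_iff[of x k] by (auto simp: indicator_def)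
    then show "(\<integral>\<^sup>+k. indicator {0..<1} (x - of_int k) * f x \<partial>count_space (UNIV :: int set)) = f x"
      by (simp add: nn_integral_multc)
  qed
  finally show ?thesis by simp
qed

text \<open>Enumerating the integers by natural numbers allows sums over \<int> to be taken with
  \<open>suminf\<close>.\<close>

abbreviation int_enum :: "nat \<Rightarrow> real" where "int_enum i \<equiv> of_int (int_decode i)"

definition periodize :: "(real \<Rightarrow> complex) \<Rightarrow> real \<Rightarrow> complex" where
  "periodize H x = indicator {0..<1} x * (\<Sum>i. H (x + int_enum i))"

lemma periodize_measurable [measurable]:
  assumes [measurable]: "H \<in> borel_measurable borel"
  shows "periodize H \<in> borel_measurable borel"
  unfolding periodize_def by measurable

text \<open>\<open>h i\<close> is the restriction of H to the i-th unit interval and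
  \<open>f i\<close> the same piece moved back to [0, 1). The L1 norms of the pieces add up to that
  of H, which gives absolute convergence almost everywhere and integration term by term.\<close>

lemma
  assumes H: "integrable lborel H"
  shows AE_summable_periodize: "AE x in lborel. x \<in> {0..<1} \<longrightarrow> summable (\<lambda>i. norm (H (x + int_enum i)))"
    and integrable_periodize: "integrable lborel (periodize H)"
    and integral_periodize: "(LINT x|lborel. periodize H x) = (LINT x|lborel. H x)"
proof -
  have [measurable]: "H \<in> borel_measurable borel" using H by (auto dest: borel_measurable_integrable)
  define f where "f i x = indicator {0..<1} x * H (x + int_enum i)" for i x
  define h where "h i x = indicator {0..<1} (x - int_enum i) * H x" for i x
  have [measurable]: "f i \<in> borel_measurable borel" "h i \<in> borel_measurable borel" for i
    unfolding f_def h_def by auto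
  have hi: "integrable lborel (h i)" for i
    by (rule Bochner_Integration.integrable_bound[OF H]) (auto simp: h_def indicator_def)
  have fh: "f i = (\<lambda>x. h i (int_enum i + 1 * x))" for i by (simp add: f_def h_def add.commute fun_eq_iff)
  have fi: "integrable lborel (f i)" for i
    using lborel_integrable_real_affine[OF hi[of i], where c=1 and t="int_enum i"] by (simp only: fh)
  have int_fh: "(LINT x|lborel. f i x) = (LINT x|lborel. h i x)" for i
    using lborel_integral_real_affine[of 1 "h i" "int_enum i"] by (simp only: fh) simp
  have int_norm: "(LINT x|lborel. norm (f i x)) = (LINT x|lborel. norm (h i x))" for i
    using lborel_integral_real_affine[of 1 "\<lambda>x. norm (h i x)" "int_enum i"] by (simp only: fh) simp
  have h_single: "h i x = (if i = int_encode \<lfloor>x\<rfloor> then H x else 0)" for i x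
    using floor_unique_iff[of x "int_decode i"]
    by (auto simp: h_def indicator_def) (metis int_decode_inverse int_encode_inverse)+
  have hs: "(\<lambda>i. h i x) sums H x" for x
    unfolding h_single using sums_single[of "int_encode \<lfloor>x\<rfloor>" "\<lambda>_. H x"] by simp
  have hns: "(\<lambda>i. norm (h i x)) sums norm (H x)" for x
    unfolding h_single using sums_single[of "int_encode \<lfloor>x\<rfloor>" "\<lambda>_. norm (H x)"]
    by (simp add: if_distrib[of norm] cong: if_cong)
  have nn: "(\<Sum>i. \<integral>\<^sup>+x. norm (h i x) \<partial>lborel) = (\<integral>\<^sup>+x. norm (H x) \<partial>lborel)"
  proof -
    have "(\<Sum>i. \<integral>\<^sup>+x. norm (h i x) \<partial>lborel) = (\<integral>\<^sup>+x. (\<Sum>i. ennreal (norm (h i x))) \<partial>lborel)"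
      by (rule nn_integral_suminf[symmetric]) auto
    also have "\<dots> = (\<integral>\<^sup>+x. norm (H x) \<partial>lborel)"
      using hns by (intro nn_integral_cong suminf_ennreal_eq) auto
    finally show ?thesis .
  qed
  have fin: "(\<integral>\<^sup>+x. norm (H x) \<partial>lborel) < \<infinity>" using H by (simp add: integrable_iff_bounded)
  have sum_norm: "summable (\<lambda>i. LINT x|lborel. norm (h i x))"
  proof (rule summable_suminf_not_top)
    show "(\<Sum>i. ennreal (LINT x|lborel. norm (h i x))) \<noteq> top"
      using nn fin nn_integral_eq_integral[OF integrable_norm[OF hi]] by auto
  qed auto
  have "(\<integral>\<^sup>+x. (\<Sum>i. ennreal (norm (f i x))) \<partial>lborel) = (\<Sum>i. \<integral>\<^sup>+x. norm (f i x) \<partial>lborel)"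
    by (rule nn_integral_suminf) auto
  also have "\<dots> = (\<Sum>i. \<integral>\<^sup>+x. norm (h i x) \<partial>lborel)"
    using nn_integral_eq_integral[OF integrable_norm[OF hi]] nn_integral_eq_integral[OF integrable_norm[OF fi]]
    by (simp add: int_norm)
  also have "\<dots> < \<infinity>" using nn fin by simp
  finally have "AE x in lborel. (\<Sum>i. ennreal (norm (f i x))) \<noteq> \<infinity>"
    by (intro nn_integral_noteq_infinite) auto
  then have sf: "AE x in lborel. summable (\<lambda>i. norm (f i x))"
    by eventually_elim (auto intro: summable_suminf_not_top)
  then show "AE x in lborel. x \<in> {0..<1} \<longrightarrow> summable (\<lambda>i. norm (H (x + int_enum i)))"
    by eventually_elim (auto simp: f_def)
  have pf: "periodize H x = (\<Sum>i. f i x)" for x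
    by (cases "x \<in> {0..<1}") (simp_all add: periodize_def f_def)
  have sn: "summable (\<lambda>i. LINT x|lborel. norm (f i x))" using sum_norm by (simp add: int_norm)
  show "integrable lborel (periodize H)"
    unfolding pf[abs_def] by (rule integrable_suminf[OF fi sf sn])
  have "(LINT x|lborel. periodize H x) = (\<Sum>i. LINT x|lborel. f i x)"
    unfolding pf[abs_def] by (rule integral_suminf[OF fi sf sn])
  also have "\<dots> = (\<Sum>i. LINT x|lborel. h i x)" by (simp add: int_fh)
  also have "\<dots> = (LINT x|lborel. (\<Sum>i. h i x))"
    by (rule integral_suminf[OF hi _ sum_norm, symmetric]) (use hns in \<open>auto intro: sums_summable\<close>)
  also have "\<dots> = (LINT x|lborel. H x)" using hs by (simp add: sums_iff)
  finally show "(LINT x|lborel. periodize H x) = (LINT x|lborel. H x)" .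
qed

lemma cis_add_int: "cis (2 * pi * of_int k * (x + of_int j)) = cis (2 * pi * of_int k * x)"
proof -
  have "cis (2 * pi * of_int k * (x + of_int j)) = cis (2 * pi * of_int k * x) * cis (2 * pi * of_int (k * j))"
    by (simp add: cis_mult algebra_simps)
  then show ?thesis using cis_multiple_2pi[of "of_int (k * j)"] by simp
qed

text \<open>An exponential of integer frequency has period 1, so periodization commutes with
  multiplication by it. Hence the Fourier transform of G at an integer is a Fourier coefficient of
  \<open>periodize G\<close>.\<close>

lemma periodize_Parseval':
  assumes G: "integrable lborel G"
  shows "(\<integral>\<^sup>+k. ennreal ((cmod (LINT x|lborel. G x * cis (2 * pi * of_int k * x)))\<^sup>2) \<partial>count_space (UNIV :: int set)) = energy lborel (periodize G)"
proof -
  have "(LINT x|lborel. G x * cis (2 * pi * of_int k * x)) = (LINT x|lborel. periodize G x * cis (2 * pi * of_int k * x))" for k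
  proof -
    have [measurable]: "G \<in> borel_measurable borel" using G by (auto dest: borel_measurable_integrable)
    have *: "periodize (\<lambda>x. G x * cis (2 * pi * of_int k * x)) x = periodize G x * cis (2 * pi * of_int k * x)"
      if "summable (\<lambda>i. norm (G (x + int_enum i)))" for x
      unfolding periodize_def cis_add_int using suminf_mult2[OF summable_norm_cancel[OF that], of "cis (2 * pi * of_int k * x)"]
      by (simp add: mult.assoc)
    have ae: "AE x in lborel. periodize (\<lambda>x. G x * cis (2 * pi * of_int k * x)) x = periodize G x * cis (2 * pi * of_int k * x)"
      using AE_summable_periodize[OF G]
    proof eventually_elim
      case (elim x)
      then show ?case using *[of x] by (cases "x \<in> {0..<1}") (auto simp: periodize_def)
    qed
    have "(LINT x|lborel. G x * cis (2 * pi * of_int k * x)) = (LINT x|lborel. periodize (\<lambda>x. G x * cis (2 * pi * of_int k * x)) x)"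
      by (rule integral_periodize[symmetric]) (intro integrable_mult_cis G, simp)
    also have "\<dots> = (LINT x|lborel. periodize G x * cis (2 * pi * of_int k * x))"
      using ae by (intro integral_cong_AE) auto
    finally show ?thesis .
  qed
  then show ?thesis
    using Fourier_series_Parseval'[OF integrable_periodize[OF G]] by (simp add: periodize_def)
qed

lemma periodize_Parseval:
  assumes G: "integrable lborel G"
  shows "(\<integral>\<^sup>+k. ennreal ((cmod (LINT x|lborel. G x * cis (- 2 * pi * of_int k * x)))\<^sup>2) \<partial>count_space (UNIV :: int set)) = energy lborel (periodize G)"
  using periodize_Parseval'[OF assms] nn_integral_uminus_int[of "\<lambda>k. ennreal ((cmod (LINT x|lborel. G x * cis (2 * pi * of_int k * x)))\<^sup>2)"]
  by simp

subsection \<open>The Plancherel theorem on the line\<close>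

text \<open>Absolute summability permits integration term by term, so the Fourier coefficients of
  the sum are the \<open>c i\<close> and Parseval's identity applies.\<close>

lemma energy_trig_series:
  assumes c: "summable (\<lambda>i. norm (c i))"
  shows "energy lborel (\<lambda>\<omega>. indicator {0..<1} \<omega> * (\<Sum>i. c i * cis (2 * pi * \<omega> * int_enum i))) = (\<Sum>i. ennreal ((cmod (c i))\<^sup>2))"
proof -
  \<comment> \<open>Multiplication by the exponential of frequency -k is built in as a shift of the
    index, so one family serves for all Fourier coefficients; k = 0 gives the series itself.\<close>
  define f where "f k i x = c i * trig (int_decode i - k) x" for k i x
  have fint: "integrable lborel (f k i)" for k i
  proof -
    have "integrable lborel (\<lambda>x. trig (int_decode i - k) x * trig 0 x)" by (intro integrable_L2_mult trig_L2)
    also have "(\<lambda>x. trig (int_decode i - k) x * trig 0 x) = trig (int_decode i - k)"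
      by (auto simp: trig_def indicator_def)
    finally show ?thesis unfolding f_def by auto
  qed
  have nf: "norm (f k i x) = norm (c i) * indicator {0..<1} x" for k i x
    by (simp add: f_def trig_def norm_mult indicator_def)
  have sf: "AE x in lborel. summable (\<lambda>i. norm (f k i x))" for k
    unfolding nf using c by (intro AE_I2 summable_mult2)
  have sn: "summable (\<lambda>i. LINT x|lborel. norm (f k i x))" for k
    unfolding nf using c by (simp add: summable_mult2)
  define F where "F \<omega> = indicator {0..<1} \<omega> * (\<Sum>i. c i * cis (2 * pi * \<omega> * int_enum i))" for \<omega>
  have Ff: "F x * cis (- 2 * pi * of_int k * x) = (\<Sum>i. f k i x)" for k x
  proof (cases "x \<in> {0..<1}")
    case True
    have "summable (\<lambda>i. c i * cis (2 * pi * x * int_enum i))"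
      by (rule summable_norm_cancel) (simp add: norm_mult c)
    from suminf_mult2[OF this, of "cis (- 2 * pi * of_int k * x)"]
    show ?thesis using True by (simp add: F_def f_def trig_def mult.assoc cis_mult algebra_simps)
  qed (simp add: F_def f_def trig_def)
  have Fint: "integrable lborel F"
  proof -
    have "F = (\<lambda>x. \<Sum>i. f 0 i x)" by (rule ext) (use Ff[of _ 0] in simp)
    then show ?thesis using integrable_suminf[OF fint sf sn, of 0] by simp
  qed
  have coeff: "(LINT x|lborel. F x * cis (- 2 * pi * of_int k * x)) = c (int_encode k)" for k
  proof -
    have "(LINT x|lborel. F x * cis (- 2 * pi * of_int k * x)) = (\<Sum>i. LINT x|lborel. f k i x)"
      unfolding Ff by (rule integral_suminf[OF fint sf sn])
    also have "\<dots> = (\<Sum>i. if i = int_encode k then c i else 0)"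
      by (intro suminf_cong) (auto simp: f_def integral_trig)
    also have "\<dots> = c (int_encode k)"
      using sums_single[of "int_encode k" c] by (simp add: sums_iff)
    finally show ?thesis .
  qed
  have "energy lborel F = (\<integral>\<^sup>+k. ennreal ((cmod (c (int_encode k)))\<^sup>2) \<partial>count_space UNIV)"
    using Fourier_series_Parseval[OF Fint] unfolding coeff by (simp add: F_def)
  also have "\<dots> = (\<Sum>i. ennreal ((cmod (c i))\<^sup>2))"
    by (simp add: suminf_int_decode[symmetric])
  finally show ?thesis unfolding F_def[abs_def] .
qed

text \<open>The sign in the exponent is positive, as in the central character of
  \<open>schroedinger\<close>.\<close>

definition fourier_line :: "(real \<Rightarrow> complex) \<Rightarrow> real \<Rightarrow> complex" where
  "fourier_line G \<omega> = (LINT x|lborel. G x * cis (2 * pi * \<omega> * x))"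

lemma fourier_line_measurable [measurable]:
  assumes [measurable]: "G \<in> borel_measurable borel"
  shows "fourier_line G \<in> borel_measurable borel"
  unfolding fourier_line_def by measurable

text \<open>The periodization of G times the exponential of frequency \<omega> is the Zak transform
  of G. As a function of x its Fourier coefficients are the values of \<open>fourier_line G\<close>
  at \<omega> + k; as a function of \<omega> it is, up to a phase, a Fourier series with
  coefficients G (x + n). Computing its energy over the unit square in both orders gives the
  identity.\<close>

lemma Plancherel_line:
  assumes G: "integrable lborel G"
  shows "energy lborel (fourier_line G) = energy lborel G"
proof -
  have [measurable]: "G \<in> borel_measurable borel" using G by (auto dest: borel_measurable_integrable)
  have shift: "fourier_line G (\<omega> + of_int k) = (LINT x|lborel. (G x * cis (2 * pi * \<omega> * x)) * cis (2 * pi * of_int k * x))" for \<omega> k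
    unfolding fourier_line_def by (simp add: mult.assoc cis_mult ring_distribs)
  have "energy lborel (fourier_line G) = (\<integral>\<^sup>+\<omega>. indicator {0..<1} \<omega> * (\<integral>\<^sup>+k. ennreal ((cmod (fourier_line G (\<omega> + of_int k)))\<^sup>2) \<partial>count_space (UNIV :: int set)) \<partial>lborel)"
    unfolding energy_def by (rule nn_integral_periodize) auto
  also have "\<dots> = (\<integral>\<^sup>+\<omega>. indicator {0..<1} \<omega> * energy lborel (periodize (\<lambda>x. G x * cis (2 * pi * \<omega> * x))) \<partial>lborel)"
    unfolding shift by (intro nn_integral_cong) (simp add: periodize_Parseval' integrable_mult_cis G)
  also have "\<dots> = (\<integral>\<^sup>+\<omega>. \<integral>\<^sup>+x. indicator {0..<1} \<omega> * ennreal ((cmod (periodize (\<lambda>x. G x * cis (2 * pi * \<omega> * x)) x))\<^sup>2) \<partial>lborel \<partial>lborel)"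
    unfolding energy_def by (simp add: nn_integral_cmult)
  also have "\<dots> = (\<integral>\<^sup>+x. \<integral>\<^sup>+\<omega>. indicator {0..<1} \<omega> * ennreal ((cmod (periodize (\<lambda>x. G x * cis (2 * pi * \<omega> * x)) x))\<^sup>2) \<partial>lborel \<partial>lborel)"
    unfolding periodize_def by (rule lborel_pair.Fubini') measurable
  also have "\<dots> = (\<integral>\<^sup>+x. indicator {0..<1} x * (\<integral>\<^sup>+k. ennreal ((cmod (G (x + of_int k)))\<^sup>2) \<partial>count_space (UNIV :: int set)) \<partial>lborel)"
  proof (rule nn_integral_cong_AE, use AE_summable_periodize[OF G] in eventually_elim)
    case (elim x)
    show ?case
    proof (cases "x \<in> {0..<1}")
      case True
      with elim have s: "summable (\<lambda>i. norm (G (x + int_enum i)))" by simp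
      have "periodize (\<lambda>x. G x * cis (2 * pi * \<omega> * x)) x = cis (2 * pi * \<omega> * x) * (\<Sum>i. G (x + int_enum i) * cis (2 * pi * \<omega> * int_enum i))" for \<omega>
      proof -
        have "summable (\<lambda>i. G (x + int_enum i) * cis (2 * pi * \<omega> * int_enum i))"
          by (rule summable_norm_cancel) (simp add: norm_mult s)
        from suminf_mult[OF this, of "cis (2 * pi * \<omega> * x)"] show ?thesis
          using True by (simp add: periodize_def ring_distribs cis_mult[symmetric] mult_ac)
      qed
      then have "(\<integral>\<^sup>+\<omega>. indicator {0..<1} \<omega> * ennreal ((cmod (periodize (\<lambda>x. G x * cis (2 * pi * \<omega> * x)) x))\<^sup>2) \<partial>lborel)
        = energy lborel (\<lambda>\<omega>. indicator {0..<1} \<omega> * (\<Sum>i. G (x + int_enum i) * cis (2 * pi * \<omega> * int_enum i)))"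
        unfolding energy_def by (intro nn_integral_cong) (auto simp: norm_mult indicator_def)
      also have "\<dots> = (\<integral>\<^sup>+k. ennreal ((cmod (G (x + of_int k)))\<^sup>2) \<partial>count_space (UNIV :: int set))"
        unfolding energy_trig_series[OF s] by (rule suminf_int_decode)
      finally show ?thesis using True by simp
    qed (simp add: periodize_def)
  qed
  also have "\<dots> = energy lborel G"
    unfolding energy_def by (rule nn_integral_periodize[symmetric]) auto
  finally show ?thesis .
qed

lemma energy_reflect:
  assumes [measurable]: "F \<in> borel_measurable borel"
  shows "energy lborel (\<lambda>x::real. F (- x)) = energy lborel F"
  unfolding energy_def
  by (subst (2) nn_integral_real_affine[where c="-1" and t=0]) auto

subsection \<open>An orthonormal basis of the line\<close>

text \<open>Gives a meaning to the choice in \<open>hs_norm_sq\<close>. The basis consists of the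
  exponentials on [0, 1) translated by integers; its totality reduces to uniqueness of Fourier
  coefficients on each unit interval.\<close>

lemma orthonormal_basis_exists: "\<exists>e. orthonormal_basis e"
proof -
  define e where "e i x = trig (int_decode (fst (prod_decode i))) (x - int_enum (snd (prod_decode i)))" for i x
  have [measurable]: "e i \<in> borel_measurable borel" for i unfolding e_def by measurable
  have L2: "e i \<in> L2 lborel" for i
  proof -
    have "energy lborel (e i) = energy lborel (trig (int_decode (fst (prod_decode i))))"
      unfolding energy_def e_def
      by (subst (2) nn_integral_real_affine[where c=1 and t="- int_enum (snd (prod_decode i))"]) auto
    then show ?thesis using trig_L2[of "int_decode (fst (prod_decode i))"] by (simp add: L2_iff)
  qed
  have orth: "inner_L2 lborel (e i) (e j) = (if i = j then 1 else 0)" for i j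
  proof (cases "snd (prod_decode i) = snd (prod_decode j)")
    case True
    have "inner_L2 lborel (e i) (e j) = inner_L2 lborel (trig (int_decode (fst (prod_decode i)))) (trig (int_decode (fst (prod_decode j))))"
      unfolding inner_L2_def e_def True
      by (subst (2) lborel_integral_real_affine[where c=1 and t="- int_enum (snd (prod_decode j))"]) auto
    moreover have "fst (prod_decode i) = fst (prod_decode j) \<longleftrightarrow> i = j"
      using True by (metis prod.expand prod_decode_inverse)
    ultimately show ?thesis by (simp add: inner_trig int_decode_eq)
  next
    case False
    have "\<not> (x - int_enum (snd (prod_decode i)) \<in> {0..<1} \<and> x - int_enum (snd (prod_decode j)) \<in> {0..<1})" for x
      unfolding floor_unique_iff using False by (metis int_decode_eq)
    then have "e i x * cnj (e j x) = 0" for x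
      unfolding e_def trig_def by (auto simp: indicator_def)
    then have "inner_L2 lborel (e i) (e j) = (LINT x|(lborel :: real measure). (0 :: complex))"
      unfolding inner_L2_def by (simp only:)
    moreover have "i \<noteq> j" using False by auto
    ultimately show ?thesis by simp
  qed
  have total: "AE t in lborel. \<phi> t = 0" if \<phi>: "\<phi> \<in> L2 lborel" and 0: "\<And>i. inner_L2 lborel \<phi> (e i) = 0" for \<phi>
  proof -
    have [measurable]: "\<phi> \<in> borel_measurable borel" using L2_measurable[OF \<phi>] by simp
    have "AE t in lborel. \<phi> t * indicator {0..<1} (t - of_int n) = 0" for n :: int
    proof -
      define F where "F x = indicator {0..<1} x * \<phi> (x + of_int n)" for x
      have [measurable]: "F \<in> borel_measurable borel" unfolding F_def by measurable
      \<comment> \<open>The frequency -k appears because the inner product conjugates the basis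
        element.\<close>
      have eq: "F x * cis (2 * pi * of_int k * x) = (\<lambda>x. \<phi> x * cnj (e (prod_encode (int_encode (-k), int_encode n)) x)) (of_int n + 1 * x)" for k x
        by (auto simp: F_def e_def trig_def indicator_def cis_cnj add.commute)
      have "trig_null F" unfolding trig_null_def
      proof (intro conjI allI)
        show "integrable lborel F"
          using lborel_integrable_real_affine[OF integrable_L2_inner[OF \<phi> L2], of 1 "of_int n" "prod_encode (int_encode (-0), int_encode n)"] 
          unfolding eq[symmetric] by simp
        show "(LINT x|lborel. F x * cis (2 * pi * of_int k * x)) = 0" for k
          using 0[of "prod_encode (int_encode (-k), int_encode n)"] unfolding inner_L2_def eq
          by (subst (asm) lborel_integral_real_affine[where c=1 and t="of_int n"]) auto
      qed
      from Fourier_unique[OF this] have "AE x in lborel. F x = 0" by (auto simp: F_def)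
      then have "AE x in lborel. F ((- of_int n) + 1 * x) = 0"
        by (rule AE_borel_affine[where P="\<lambda>x. F x = 0", rotated 2]) auto
      then show ?thesis by eventually_elim (auto simp: F_def)
    qed
    then have "AE t in lborel. \<forall>n::int. \<phi> t * indicator {0..<1} (t - of_int n) = 0"
      unfolding AE_all_countable by (rule allI)
    then show ?thesis
    proof eventually_elim
      case (elim t)
      have "t - of_int \<lfloor>t\<rfloor> \<in> {0..<1}" by (simp only: floor_unique_iff)
      then show ?case using spec[OF elim, of "\<lfloor>t\<rfloor>"] by simp
    qed
  qed
  show ?thesis unfolding orthonormal_basis_def using L2 orth total by blast
qed

section \<open>The Plancherel transform in coordinates\<close>

lemma borel_measurable_fst_borel [measurable]: "fst \<in> borel_measurable borel"
  by (intro borel_measurable_continuous_onI continuous_intros)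

lemma borel_measurable_snd_borel [measurable]: "snd \<in> borel_measurable borel"
  by (intro borel_measurable_continuous_onI continuous_intros)

lemma nn_integral_lborel_pair:
  fixes f :: "'a::euclidean_space \<times> 'b::euclidean_space \<Rightarrow> ennreal"
  assumes "f \<in> borel_measurable borel"
  shows "(\<integral>\<^sup>+p. f p \<partial>lborel) = (\<integral>\<^sup>+x. \<integral>\<^sup>+y. f (x, y) \<partial>lborel \<partial>lborel)"
proof -
  have "f \<in> borel_measurable (lborel \<Otimes>\<^sub>M lborel)" using assms by (simp add: lborel_prod)
  from lborel.nn_integral_fst[OF this] show ?thesis by (simp add: lborel_prod)
qed

lemma nn_integral_lborel_swap:
  fixes f :: "'a::euclidean_space \<Rightarrow> 'b::euclidean_space \<Rightarrow> ennreal"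
  assumes [measurable]: "case_prod f \<in> borel_measurable borel"
  shows "(\<integral>\<^sup>+x. \<integral>\<^sup>+y. f x y \<partial>lborel \<partial>lborel) = (\<integral>\<^sup>+y. \<integral>\<^sup>+x. f x y \<partial>lborel \<partial>lborel)"
proof (rule lborel_pair.Fubini'[symmetric])
  show "case_prod f \<in> borel_measurable (lborel \<Otimes>\<^sub>M lborel)" by (simp add: lborel_prod)
qed

lemma integrable_lborel_pair:
  fixes f :: "'a::euclidean_space \<times> 'b::euclidean_space \<Rightarrow> complex"
  assumes "integrable lborel f"
  shows "AE x in lborel. integrable lborel (\<lambda>y. f (x, y))"
    and "integrable lborel (\<lambda>x. LINT y|lborel. f (x, y))"
    and "(LINT x|lborel. LINT y|lborel. f (x, y)) = (LINT p|lborel. f p)"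
proof -
  have f: "integrable (lborel \<Otimes>\<^sub>M lborel) f" using assms by (simp add: lborel_prod)
  show "AE x in lborel. integrable lborel (\<lambda>y. f (x, y))" by (rule lborel_pair.AE_integrable_fst'[OF f])
  show "integrable lborel (\<lambda>x. LINT y|lborel. f (x, y))" by (rule lborel_pair.integrable_fst'[OF f])
  show "(LINT x|lborel. LINT y|lborel. f (x, y)) = (LINT p|lborel. f p)"
    using lborel_pair.integral_fst'[OF f] by (simp add: lborel_prod)
qed

text \<open>The signs are those of the two phases in \<open>schroedinger\<close>, with l for \<xi>
  and \<omega> for \<xi> * t.\<close>

definition fourier_plane :: "(real \<times> real \<Rightarrow> complex) \<Rightarrow> real \<Rightarrow> real \<Rightarrow> complex" where
  "fourier_plane h \<omega> l = (LINT p|lborel. h p * cis (2 * pi * (l * snd p - \<omega> * fst p)))"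

text \<open>The one-dimensional theorem is used twice: in y for every l, since Fubini makes
  \<open>h1 l\<close> integrable, then in z for almost every y.\<close>

lemma Plancherel_plane:
  assumes h: "integrable lborel h"
  shows "(\<integral>\<^sup>+l. \<integral>\<^sup>+\<omega>. ennreal ((cmod (fourier_plane h \<omega> l))\<^sup>2) \<partial>lborel \<partial>lborel) = energy lborel h"
proof -
  have [measurable]: "h \<in> borel_measurable borel" using h by (auto dest: borel_measurable_integrable)
  define h1 where "h1 l y = fourier_line (\<lambda>z. h (y, z)) l" for l y
  have h1m: "case_prod h1 \<in> borel_measurable borel" unfolding h1_def fourier_line_def by measurable
  then have [measurable]: "(\<lambda>q. h1 (fst q) (snd q)) \<in> borel_measurable borel" by (simp add: case_prod_beta')
  have h1i: "integrable lborel (h1 l)" and hat: "fourier_plane h \<omega> l = fourier_line (h1 l) (- \<omega>)" for l \<omega>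
  proof -
    have i1: "integrable lborel (\<lambda>p. h p * cis (2 * pi * (l * snd p)))"
      by (rule integrable_mult_cis[OF h]) auto
    from integrable_lborel_pair(2)[OF i1] show "integrable lborel (h1 l)"
      by (simp add: h1_def[abs_def] fourier_line_def mult.assoc)
    have i2: "integrable lborel (\<lambda>p. h p * cis (2 * pi * (l * snd p - \<omega> * fst p)))"
      by (rule integrable_mult_cis[OF h]) auto
    have "fourier_plane h \<omega> l = (LINT y|lborel. LINT z|lborel. (h (y, z) * cis (2 * pi * l * z)) * cis (2 * pi * (- \<omega>) * y))"
      unfolding fourier_plane_def integrable_lborel_pair(3)[OF i2, symmetric]
      by (intro Bochner_Integration.integral_cong refl) (simp add: mult.assoc cis_mult algebra_simps)
    also have "\<dots> = fourier_line (h1 l) (- \<omega>)"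
      unfolding h1_def fourier_line_def by simp
    finally show "fourier_plane h \<omega> l = fourier_line (h1 l) (- \<omega>)" .
  qed
  have "(\<integral>\<^sup>+l. \<integral>\<^sup>+\<omega>. ennreal ((cmod (fourier_plane h \<omega> l))\<^sup>2) \<partial>lborel \<partial>lborel) = (\<integral>\<^sup>+l. energy lborel (\<lambda>\<omega>. fourier_line (h1 l) (- \<omega>)) \<partial>lborel)"
    by (simp add: hat energy_def)
  also have "\<dots> = (\<integral>\<^sup>+l. energy lborel (h1 l) \<partial>lborel)"
    using h1i by (intro nn_integral_cong) (simp add: energy_reflect Plancherel_line borel_measurable_integrable)
  also have "\<dots> = (\<integral>\<^sup>+y. \<integral>\<^sup>+l. ennreal ((cmod (h1 l y))\<^sup>2) \<partial>lborel \<partial>lborel)"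
    unfolding energy_def by (rule nn_integral_lborel_swap) measurable
  also have "\<dots> = (\<integral>\<^sup>+y. energy lborel (\<lambda>z. h (y, z)) \<partial>lborel)"
  proof (rule nn_integral_cong_AE, use integrable_lborel_pair(1)[OF h] in eventually_elim)
    case (elim y)
    from Plancherel_line[OF this] show ?case by (simp add: h1_def energy_def)
  qed
  also have "\<dots> = energy lborel h"
    unfolding energy_def by (rule nn_integral_lborel_pair[symmetric]) measurable
  finally show ?thesis .
qed

text \<open>\<open>wkernel g (l, t, s)\<close> is \<open>sqrt \<bar>l\<bar>\<close> times the integral kernel at \<open>(t, s)\<close> of the Fourier transform of
  \<open>g\<close> at \<open>l\<close>; the factor absorbs the Plancherel weight.\<close>

definition wkernel :: "(real \<times> real \<times> real \<Rightarrow> complex) \<Rightarrow> real \<times> real \<times> real \<Rightarrow> complex" where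
  "wkernel g = (\<lambda>(l, t, s). of_real (sqrt \<bar>l\<bar>) * fourier_plane (\<lambda>p. g (t - s, p)) (l * t) l)"

lemma wkernel_apply: "wkernel g (l, t, s) = of_real (sqrt \<bar>l\<bar>) * fourier_plane (\<lambda>p. g (t - s, p)) (l * t) l"
  by (simp add: wkernel_def)

lemma wkernel_measurable [measurable]:
  assumes [measurable]: "g \<in> borel_measurable borel"
  shows "wkernel g \<in> borel_measurable borel"
  unfolding wkernel_def fourier_plane_def by measurable

text \<open>For fixed l and t the variable s is replaced by x = t - s, and for fixed l \<noteq> 0
  the variable t by \<omega> = l * t. The Jacobian |l| of the second substitution is the square of
  the weight in \<open>wkernel\<close>, and what remains is the planar theorem for almost every
  x.\<close>

lemma energy_wkernel:
  assumes g: "integrable lborel g"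
  shows "energy lborel (wkernel g) = energy lborel g"
proof -
  have [measurable]: "g \<in> borel_measurable borel" using g by (auto dest: borel_measurable_integrable)
  define \<Phi> where "\<Phi> x \<omega> l = ennreal ((cmod (fourier_plane (\<lambda>p. g (x, p)) \<omega> l))\<^sup>2)" for x \<omega> l
  have \<Phi>m [measurable]: "(\<lambda>(x, \<omega>, l). \<Phi> x \<omega> l) \<in> borel_measurable borel"
    unfolding \<Phi>_def fourier_plane_def by measurable
  have [measurable (raw)]: "(\<lambda>y. \<Phi> (X y) (O' y) (L y)) \<in> borel_measurable M"
    if "X \<in> borel_measurable M" "O' \<in> borel_measurable M" "L \<in> borel_measurable M" for X O' L and M :: "'z measure"
    using measurable_compose[OF _ \<Phi>m, of "\<lambda>y. (X y, O' y, L y)" M] that by simp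
  have "energy lborel (wkernel g) = (\<integral>\<^sup>+l. \<integral>\<^sup>+q. ennreal ((cmod (wkernel g (l, q)))\<^sup>2) \<partial>lborel \<partial>lborel)"
    unfolding energy_def by (rule nn_integral_lborel_pair) measurable
  also have "\<dots> = (\<integral>\<^sup>+l. \<integral>\<^sup>+t. \<integral>\<^sup>+s. ennreal ((cmod (wkernel g (l, t, s)))\<^sup>2) \<partial>lborel \<partial>lborel \<partial>lborel)"
    by (intro nn_integral_cong nn_integral_lborel_pair) measurable
  also have "\<dots> = (\<integral>\<^sup>+l. \<integral>\<^sup>+t. \<integral>\<^sup>+s. ennreal \<bar>l\<bar> * \<Phi> (t - s) (l * t) l \<partial>lborel \<partial>lborel \<partial>lborel)"
    by (simp add: wkernel_apply \<Phi>_def norm_mult power_mult_distrib ennreal_mult)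
  also have "\<dots> = (\<integral>\<^sup>+l. \<integral>\<^sup>+t. ennreal \<bar>l\<bar> * (\<integral>\<^sup>+x. \<Phi> x (l * t) l \<partial>lborel) \<partial>lborel \<partial>lborel)"
  proof (intro nn_integral_cong)
    fix l t :: real
    have "(\<integral>\<^sup>+s. ennreal \<bar>l\<bar> * \<Phi> (t - s) (l * t) l \<partial>lborel) = ennreal \<bar>l\<bar> * (\<integral>\<^sup>+s. \<Phi> (t - s) (l * t) l \<partial>lborel)"
      by (rule nn_integral_cmult) measurable
    also have "(\<integral>\<^sup>+s. \<Phi> (t - s) (l * t) l \<partial>lborel) = (\<integral>\<^sup>+x. \<Phi> x (l * t) l \<partial>lborel)"
      by (subst (2) nn_integral_real_affine[where c="-1" and t=t]) auto
    finally show "(\<integral>\<^sup>+s. ennreal \<bar>l\<bar> * \<Phi> (t - s) (l * t) l \<partial>lborel) = ennreal \<bar>l\<bar> * (\<integral>\<^sup>+x. \<Phi> x (l * t) l \<partial>lborel)" .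
  qed
  also have "\<dots> = (\<integral>\<^sup>+l. \<integral>\<^sup>+\<omega>. \<integral>\<^sup>+x. \<Phi> x \<omega> l \<partial>lborel \<partial>lborel \<partial>lborel)"
  proof (rule nn_integral_cong_AE, use AE_lborel_singleton[of 0] in eventually_elim)
    fix l :: real assume "l \<noteq> 0"
    then have "(\<integral>\<^sup>+\<omega>. \<integral>\<^sup>+x. \<Phi> x \<omega> l \<partial>lborel \<partial>lborel) = ennreal \<bar>l\<bar> * (\<integral>\<^sup>+t. \<integral>\<^sup>+x. \<Phi> x (l * t) l \<partial>lborel \<partial>lborel)"
      by (subst nn_integral_real_affine[where c=l and t=0]) auto
    then show "(\<integral>\<^sup>+t. ennreal \<bar>l\<bar> * (\<integral>\<^sup>+x. \<Phi> x (l * t) l \<partial>lborel) \<partial>lborel) = (\<integral>\<^sup>+\<omega>. \<integral>\<^sup>+x. \<Phi> x \<omega> l \<partial>lborel \<partial>lborel)"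
      by (subst nn_integral_cmult) auto
  qed
  also have "\<dots> = (\<integral>\<^sup>+l. \<integral>\<^sup>+x. \<integral>\<^sup>+\<omega>. \<Phi> x \<omega> l \<partial>lborel \<partial>lborel \<partial>lborel)"
    by (intro nn_integral_cong nn_integral_lborel_swap) measurable
  also have "\<dots> = (\<integral>\<^sup>+x. \<integral>\<^sup>+l. \<integral>\<^sup>+\<omega>. \<Phi> x \<omega> l \<partial>lborel \<partial>lborel \<partial>lborel)"
    by (rule nn_integral_lborel_swap) measurable
  also have "\<dots> = (\<integral>\<^sup>+x. energy lborel (\<lambda>p. g (x, p)) \<partial>lborel)"
  proof (rule nn_integral_cong_AE, use integrable_lborel_pair(1)[OF g] in eventually_elim)
    case (elim x)
    from Plancherel_plane[OF this] show ?case by (simp add: \<Phi>_def)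
  qed
  also have "\<dots> = energy lborel g"
    unfolding energy_def by (rule nn_integral_lborel_pair[symmetric]) measurable
  finally show ?thesis .
qed

text \<open>Sections g (x, .) are integrable only for almost every x, while the kernel at (l, t, s)
  involves x = t - s. The exceptional set pulls back to a null set since, for fixed t, the variable
  s enters by an affine map. The factor \<alpha> and the offset d serve the dilated and the
  translated kernels.\<close>

lemma AE_lborel_kernel:
  assumes "AE x in lborel. P x" and "\<alpha> \<noteq> (0::real)"
  shows "AE q in (lborel :: (real \<times> real \<times> real) measure). P (\<alpha> * (fst (snd q) - snd (snd q)) + d)"
proof -
  obtain N where N: "{x \<in> space lborel. \<not> P x} \<subseteq> N" "N \<in> null_sets lborel"
    using assms(1) unfolding eventually_ae_filter by blast
  have [measurable]: "N \<in> sets borel" using N(2) by auto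
  have "(\<integral>\<^sup>+q. indicator N (\<alpha> * (fst (snd q) - snd (snd q)) + d) \<partial>(lborel :: (real \<times> real \<times> real) measure))
    = (\<integral>\<^sup>+l. \<integral>\<^sup>+t. \<integral>\<^sup>+s. indicator N (\<alpha> * (t - s) + d) \<partial>lborel \<partial>lborel \<partial>(lborel :: real measure))"
    by (subst nn_integral_lborel_pair, measurable, intro nn_integral_cong, subst nn_integral_lborel_pair) auto
  also have "\<dots> = (\<integral>\<^sup>+l. \<integral>\<^sup>+t. 0 \<partial>(lborel :: real measure) \<partial>(lborel :: real measure))"
  proof (intro nn_integral_cong)
    fix t :: real
    have "0 = (\<integral>\<^sup>+x. indicator N x \<partial>lborel)" using N(2) by (simp add: null_sets_def)
    also have "\<dots> = ennreal \<bar>\<alpha>\<bar> * (\<integral>\<^sup>+s. indicator N (\<alpha> * (t - s) + d) \<partial>lborel)"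
      using assms(2) by (subst nn_integral_real_affine[where c="-\<alpha>" and t="\<alpha> * t + d"]) (auto simp: algebra_simps)
    finally show "(\<integral>\<^sup>+s. indicator N (\<alpha> * (t - s) + d) \<partial>lborel) = 0" using assms(2) by auto
  qed
  finally have "(\<integral>\<^sup>+q. indicator N (\<alpha> * (fst (snd q) - snd (snd q)) + d) \<partial>(lborel :: (real \<times> real \<times> real) measure)) = 0" by simp
  then have "AE q in (lborel :: (real \<times> real \<times> real) measure). indicator N (\<alpha> * (fst (snd q) - snd (snd q)) + d) = (0::ennreal)"
    by (subst (asm) nn_integral_0_iff_AE) auto
  then show ?thesis by eventually_elim (use N(1) in \<open>auto simp: indicator_def split: if_splits\<close>)
qed

lemma fourier_plane_add:
  assumes "integrable lborel g" "integrable lborel h"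
  shows "fourier_plane (\<lambda>p. g p + c * h p) \<omega> l = fourier_plane g \<omega> l + c * fourier_plane h \<omega> l"
proof -
  have "integrable lborel (\<lambda>p. g p * cis (2 * pi * (l * snd p - \<omega> * fst p)))"
    "integrable lborel (\<lambda>p. h p * cis (2 * pi * (l * snd p - \<omega> * fst p)))"
    using assms by (auto intro!: integrable_mult_cis)
  then show ?thesis unfolding fourier_plane_def by (simp add: ring_distribs mult.assoc)
qed

text \<open>Additivity holds where both sections at t - s are integrable, hence only almost
  everywhere.\<close>

lemma wkernel_add:
  assumes "integrable lborel g" "integrable lborel h"
  shows "AE q in lborel. wkernel (\<lambda>x. g x + c * h x) q = wkernel g q + c * wkernel h q"
proof -
  have *: "AE q in (lborel :: (real \<times> real \<times> real) measure). integrable lborel (\<lambda>y. f (fst (snd q) - snd (snd q), y))" if "integrable lborel f"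
    for f :: "real \<times> real \<times> real \<Rightarrow> complex"
    using AE_lborel_kernel[OF integrable_lborel_pair(1)[OF that], of 1 0] by simp
  show ?thesis
    using *[OF assms(1)] *[OF assms(2)]
  proof eventually_elim
    case (elim q)
    then show ?case by (cases q) (simp add: wkernel_apply fourier_plane_add ring_distribs)
  qed
qed

lemma energy_diff_wkernel:
  assumes "integrable lborel g" "integrable lborel h"
  shows "energy lborel (\<lambda>x. wkernel g x - wkernel h x) = energy lborel (\<lambda>x. g x - h x)"
proof -
  have "energy lborel (\<lambda>x. wkernel g x - wkernel h x) = energy lborel (wkernel (\<lambda>x. g x + (-1) * h x))"
    using wkernel_add[OF assms, of "-1"] by (intro energy_cong_AE) (auto elim!: eventually_mono)
  also have "\<dots> = energy lborel (\<lambda>x. g x + (-1) * h x)"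
    using assms by (intro energy_wkernel) auto
  finally show ?thesis by simp
qed

section \<open>Extension of the kernel transform to all of L2\<close>

lemma tendsto_norm_L2_sq:
  assumes "\<And>n. f n \<in> L2 M" "g \<in> L2 M" "(\<lambda>n. energy M (\<lambda>x. f n x - g x)) \<longlonglongrightarrow> 0"
  shows "(\<lambda>n. (norm_L2 M (f n))\<^sup>2) \<longlonglongrightarrow> (norm_L2 M g)\<^sup>2"
proof -
  define d where "d n x = f n x - g x" for n x
  have d: "d n \<in> L2 M" for n unfolding d_def by (intro L2_diff assms)
  have "(\<lambda>n. ennreal ((norm_L2 M (d n))\<^sup>2)) \<longlonglongrightarrow> ennreal 0"
    using assms(3) unfolding d_def[symmetric] by (simp add: energy_L2[OF d])
  then have nd: "(\<lambda>n. (norm_L2 M (d n))\<^sup>2) \<longlonglongrightarrow> 0" by (subst (asm) tendsto_ennreal_iff) auto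
  have bnd: "cmod (inner_L2 M g (d n)) \<le> norm_L2 M g * sqrt ((norm_L2 M (d n))\<^sup>2)" for n
  proof -
    have "ennreal ((cmod (inner_L2 M g (d n)))\<^sup>2) \<le> energy M g * energy M (d n)"
      by (rule Cauchy_Schwarz_inner) (auto intro: L2_measurable assms d)
    then have "(cmod (inner_L2 M g (d n)))\<^sup>2 \<le> (norm_L2 M g * norm_L2 M (d n))\<^sup>2"
      by (simp add: energy_L2 assms d power_mult_distrib flip: ennreal_mult)
    then have "cmod (inner_L2 M g (d n)) \<le> norm_L2 M g * norm_L2 M (d n)"
      by (rule power2_le_imp_le) (simp add: norm_L2_nonneg)
    then show ?thesis by (simp add: norm_L2_nonneg)
  qed
  have "(\<lambda>n. norm_L2 M g * sqrt ((norm_L2 M (d n))\<^sup>2)) \<longlonglongrightarrow> norm_L2 M g * sqrt 0"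
    by (intro tendsto_intros nd)
  then have lim0: "(\<lambda>n. norm_L2 M g * sqrt ((norm_L2 M (d n))\<^sup>2)) \<longlonglongrightarrow> 0"
    by (simp only: real_sqrt_zero mult_zero_right)
  have "(\<lambda>n. inner_L2 M g (d n)) \<longlonglongrightarrow> 0"
    by (rule Lim_null_comparison[OF _ lim0]) (rule always_eventually, rule allI, rule bnd)
  then have "(\<lambda>n. (norm_L2 M g)\<^sup>2 + (norm_L2 M (d n))\<^sup>2 + 2 * Re (inner_L2 M g (d n))) \<longlonglongrightarrow> (norm_L2 M g)\<^sup>2 + 0 + 2 * Re 0"
    by (intro tendsto_intros nd)
  moreover have "(norm_L2 M (f n))\<^sup>2 = (norm_L2 M g)\<^sup>2 + (norm_L2 M (d n))\<^sup>2 + 2 * Re (inner_L2 M g (d n))" for n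
    using norm_L2_add_sq[OF assms(2) d[of n]] by (simp add: d_def)
  ultimately show ?thesis by simp
qed

text \<open>The continuous extension of \<open>wkernel\<close> from integrable L2 functions to L2,
  with K determined up to a null set (\<open>ktransform_unique\<close>). The shape follows
  \<open>plancherel\<close>, so that one approximating sequence can be followed under both.\<close>

definition ktransform :: "(real \<times> real \<times> real \<Rightarrow> complex) \<Rightarrow> (real \<times> real \<times> real \<Rightarrow> complex) \<Rightarrow> bool" where
  "ktransform h K \<longleftrightarrow> h \<in> L2 lborel \<and> K \<in> L2 lborel \<and>
     (\<exists>g. (\<forall>n. g n \<in> L2 lborel \<and> integrable lborel (g n)) \<and>
        (\<lambda>n. energy lborel (\<lambda>x. g n x - h x)) \<longlonglongrightarrow> 0 \<and>
        (\<lambda>n. energy lborel (\<lambda>x. wkernel (g n) x - K x)) \<longlonglongrightarrow> 0)"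

lemma ktransform_E:
  assumes "ktransform h K"
  obtains g where "h \<in> L2 lborel" "K \<in> L2 lborel" "\<And>n. g n \<in> L2 lborel" "\<And>n. integrable lborel (g n)"
    "(\<lambda>n. energy lborel (\<lambda>x. g n x - h x)) \<longlonglongrightarrow> 0" "(\<lambda>n. energy lborel (\<lambda>x. wkernel (g n) x - K x)) \<longlonglongrightarrow> 0"
proof -
  from assms obtain g where "h \<in> L2 lborel" "K \<in> L2 lborel" "\<forall>n. g n \<in> L2 lborel \<and> integrable lborel (g n)"
    "(\<lambda>n. energy lborel (\<lambda>x. g n x - h x)) \<longlonglongrightarrow> 0" "(\<lambda>n. energy lborel (\<lambda>x. wkernel (g n) x - K x)) \<longlonglongrightarrow> 0"
    unfolding ktransform_def by (elim conjE exE) (rule that)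
  then show thesis by (intro that[of g]) simp_all
qed

lemma ktransform_I:
  assumes "h \<in> L2 lborel" "K \<in> L2 lborel" "\<And>n. g n \<in> L2 lborel" "\<And>n. integrable lborel (g n)"
    "(\<lambda>n. energy lborel (\<lambda>x. g n x - h x)) \<longlonglongrightarrow> 0" "(\<lambda>n. energy lborel (\<lambda>x. wkernel (g n) x - K x)) \<longlonglongrightarrow> 0"
  shows "ktransform h K"
proof -
  have "\<forall>n. g n \<in> L2 lborel \<and> integrable lborel (g n)" using assms(3,4) by (rule allI[OF conjI])
  with assms(1,2,5,6) show ?thesis unfolding ktransform_def by (intro conjI exI[of _ g])
qed

lemma wkernel_L2: "g \<in> L2 lborel \<Longrightarrow> integrable lborel g \<Longrightarrow> wkernel g \<in> L2 lborel"
  by (simp add: L2_iff energy_wkernel)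

text \<open>Convergence along the given sequence is part of the conclusion because in the comparison
  with \<open>plancherel\<close> the sequence is prescribed.\<close>

lemma ktransform_of_approx:
  assumes h: "h \<in> L2 lborel" and g: "\<And>n. g n \<in> L2 lborel" "\<And>n. integrable lborel (g n)"
    and lim: "(\<lambda>n. energy lborel (\<lambda>x. g n x - h x)) \<longlonglongrightarrow> 0"
  obtains K where "ktransform h K" "(\<lambda>n. energy lborel (\<lambda>x. wkernel (g n) x - K x)) \<longlonglongrightarrow> 0"
proof -
  have [measurable]: "g n \<in> borel_measurable borel" "h \<in> borel_measurable borel" for n
    using L2_measurable[OF g(1)] L2_measurable[OF h] by auto
  have "\<exists>N. \<forall>m\<ge>N. \<forall>n\<ge>N. energy lborel (\<lambda>x. wkernel (g m) x - wkernel (g n) x) < ennreal e" if e: "e > 0" for e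
  proof -
    \<comment> \<open>Two errors below e / 5, each doubled by \<open>energy_diff_triangle\<close>,
      add up to at most 4/5 of e.\<close>
    have "\<forall>\<^sub>F n in sequentially. energy lborel (\<lambda>x. g n x - h x) < ennreal (e / 5)"
      using order_tendstoD(2)[OF lim, of "ennreal (e/5)"] e by simp
    then obtain N where N: "\<And>n. n \<ge> N \<Longrightarrow> energy lborel (\<lambda>x. g n x - h x) < ennreal (e / 5)"
      by (auto simp: eventually_sequentially)
    have "energy lborel (\<lambda>x. wkernel (g m) x - wkernel (g n) x) < ennreal e" if "m \<ge> N" "n \<ge> N" for m n
    proof -
      have "energy lborel (\<lambda>x. wkernel (g m) x - wkernel (g n) x) = energy lborel (\<lambda>x. g m x - g n x)"
        by (rule energy_diff_wkernel[OF g(2) g(2)])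
      also have "\<dots> \<le> 2 * energy lborel (\<lambda>x. g m x - h x) + 2 * energy lborel (\<lambda>x. h x - g n x)"
        by (rule energy_diff_triangle) auto
      also have "\<dots> \<le> 2 * ennreal (e / 5) + 2 * ennreal (e / 5)"
        using N[OF that(1)] N[OF that(2)]
        by (subst (2) energy_minus_commute) (intro add_mono mult_left_mono less_imp_le, auto)
      also have "\<dots> = ennreal (2 * (e / 5) + 2 * (e / 5))"
        using e by (subst ennreal_plus) (auto simp: ennreal_mult' ennreal_numeral[symmetric] simp del: ennreal_numeral times_divide_eq_right)
      also have "\<dots> < ennreal e" using e by (intro ennreal_lessI) auto
      finally show ?thesis .
    qed
    then show ?thesis by blast
  qed
  from L2_complete[OF wkernel_L2[OF g] this] obtain K where
    "K \<in> L2 lborel" "(\<lambda>n. energy lborel (\<lambda>x. wkernel (g n) x - K x)) \<longlonglongrightarrow> 0" by blast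
  with that show ?thesis using ktransform_I[OF h _ g lim] by blast
qed

text \<open>Restriction to growing balls; on a ball, Cauchy-Schwarz against the indicator gives
  integrability.\<close>

lemma L2_integrable_approx:
  fixes h :: "'a::euclidean_space \<Rightarrow> complex"
  assumes h: "h \<in> L2 lborel"
  obtains g where "\<And>n::nat. g n \<in> L2 lborel" "\<And>n. integrable lborel (g n)"
    "(\<lambda>n. energy lborel (\<lambda>x. g n x - h x)) \<longlonglongrightarrow> 0"
proof -
  have [measurable]: "h \<in> borel_measurable borel" using L2_measurable[OF h] by simp
  define g where "g n x = h x * indicator (cball 0 (real n)) x" for n x
  have [measurable]: "cball (0 :: 'a) r \<in> sets borel" for r by simp
  have [measurable]: "g n \<in> borel_measurable borel" for n unfolding g_def by measurable
  have gL: "g n \<in> L2 lborel" for n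
  proof -
    have "energy lborel (g n) \<le> energy lborel h"
      unfolding energy_def g_def by (intro nn_integral_mono) (auto simp: indicator_def)
    then show ?thesis using h by (auto simp: L2_iff intro: le_less_trans)
  qed
  have gi: "integrable lborel (g n)" for n
    unfolding g_def
  proof (rule integrable_L2_mult[OF h])
    have "energy lborel (indicator (cball 0 (real n)) :: 'a \<Rightarrow> complex) = (\<integral>\<^sup>+x. indicator (cball 0 (real n)) x \<partial>(lborel :: 'a measure))"
      unfolding energy_def by (intro nn_integral_cong) (auto simp: indicator_def)
    then show "(\<lambda>x. indicator (cball 0 (real n)) x) \<in> L2 (lborel :: 'a measure)"
      using emeasure_bounded_finite[of "cball 0 (real n) :: 'a set"] by (simp add: L2_iff)
  qed
  have "(\<lambda>n. \<integral>\<^sup>+x. ennreal ((cmod (g n x - h x))\<^sup>2) \<partial>lborel) \<longlonglongrightarrow> (\<integral>\<^sup>+x. 0 \<partial>(lborel :: 'a measure))"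
  proof (rule nn_integral_dominated_convergence[where w="\<lambda>x. ennreal ((cmod (h x))\<^sup>2)"])
    show "(\<integral>\<^sup>+x. ennreal ((cmod (h x))\<^sup>2) \<partial>lborel) < \<infinity>" using h by (simp add: L2_iff energy_def)
    show "AE x in lborel. (\<lambda>n. ennreal ((cmod (g n x - h x))\<^sup>2)) \<longlonglongrightarrow> 0"
    proof (rule AE_I2)
      fix x :: 'a
      obtain N where "norm x \<le> real N" using real_arch_simple by blast
      then have "g n x - h x = 0" if "n \<ge> N" for n using that by (auto simp: g_def)
      then have "\<forall>\<^sub>F n in sequentially. ennreal ((cmod (g n x - h x))\<^sup>2) = 0"
        unfolding eventually_sequentially by auto
      then show "(\<lambda>n. ennreal ((cmod (g n x - h x))\<^sup>2)) \<longlonglongrightarrow> 0" by (rule tendsto_eventually)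
    qed
  qed (auto simp: g_def indicator_def)
  then show ?thesis using that[OF gL gi] by (simp add: energy_def)
qed

lemma ktransform_exists:
  assumes "h \<in> L2 lborel" shows "\<exists>K. ktransform h K"
proof -
  obtain g where g: "\<And>n::nat. g n \<in> L2 lborel" "\<And>n. integrable lborel (g n)"
    "(\<lambda>n. energy lborel (\<lambda>x. g n x - h x)) \<longlonglongrightarrow> 0"
    by (fact L2_integrable_approx[OF assms])
  show ?thesis by (rule ktransform_of_approx[OF assms g]) (rule exI)
qed

lemma ktransform_norm:
  assumes "ktransform h K" shows "norm_L2 lborel K = norm_L2 lborel h"
proof -
  obtain g where g: "h \<in> L2 lborel" "K \<in> L2 lborel" "\<And>n. g n \<in> L2 lborel" "\<And>n. integrable lborel (g n)"
    "(\<lambda>n. energy lborel (\<lambda>x. g n x - h x)) \<longlonglongrightarrow> 0" "(\<lambda>n. energy lborel (\<lambda>x. wkernel (g n) x - K x)) \<longlonglongrightarrow> 0"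
    by (fact ktransform_E[OF assms])
  have "(norm_L2 lborel (wkernel (g n)))\<^sup>2 = (norm_L2 lborel (g n))\<^sup>2" for n
    using energy_wkernel[OF g(4)] L2_measurable[OF wkernel_L2[OF g(3,4)]] L2_measurable[OF g(3)]
    by (simp add: norm_L2_sq)
  with tendsto_norm_L2_sq[OF wkernel_L2[OF g(3,4)] g(2) g(6)] tendsto_norm_L2_sq[OF g(3) g(1) g(5)]
  have "(norm_L2 lborel K)\<^sup>2 = (norm_L2 lborel h)\<^sup>2" by (simp only:) (rule LIMSEQ_unique)
  then show ?thesis by (simp add: norm_L2_nonneg)
qed

lemma energy_tendsto_add_cmult:
  assumes "\<And>n. f n \<in> L2 M" "F \<in> L2 M" "\<And>n. g n \<in> L2 M" "G \<in> L2 M"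
    and "(\<lambda>n. energy M (\<lambda>x. f n x - F x)) \<longlonglongrightarrow> 0" "(\<lambda>n. energy M (\<lambda>x. g n x - G x)) \<longlonglongrightarrow> 0"
  shows "(\<lambda>n. energy M (\<lambda>x. (f n x + c * g n x) - (F x + c * G x))) \<longlonglongrightarrow> 0"
proof -
  have le: "energy M (\<lambda>x. (f n x + c * g n x) - (F x + c * G x)) \<le> 2 * energy M (\<lambda>x. f n x - F x) + 2 * (ennreal ((cmod c)\<^sup>2) * energy M (\<lambda>x. g n x - G x))" for n
  proof -
    have m: "f n \<in> borel_measurable M" "F \<in> borel_measurable M" "g n \<in> borel_measurable M" "G \<in> borel_measurable M"
      by (simp_all add: L2_measurable assms)
    have "energy M (\<lambda>x. (f n x + c * g n x) - (F x + c * G x)) = energy M (\<lambda>x. (f n x - F x) + c * (g n x - G x))"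
      by (simp add: right_diff_distrib add_diff_add)
    also have "\<dots> \<le> 2 * energy M (\<lambda>x. f n x - F x) + 2 * energy M (\<lambda>x. c * (g n x - G x))"
      using m by (intro energy_add_le) auto
    also have "energy M (\<lambda>x. c * (g n x - G x)) = ennreal ((cmod c)\<^sup>2) * energy M (\<lambda>x. g n x - G x)"
      by (rule energy_cmult) (use m in auto)
    finally show ?thesis .
  qed
  have "(\<lambda>n. 2 * energy M (\<lambda>x. f n x - F x) + 2 * (ennreal ((cmod c)\<^sup>2) * energy M (\<lambda>x. g n x - G x))) \<longlonglongrightarrow> 2 * 0 + 2 * (ennreal ((cmod c)\<^sup>2) * 0)"
    by (intro tendsto_add ennreal_tendsto_cmult assms) auto
  then have lim: "(\<lambda>n. 2 * energy M (\<lambda>x. f n x - F x) + 2 * (ennreal ((cmod c)\<^sup>2) * energy M (\<lambda>x. g n x - G x))) \<longlonglongrightarrow> 0"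
    by simp
  show ?thesis
    by (rule tendsto_sandwich[OF _ _ tendsto_const lim]) (use le in auto)
qed

lemma ktransform_add_cmult:
  assumes "ktransform h K" "ktransform h' K'"
  shows "ktransform (\<lambda>x. h x + c * h' x) (\<lambda>x. K x + c * K' x)"
proof -
  obtain g where g: "h \<in> L2 lborel" "K \<in> L2 lborel" "\<And>n. g n \<in> L2 lborel" "\<And>n. integrable lborel (g n)"
    "(\<lambda>n. energy lborel (\<lambda>x. g n x - h x)) \<longlonglongrightarrow> 0" "(\<lambda>n. energy lborel (\<lambda>x. wkernel (g n) x - K x)) \<longlonglongrightarrow> 0"
    by (fact ktransform_E[OF assms(1)])
  obtain g' where g': "h' \<in> L2 lborel" "K' \<in> L2 lborel" "\<And>n. g' n \<in> L2 lborel" "\<And>n. integrable lborel (g' n)"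
    "(\<lambda>n. energy lborel (\<lambda>x. g' n x - h' x)) \<longlonglongrightarrow> 0" "(\<lambda>n. energy lborel (\<lambda>x. wkernel (g' n) x - K' x)) \<longlonglongrightarrow> 0"
    by (fact ktransform_E[OF assms(2)])
  have "energy lborel (\<lambda>x. wkernel (\<lambda>y. g n y + c * g' n y) x - (K x + c * K' x)) = energy lborel (\<lambda>x. (wkernel (g n) x + c * wkernel (g' n) x) - (K x + c * K' x))" for n
    using wkernel_add[OF g(4) g'(4)] by (intro energy_cong_AE) (auto elim!: eventually_mono)
  then have "(\<lambda>n. energy lborel (\<lambda>x. wkernel (\<lambda>y. g n y + c * g' n y) x - (K x + c * K' x))) \<longlonglongrightarrow> 0"
    using energy_tendsto_add_cmult[OF wkernel_L2[OF g(3,4)] g(2) wkernel_L2[OF g'(3,4)] g'(2) g(6) g'(6)] by simp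
  moreover have "(\<lambda>n. energy lborel (\<lambda>x. (g n x + c * g' n x) - (h x + c * h' x))) \<longlonglongrightarrow> 0"
    by (rule energy_tendsto_add_cmult[OF g(3) g(1) g'(3) g'(1) g(5) g'(5)])
  moreover have "\<forall>n. (\<lambda>y. g n y + c * g' n y) \<in> L2 lborel \<and> integrable lborel (\<lambda>y. g n y + c * g' n y)"
    by (intro allI conjI L2_add L2_cmult Bochner_Integration.integrable_add integrable_mult_right g(3,4) g'(3,4))
  moreover have "(\<lambda>x. h x + c * h' x) \<in> L2 lborel" "(\<lambda>x. K x + c * K' x) \<in> L2 lborel"
    by (intro L2_add L2_cmult g(1,2) g'(1,2))+
  ultimately show ?thesis by (intro ktransform_I[where g="\<lambda>n y. g n y + c * g' n y"]) auto
qed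


lemma ktransform_L2: "ktransform h K \<Longrightarrow> h \<in> L2 lborel" "ktransform h K \<Longrightarrow> K \<in> L2 lborel"
  by (auto simp: ktransform_def)

lemma ktransform_energy: "ktransform h K \<Longrightarrow> energy lborel K = energy lborel h"
  using ktransform_norm[of h K] energy_L2[OF ktransform_L2(1)[of h K]] energy_L2[OF ktransform_L2(2)[of h K]] by metis

lemma ktransform_Re_inner:
  assumes "ktransform h K" "ktransform h' K'"
  shows "Re (inner_L2 lborel K K') = Re (inner_L2 lborel h h')"
proof -
  have "norm_L2 lborel (\<lambda>x. K x + K' x) = norm_L2 lborel (\<lambda>x. h x + h' x)"
    using ktransform_norm[OF ktransform_add_cmult[OF assms, of 1]] unfolding mult_1 .
  then show ?thesis
    unfolding Re_inner_polarization[OF ktransform_L2(2)[OF assms(1)] ktransform_L2(2)[OF assms(2)]]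
      Re_inner_polarization[OF ktransform_L2(1)[OF assms(1)] ktransform_L2(1)[OF assms(2)]]
    by (simp only: ktransform_norm[OF assms(1)] ktransform_norm[OF assms(2)])
qed

lemma ktransform_zero: "ktransform (\<lambda>x. 0) (\<lambda>x. 0)"
proof (rule ktransform_I[where g="\<lambda>n x. 0"])
  have "wkernel (\<lambda>x. 0) = (\<lambda>x. 0)" by (simp add: wkernel_def fourier_plane_def fun_eq_iff)
  then show "(\<lambda>n::nat. energy lborel (\<lambda>x. wkernel (\<lambda>x. 0) x - 0)) \<longlonglongrightarrow> 0" by (simp add: energy_def)
qed (simp_all add: L2_zero energy_def)

lemma ktransform_inner:
  assumes "ktransform h K" "ktransform h' K'"
  shows "inner_L2 lborel K K' = inner_L2 lborel h h'"
proof (rule complex_eqI)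
  show "Re (inner_L2 lborel K K') = Re (inner_L2 lborel h h')" by (rule ktransform_Re_inner[OF assms])
  have "ktransform (\<lambda>x. \<i> * h' x) (\<lambda>x. \<i> * K' x)" using ktransform_add_cmult[OF ktransform_zero assms(2), of \<i>] by simp
  from ktransform_Re_inner[OF assms(1) this] show "Im (inner_L2 lborel K K') = Im (inner_L2 lborel h h')"
    by (simp add: Im_inner_eq_Re)
qed

text \<open>The difference of two transforms of h is a transform of 0, and energy is
  preserved.\<close>

lemma ktransform_unique:
  assumes "ktransform h K" "ktransform h K'"
  shows "AE x in lborel. K x = K' x"
proof -
  have "ktransform (\<lambda>x. 0) (\<lambda>x. K x - K' x)" using ktransform_add_cmult[OF assms, of "-1"] by simp
  from ktransform_energy[OF this] L2_measurable[OF ktransform_L2(2)[OF this]] show ?thesis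
    using energy_eq_0_iff[of "\<lambda>x. K x - K' x" lborel] by (simp add: energy_def)
qed

text \<open>Covariance is checked on integrable functions, where \<open>wkernel\<close> is an honest
  integral, and passes to L2 because both weighted substitutions are isometric. Translations and
  dilations are the two instances.\<close>

lemma ktransform_transfer:
  assumes ktransform: "ktransform h K"
    and [measurable]: "\<phi> \<in> borel_measurable borel" "\<psi> \<in> borel_measurable borel" "\<phi>' \<in> borel_measurable borel" "\<psi>' \<in> borel_measurable borel"
    and iso: "\<And>f. f \<in> borel_measurable borel \<Longrightarrow> energy lborel (\<lambda>x. \<phi> x * f (\<psi> x)) = energy lborel f"
    and iso': "\<And>f. f \<in> borel_measurable borel \<Longrightarrow> energy lborel (\<lambda>x. \<phi>' x * f (\<psi>' x)) = energy lborel f"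
    and int: "\<And>g. integrable lborel g \<Longrightarrow> integrable lborel (\<lambda>x. \<phi> x * g (\<psi> x))"
    and wkernel: "\<And>g. integrable lborel g \<Longrightarrow> AE q in lborel. wkernel (\<lambda>x. \<phi> x * g (\<psi> x)) q = \<phi>' q * wkernel g (\<psi>' q)"
  shows "ktransform (\<lambda>x. \<phi> x * h (\<psi> x)) (\<lambda>x. \<phi>' x * K (\<psi>' x))"
proof -
  obtain g where g: "h \<in> L2 lborel" "K \<in> L2 lborel" "\<And>n. g n \<in> L2 lborel" "\<And>n. integrable lborel (g n)"
    "(\<lambda>n. energy lborel (\<lambda>x. g n x - h x)) \<longlonglongrightarrow> 0" "(\<lambda>n. energy lborel (\<lambda>x. wkernel (g n) x - K x)) \<longlonglongrightarrow> 0"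
    by (fact ktransform_E[OF ktransform])
  have L2: "(\<lambda>x. \<phi> x * f (\<psi> x)) \<in> L2 lborel" "(\<lambda>x. \<phi>' x * f (\<psi>' x)) \<in> L2 lborel" if "f \<in> L2 lborel" for f
  proof -
    have [measurable]: "f \<in> borel_measurable borel" using L2_measurable[OF that] by simp
    show "(\<lambda>x. \<phi> x * f (\<psi> x)) \<in> L2 lborel" "(\<lambda>x. \<phi>' x * f (\<psi>' x)) \<in> L2 lborel"
      using that by (auto simp: L2_iff iso iso')
  qed
  have m [measurable]: "g n \<in> borel_measurable borel" "h \<in> borel_measurable borel" "K \<in> borel_measurable borel" for n
    using L2_measurable[OF g(1)] L2_measurable[OF g(2)] L2_measurable[OF g(3)] by auto
  have "energy lborel (\<lambda>x. \<phi> x * g n (\<psi> x) - \<phi> x * h (\<psi> x)) = energy lborel (\<lambda>x. g n x - h x)" for n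
    using iso[of "\<lambda>x. g n x - h x"] by (simp add: right_diff_distrib)
  moreover have "energy lborel (\<lambda>q. wkernel (\<lambda>x. \<phi> x * g n (\<psi> x)) q - \<phi>' q * K (\<psi>' q)) = energy lborel (\<lambda>q. wkernel (g n) q - K q)" for n
  proof -
    have "energy lborel (\<lambda>q. wkernel (\<lambda>x. \<phi> x * g n (\<psi> x)) q - \<phi>' q * K (\<psi>' q)) = energy lborel (\<lambda>q. \<phi>' q * (wkernel (g n) (\<psi>' q) - K (\<psi>' q)))"
      using wkernel[OF g(4)[of n]] by (intro energy_cong_AE) (auto simp: right_diff_distrib elim!: eventually_mono)
    also have "\<dots> = energy lborel (\<lambda>q. wkernel (g n) q - K q)" by (rule iso') measurable
    finally show ?thesis .
  qed
  ultimately have "(\<lambda>n. energy lborel (\<lambda>x. \<phi> x * g n (\<psi> x) - \<phi> x * h (\<psi> x))) \<longlonglongrightarrow> 0"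
    "(\<lambda>n. energy lborel (\<lambda>q. wkernel (\<lambda>x. \<phi> x * g n (\<psi> x)) q - \<phi>' q * K (\<psi>' q))) \<longlonglongrightarrow> 0"
    using g(5,6) by simp_all
  moreover have "\<forall>n. (\<lambda>x. \<phi> x * g n (\<psi> x)) \<in> L2 lborel \<and> integrable lborel (\<lambda>x. \<phi> x * g n (\<psi> x))"
    using L2(1)[OF g(3)] int[OF g(4)] by blast
  ultimately show ?thesis
    using L2(1)[OF g(1)] L2(2)[OF g(2)] by (intro ktransform_I[where g="\<lambda>n x. \<phi> x * g n (\<psi> x)"]) auto
qed

section \<open>Covariance of the kernel transform under translation and dilation\<close>

lemma nn_integral_shear:
  fixes f :: "real \<times> real \<Rightarrow> ennreal"
  assumes [measurable]: "f \<in> borel_measurable borel"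
  shows "(\<integral>\<^sup>+p. f (fst p + A, snd p + B * fst p + C) \<partial>lborel) = (\<integral>\<^sup>+p. f p \<partial>lborel)"
proof -
  have "(\<integral>\<^sup>+p. f (fst p + A, snd p + B * fst p + C) \<partial>lborel) = (\<integral>\<^sup>+y. \<integral>\<^sup>+z. f (y + A, z + B * y + C) \<partial>lborel \<partial>lborel)"
    by (subst nn_integral_lborel_pair) auto
  also have "\<dots> = (\<integral>\<^sup>+y. \<integral>\<^sup>+z. f (y + A, z) \<partial>lborel \<partial>lborel)"
  proof (rule nn_integral_cong)
    fix y
    show "(\<integral>\<^sup>+z. f (y + A, z + B * y + C) \<partial>lborel) = (\<integral>\<^sup>+z. f (y + A, z) \<partial>lborel)"
      by (subst (2) nn_integral_real_affine[where c=1 and t="B * y + C"]) (auto simp: ac_simps)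
  qed
  also have "\<dots> = (\<integral>\<^sup>+y. \<integral>\<^sup>+z. f (y, z) \<partial>lborel \<partial>lborel)"
    by (subst (2) nn_integral_real_affine[where c=1 and t=A]) (auto simp: ac_simps)
  also have "\<dots> = (\<integral>\<^sup>+p. f p \<partial>lborel)"
    by (rule nn_integral_lborel_pair[symmetric]) simp
  finally show ?thesis .
qed

text \<open>Left multiplication in the Heisenberg group shears the (y, z) plane. Dually the
  frequency of y moves by a multiple of the central frequency, from \<omega> to \<omega> + l * B,
  and the translation parts become phases.\<close>

lemma fourier_plane_shear:
  assumes h: "integrable lborel h"
  shows "fourier_plane (\<lambda>p. h (fst p + A, snd p + B * fst p + C)) \<omega> l = cis (2 * pi * ((\<omega> + l * B) * A - l * C)) * fourier_plane h (\<omega> + l * B) l"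
proof -
  have [measurable]: "h \<in> borel_measurable borel" using h by (auto dest: borel_measurable_integrable)
  have i: "integrable lborel (\<lambda>p. h (fst p + A, snd p + B * fst p + C))"
    using h nn_integral_shear[of "\<lambda>p. ennreal (norm (h p))" A B C] by (simp add: integrable_iff_bounded)
  have i1: "integrable lborel (\<lambda>p. h (fst p + A, snd p + B * fst p + C) * cis (2 * pi * (l * snd p - \<omega> * fst p)))"
    by (rule integrable_mult_cis[OF i]) auto
  have i2: "integrable lborel (\<lambda>p. h p * cis (2 * pi * (l * snd p - (\<omega> + l * B) * fst p)))"
    by (rule integrable_mult_cis[OF h]) auto
  have "fourier_plane (\<lambda>p. h (fst p + A, snd p + B * fst p + C)) \<omega> l
     = (LINT y|lborel. LINT z|lborel. h (y + A, z + B * y + C) * cis (2 * pi * (l * z - \<omega> * y)))"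
    unfolding fourier_plane_def integrable_lborel_pair(3)[OF i1, symmetric] by simp
  also have "\<dots> = (LINT y|lborel. LINT z|lborel. h (y + A, z) * cis (2 * pi * (l * (z - B * y - C) - \<omega> * y)))"
  proof (rule Bochner_Integration.integral_cong[OF refl])
    fix y
    show "(LINT z|lborel. h (y + A, z + B * y + C) * cis (2 * pi * (l * z - \<omega> * y))) = (LINT z|lborel. h (y + A, z) * cis (2 * pi * (l * (z - B * y - C) - \<omega> * y)))"
      by (subst (2) lborel_integral_real_affine[where c=1 and t="B * y + C"]) (auto simp: ac_simps)
  qed
  also have "\<dots> = (LINT y|lborel. LINT z|lborel. h (y, z) * cis (2 * pi * (l * (z - B * (y - A) - C) - \<omega> * (y - A))))"
    by (subst (2) lborel_integral_real_affine[where c=1 and t=A]) (auto simp: ac_simps)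
  also have "\<dots> = (LINT y|lborel. LINT z|lborel. cis (2 * pi * ((\<omega> + l * B) * A - l * C)) * (h (y, z) * cis (2 * pi * (l * z - (\<omega> + l * B) * y))))"
    by (intro Bochner_Integration.integral_cong refl) (simp add: mult.left_commute cis_mult algebra_simps)
  also have "\<dots> = cis (2 * pi * ((\<omega> + l * B) * A - l * C)) * fourier_plane h (\<omega> + l * B) l"
    unfolding fourier_plane_def integrable_lborel_pair(3)[OF i2, symmetric] by simp
  finally show ?thesis .
qed

lemma nn_integral_scale:
  fixes f :: "real \<times> real \<Rightarrow> ennreal"
  assumes [measurable]: "f \<in> borel_measurable borel" and "\<beta> \<noteq> 0" "\<delta> \<noteq> 0"
  shows "ennreal \<bar>\<beta> * \<delta>\<bar> * (\<integral>\<^sup>+p. f (\<beta> * fst p, \<delta> * snd p) \<partial>lborel) = (\<integral>\<^sup>+p. f p \<partial>lborel)"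
proof -
  have "(\<integral>\<^sup>+p. f p \<partial>lborel) = (\<integral>\<^sup>+y. \<integral>\<^sup>+z. f (y, z) \<partial>lborel \<partial>lborel)"
    by (rule nn_integral_lborel_pair) simp
  also have "\<dots> = (\<integral>\<^sup>+y. ennreal \<bar>\<delta>\<bar> * (\<integral>\<^sup>+z. f (y, \<delta> * z) \<partial>lborel) \<partial>lborel)"
    using assms by (intro nn_integral_cong, subst nn_integral_real_affine[where c=\<delta> and t=0]) auto
  also have "\<dots> = ennreal \<bar>\<beta>\<bar> * (\<integral>\<^sup>+y. ennreal \<bar>\<delta>\<bar> * (\<integral>\<^sup>+z. f (\<beta> * y, \<delta> * z) \<partial>lborel) \<partial>lborel)"
    using assms by (subst nn_integral_real_affine[where c=\<beta> and t=0]) auto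
  also have "\<dots> = ennreal \<bar>\<beta>\<bar> * (ennreal \<bar>\<delta>\<bar> * (\<integral>\<^sup>+y. \<integral>\<^sup>+z. f (\<beta> * y, \<delta> * z) \<partial>lborel \<partial>lborel))"
    by (subst nn_integral_cmult) auto
  also have "(\<integral>\<^sup>+y. \<integral>\<^sup>+z. f (\<beta> * y, \<delta> * z) \<partial>lborel \<partial>lborel) = (\<integral>\<^sup>+p. f (\<beta> * fst p, \<delta> * snd p) \<partial>lborel)"
    by (subst nn_integral_lborel_pair) auto
  finally show ?thesis by (simp add: abs_mult ennreal_mult mult.assoc)
qed

lemma fourier_plane_scale:
  assumes h: "integrable lborel h" and nz: "\<beta> \<noteq> 0" "\<delta> \<noteq> 0"
  shows "fourier_plane (\<lambda>p. h (\<beta> * fst p, \<delta> * snd p)) \<omega> l = fourier_plane h (\<omega> / \<beta>) (l / \<delta>) / of_real \<bar>\<beta> * \<delta>\<bar>"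
proof -
  have [measurable]: "h \<in> borel_measurable borel" using h by (auto dest: borel_measurable_integrable)
  have i: "integrable lborel (\<lambda>p. h (\<beta> * fst p, \<delta> * snd p))"
  proof -
    have "ennreal \<bar>\<beta> * \<delta>\<bar> * (\<integral>\<^sup>+p. ennreal (norm (h (\<beta> * fst p, \<delta> * snd p))) \<partial>lborel) < top"
      using nn_integral_scale[OF _ nz, of "\<lambda>p. ennreal (norm (h p))"] h by (simp add: integrable_iff_bounded)
    then have "(\<integral>\<^sup>+p. ennreal (norm (h (\<beta> * fst p, \<delta> * snd p))) \<partial>lborel) < top"
      using nz by (auto simp: ennreal_mult_less_top)
    then show ?thesis by (simp add: integrable_iff_bounded)
  qed
  have i1: "integrable lborel (\<lambda>p. h (\<beta> * fst p, \<delta> * snd p) * cis (2 * pi * (l * snd p - \<omega> * fst p)))"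
    by (rule integrable_mult_cis[OF i]) auto
  have i2: "integrable lborel (\<lambda>p. h p * cis (2 * pi * (l / \<delta> * snd p - \<omega> / \<beta> * fst p)))"
    by (rule integrable_mult_cis[OF h]) auto
  have "fourier_plane h (\<omega> / \<beta>) (l / \<delta>) = (LINT y|lborel. LINT z|lborel. h (y, z) * cis (2 * pi * (l / \<delta> * z - \<omega> / \<beta> * y)))"
    unfolding fourier_plane_def integrable_lborel_pair(3)[OF i2, symmetric] by simp
  also have "\<dots> = (LINT y|lborel. of_real \<bar>\<delta>\<bar> * (LINT z|lborel. h (y, \<delta> * z) * cis (2 * pi * (l * z - \<omega> / \<beta> * y))))"
    by (intro Bochner_Integration.integral_cong refl, subst lborel_integral_real_affine[where c=\<delta> and t=0])
       (use nz in \<open>auto simp: scaleR_conv_of_real\<close>)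
  also have "\<dots> = of_real \<bar>\<beta>\<bar> * (LINT y|lborel. of_real \<bar>\<delta>\<bar> * (LINT z|lborel. h (\<beta> * y, \<delta> * z) * cis (2 * pi * (l * z - \<omega> * y))))"
    by (subst lborel_integral_real_affine[where c=\<beta> and t=0])
       (use nz in \<open>auto simp: scaleR_conv_of_real\<close>)
  also have "\<dots> = of_real \<bar>\<beta> * \<delta>\<bar> * fourier_plane (\<lambda>p. h (\<beta> * fst p, \<delta> * snd p)) \<omega> l"
    unfolding fourier_plane_def integrable_lborel_pair(3)[OF i1, symmetric] by (simp add: abs_mult mult.assoc)
  finally show ?thesis using nz by simp
qed

lemma nn_integral_scale3:
  fixes f :: "real \<times> real \<times> real \<Rightarrow> ennreal"
  assumes [measurable]: "f \<in> borel_measurable borel" and c: "c1 \<noteq> 0" "c2 \<noteq> 0" "c3 \<noteq> 0"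
  shows "ennreal (\<bar>c1\<bar> * \<bar>c2 * c3\<bar>) * (\<integral>\<^sup>+p. f (c1 * fst p, c2 * fst (snd p), c3 * snd (snd p)) \<partial>lborel) = (\<integral>\<^sup>+p. f p \<partial>lborel)"
proof -
  have "(\<integral>\<^sup>+p. f p \<partial>lborel) = (\<integral>\<^sup>+x. \<integral>\<^sup>+r. f (x, r) \<partial>lborel \<partial>lborel)"
    by (rule nn_integral_lborel_pair) measurable
  also have "\<dots> = (\<integral>\<^sup>+x. ennreal \<bar>c2 * c3\<bar> * (\<integral>\<^sup>+r. f (x, c2 * fst r, c3 * snd r) \<partial>lborel) \<partial>lborel)"
    by (intro nn_integral_cong nn_integral_scale[symmetric] c) measurable
  also have "\<dots> = ennreal \<bar>c1\<bar> * (\<integral>\<^sup>+x. ennreal \<bar>c2 * c3\<bar> * (\<integral>\<^sup>+r. f (c1 * x, c2 * fst r, c3 * snd r) \<partial>lborel) \<partial>lborel)"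
    using c by (subst nn_integral_real_affine[where c=c1 and t=0]) auto
  also have "\<dots> = ennreal \<bar>c1\<bar> * (ennreal \<bar>c2 * c3\<bar> * (\<integral>\<^sup>+x. \<integral>\<^sup>+r. f (c1 * x, c2 * fst r, c3 * snd r) \<partial>lborel \<partial>lborel))"
    by (subst nn_integral_cmult) auto
  also have "(\<integral>\<^sup>+x. \<integral>\<^sup>+r. f (c1 * x, c2 * fst r, c3 * snd r) \<partial>lborel \<partial>lborel) = (\<integral>\<^sup>+p. f (c1 * fst p, c2 * fst (snd p), c3 * snd (snd p)) \<partial>lborel)"
    by (subst nn_integral_lborel_pair) auto
  finally show ?thesis by (simp add: ennreal_mult mult.assoc)
qed

text \<open>Since \<delta> = \<alpha> * \<beta>, the Jacobian is the square of \<delta>, and the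
  factor \<delta> in front normalizes it.\<close>

lemma energy_dilate:
  fixes \<alpha> \<beta> \<delta> :: real
  assumes [measurable]: "h \<in> borel_measurable borel"
    and "\<alpha> \<noteq> 0" "\<beta> \<noteq> 0" "\<delta> = \<alpha> * \<beta>" "\<delta> > 0"
  shows "energy lborel (\<lambda>p. of_real \<delta> * h (\<alpha> * fst p, \<beta> * fst (snd p), \<delta> * snd (snd p))) = energy lborel h"
proof -
  have "\<bar>\<alpha>\<bar> * \<bar>\<beta> * \<delta>\<bar> = \<delta>\<^sup>2" using assms(4,5) by (simp add: abs_mult power2_eq_square)
  then show ?thesis
    using nn_integral_scale3[of "\<lambda>x. ennreal ((cmod (h x))\<^sup>2)" \<alpha> \<beta> \<delta>] assms(2,3,5)
    by (subst energy_cmult) (simp_all add: energy_def)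
qed

lemma energy_phase:
  "(\<And>x. cmod (\<phi> x) = 1) \<Longrightarrow> energy M (\<lambda>x. \<phi> x * f x) = energy M f"
  by (simp add: energy_def norm_mult)

text \<open>The substitution on the left is \<open>bireg\<close> in coordinates, compare
  \<open>bireg_coords\<close>. On the kernel, the central parameter k1 gives a phase in l alone, k3
  and m3 translate t and s, and k2 and m2 modulate them.\<close>

lemma ktransform_translate:
  fixes k1 k2 k3 m2 m3 :: real
  assumes "ktransform h K"
  shows "ktransform (\<lambda>p. h (fst p - k3 + m3, fst (snd p) - k2 + m2, snd (snd p) - k1 + k3 * k2 - k3 * fst (snd p) + (fst p - k3) * m2))
     (\<lambda>q. cis (2 * pi * fst q * (k1 + snd (snd q) * m2 - fst (snd q) * k2)) * K (fst q, fst (snd q) - k3, snd (snd q) - m3))"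
proof -
  define \<psi> where "\<psi> p = (fst p - k3 + m3, fst (snd p) - k2 + m2, snd (snd p) - k1 + k3 * k2 - k3 * fst (snd p) + (fst p - k3) * m2)" for p :: "real \<times> real \<times> real"
  define \<psi>' where "\<psi>' q = (fst q, fst (snd q) - k3, snd (snd q) - m3)" for q :: "real \<times> real \<times> real"
  have [measurable]: "\<psi> \<in> borel_measurable borel" "\<psi>' \<in> borel_measurable borel" unfolding \<psi>_def \<psi>'_def by measurable
  have nn: "(\<integral>\<^sup>+p. f (\<psi> p) \<partial>lborel) = (\<integral>\<^sup>+p. f p \<partial>lborel)" if [measurable]: "f \<in> borel_measurable borel" for f :: "_ \<Rightarrow> ennreal"
  proof -
    have "(\<integral>\<^sup>+p. f (\<psi> p) \<partial>lborel) = (\<integral>\<^sup>+x. \<integral>\<^sup>+r. f (\<psi> (x, r)) \<partial>lborel \<partial>lborel)"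
      by (rule nn_integral_lborel_pair) measurable
    also have "\<dots> = (\<integral>\<^sup>+x. \<integral>\<^sup>+r. f (x - k3 + m3, r) \<partial>lborel \<partial>lborel)"
    proof (rule nn_integral_cong)
      fix x
      show "(\<integral>\<^sup>+r. f (\<psi> (x, r)) \<partial>lborel) = (\<integral>\<^sup>+r. f (x - k3 + m3, r) \<partial>lborel)"
        using nn_integral_shear[of "\<lambda>r. f (x - k3 + m3, r)" "m2 - k2" "- k3" "- k1 + k3 * k2 + (x - k3) * m2"]
        by (simp add: \<psi>_def algebra_simps)
    qed
    also have "\<dots> = (\<integral>\<^sup>+x. \<integral>\<^sup>+r. f (x, r) \<partial>lborel \<partial>lborel)"
      by (subst (2) nn_integral_real_affine[where c=1 and t="m3 - k3"]) (auto simp: algebra_simps)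
    also have "\<dots> = (\<integral>\<^sup>+p. f p \<partial>lborel)" by (rule nn_integral_lborel_pair[symmetric]) measurable
    finally show ?thesis .
  qed
  have nn': "(\<integral>\<^sup>+p. f (\<psi>' p) \<partial>lborel) = (\<integral>\<^sup>+p. f p \<partial>lborel)" if [measurable]: "f \<in> borel_measurable borel" for f :: "_ \<Rightarrow> ennreal"
  proof -
    have "(\<integral>\<^sup>+p. f (\<psi>' p) \<partial>lborel) = (\<integral>\<^sup>+l. \<integral>\<^sup>+r. f (\<psi>' (l, r)) \<partial>lborel \<partial>lborel)"
      by (rule nn_integral_lborel_pair) measurable
    also have "\<dots> = (\<integral>\<^sup>+l. \<integral>\<^sup>+r. f (l, r) \<partial>lborel \<partial>lborel)"
    proof (rule nn_integral_cong)
      fix l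
      show "(\<integral>\<^sup>+r. f (\<psi>' (l, r)) \<partial>lborel) = (\<integral>\<^sup>+r. f (l, r) \<partial>lborel)"
        using nn_integral_shear[of "\<lambda>r. f (l, r)" "- k3" 0 "- m3"] by (simp add: \<psi>'_def)
    qed
    also have "\<dots> = (\<integral>\<^sup>+p. f p \<partial>lborel)" by (rule nn_integral_lborel_pair[symmetric]) measurable
    finally show ?thesis .
  qed
  have "ktransform (\<lambda>p. 1 * h (\<psi> p)) (\<lambda>q. cis (2 * pi * fst q * (k1 + snd (snd q) * m2 - fst (snd q) * k2)) * K (\<psi>' q))"
  proof (rule ktransform_transfer[OF assms])
    show "energy lborel (\<lambda>x. 1 * f (\<psi> x)) = energy lborel f" if [measurable]: "f \<in> borel_measurable borel" for f
      using nn[of "\<lambda>x. ennreal ((cmod (f x))\<^sup>2)"] by (simp add: energy_def)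
    show "energy lborel (\<lambda>q. cis (2 * pi * fst q * (k1 + snd (snd q) * m2 - fst (snd q) * k2)) * f (\<psi>' q)) = energy lborel f"
      if [measurable]: "f \<in> borel_measurable borel" for f
      using nn'[of "\<lambda>x. ennreal ((cmod (f x))\<^sup>2)"] by (subst energy_phase) (simp_all add: energy_def)
    show "integrable lborel (\<lambda>x. 1 * g (\<psi> x))" if g: "integrable lborel g" for g :: "_ \<Rightarrow> complex"
    proof -
      have [measurable]: "g \<in> borel_measurable borel" using g by (auto dest: borel_measurable_integrable)
      show ?thesis using nn[of "\<lambda>x. ennreal (cmod (g x))"] g by (simp add: integrable_iff_bounded)
    qed
    fix g :: "real \<times> real \<times> real \<Rightarrow> complex" assume g: "integrable lborel g"
    show "AE q in lborel. wkernel (\<lambda>x. 1 * g (\<psi> x)) q = cis (2 * pi * fst q * (k1 + snd (snd q) * m2 - fst (snd q) * k2)) * wkernel g (\<psi>' q)"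
      using AE_lborel_kernel[OF integrable_lborel_pair(1)[OF g] one_neq_zero, of "m3 - k3"]
    proof eventually_elim
      case (elim q)
      obtain l t s where q: "q = (l, t, s)" by (cases q)
      have i: "integrable lborel (\<lambda>p. g (t - s - k3 + m3, p))" using elim by (simp add: q algebra_simps)
      have "wkernel (\<lambda>x. 1 * g (\<psi> x)) q = of_real (sqrt \<bar>l\<bar>) * fourier_plane (\<lambda>p. (\<lambda>p. g (t - s - k3 + m3, p))
          (fst p + (m2 - k2), snd p + (- k3) * fst p + (- k1 + k3 * k2 + (t - s - k3) * m2))) (l * t) l"
        by (simp add: q wkernel_apply \<psi>_def algebra_simps)
      also have "\<dots> = of_real (sqrt \<bar>l\<bar>) * (cis (2 * pi * ((l * t + l * (- k3)) * (m2 - k2) - l * (- k1 + k3 * k2 + (t - s - k3) * m2))) *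
          fourier_plane (\<lambda>p. g (t - s - k3 + m3, p)) (l * t + l * (- k3)) l)"
        by (subst fourier_plane_shear[OF i]) (rule refl)
      \<comment> \<open>All terms with k3 and the two terms t * m2 cancel in the phase. What is left
        separates into a function of t and a function of s, which is why rank-one kernels stay rank
        one.\<close>
      also have "\<dots> = cis (2 * pi * l * (k1 + s * m2 - t * k2)) * wkernel g (l, t - k3, s - m3)"
        by (simp add: wkernel_apply algebra_simps)
      finally show ?case by (simp add: q \<psi>'_def)
    qed
  qed measurable
  then show ?thesis by (simp add: \<psi>_def \<psi>'_def)
qed

text \<open>The constant collects \<delta> from the normalization, 1 / |\<beta> * \<delta>| from the
  planar scaling, and sqrt \<delta> from comparing the weights at l and l / \<delta>.\<close>

lemma ktransform_dilate:
  fixes \<alpha> \<beta> \<delta> :: real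
  assumes "ktransform h K" and nz: "\<alpha> \<noteq> 0" "\<beta> \<noteq> 0" and \<delta>: "\<delta> = \<alpha> * \<beta>" "\<delta> > 0"
  shows "ktransform (\<lambda>p. of_real \<delta> * h (\<alpha> * fst p, \<beta> * fst (snd p), \<delta> * snd (snd p)))
     (\<lambda>q. of_real (sqrt \<delta> / \<bar>\<beta>\<bar>) * K (fst q / \<delta>, \<alpha> * fst (snd q), \<alpha> * snd (snd q)))"
proof -
  define \<psi> where "\<psi> p = (\<alpha> * fst p, \<beta> * fst (snd p), \<delta> * snd (snd p))" for p :: "real \<times> real \<times> real"
  define \<psi>' where "\<psi>' q = (fst q / \<delta>, \<alpha> * fst (snd q), \<alpha> * snd (snd q))" for q :: "real \<times> real \<times> real"
  have [measurable]: "\<psi> \<in> borel_measurable borel" "\<psi>' \<in> borel_measurable borel" unfolding \<psi>_def \<psi>'_def by measurable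
  have dpos: "\<bar>\<alpha>\<bar> * \<bar>\<beta> * \<delta>\<bar> = \<delta>\<^sup>2" using \<delta> by (simp add: abs_mult power2_eq_square)
  have dpos': "\<bar>inverse \<delta>\<bar> * \<bar>\<alpha> * \<alpha>\<bar> = (sqrt \<delta> / \<bar>\<beta>\<bar>)\<^sup>2"
    using \<delta> nz by (simp add: abs_mult power2_eq_square field_simps)
  have "ktransform (\<lambda>p. of_real \<delta> * h (\<psi> p)) (\<lambda>q. of_real (sqrt \<delta> / \<bar>\<beta>\<bar>) * K (\<psi>' q))"
  proof (rule ktransform_transfer[OF assms(1)])
    show "energy lborel (\<lambda>x. of_real \<delta> * f (\<psi> x)) = energy lborel f" if [measurable]: "f \<in> borel_measurable borel" for f
      unfolding \<psi>_def by (rule energy_dilate) (use nz \<delta> in simp_all)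
    show "energy lborel (\<lambda>q. of_real (sqrt \<delta> / \<bar>\<beta>\<bar>) * f (\<psi>' q)) = energy lborel f"
      if [measurable]: "f \<in> borel_measurable borel" for f
    proof -
      define r where "r = sqrt \<delta> / \<bar>\<beta>\<bar>"
      have "energy lborel (\<lambda>q. of_real r * f (\<psi>' q)) = ennreal (r\<^sup>2) * energy lborel (\<lambda>q. f (\<psi>' q))"
        by (simp add: energy_cmult)
      also have "\<dots> = energy lborel f"
        using nn_integral_scale3[of "\<lambda>x. ennreal ((cmod (f x))\<^sup>2)" "inverse \<delta>" \<alpha> \<alpha>] nz \<delta>(2) unfolding dpos' r_def[symmetric]
        by (simp add: energy_def \<psi>'_def divide_inverse mult.commute[of "inverse _"])
      finally show ?thesis by (simp only: r_def)
    qed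
    show "integrable lborel (\<lambda>x. of_real \<delta> * g (\<psi> x))" if g: "integrable lborel g" for g :: "_ \<Rightarrow> complex"
    proof -
      have [measurable]: "g \<in> borel_measurable borel" using g by (auto dest: borel_measurable_integrable)
      have "ennreal (\<delta>\<^sup>2) * (\<integral>\<^sup>+x. ennreal (cmod (g (\<psi> x))) \<partial>lborel) < top"
        using nn_integral_scale3[of "\<lambda>x. ennreal (cmod (g x))" \<alpha> \<beta> \<delta>] nz \<delta>(2) g unfolding dpos
        by (simp add: integrable_iff_bounded \<psi>_def)
      then have "integrable lborel (\<lambda>x. g (\<psi> x))"
        using \<delta>(2) by (auto simp: integrable_iff_bounded ennreal_mult_less_top)
      then show ?thesis by simp
    qed
    fix g :: "real \<times> real \<times> real \<Rightarrow> complex" assume g: "integrable lborel g"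
    show "AE q in lborel. wkernel (\<lambda>x. of_real \<delta> * g (\<psi> x)) q = of_real (sqrt \<delta> / \<bar>\<beta>\<bar>) * wkernel g (\<psi>' q)"
      using AE_lborel_kernel[OF integrable_lborel_pair(1)[OF g] nz(1), of 0]
    proof eventually_elim
      case (elim q)
      obtain l t s where q: "q = (l, t, s)" by (cases q)
      have i: "integrable lborel (\<lambda>p. g (\<alpha> * (t - s), p))" using elim by (simp add: q)
      have "wkernel (\<lambda>x. of_real \<delta> * g (\<psi> x)) q = of_real (sqrt \<bar>l\<bar>) * (of_real \<delta> * fourier_plane (\<lambda>p. (\<lambda>p. g (\<alpha> * (t - s), p)) (\<beta> * fst p, \<delta> * snd p)) (l * t) l)"
        by (simp add: q wkernel_apply \<psi>_def fourier_plane_def mult.assoc)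
      also have "\<dots> = of_real (sqrt \<bar>l\<bar>) * (of_real \<delta> * (fourier_plane (\<lambda>p. g (\<alpha> * (t - s), p)) (l * t / \<beta>) (l / \<delta>) / of_real \<bar>\<beta> * \<delta>\<bar>))"
        using nz \<delta>(2) by (subst fourier_plane_scale[OF i]) auto
      \<comment> \<open>Here \<delta> = \<alpha> * \<beta> makes the frequency once more that of a
        kernel, at central frequency l / \<delta> and point \<alpha> * t.\<close>
      also have "l * t / \<beta> = l / \<delta> * (\<alpha> * t)" using nz by (simp add: \<delta>(1))
      also have "of_real (sqrt \<bar>l\<bar>) * (of_real \<delta> * (fourier_plane (\<lambda>p. g (\<alpha> * (t - s), p)) (l / \<delta> * (\<alpha> * t)) (l / \<delta>) / of_real \<bar>\<beta> * \<delta>\<bar>))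
         = of_real (sqrt \<delta> / \<bar>\<beta>\<bar>) * wkernel g (l / \<delta>, \<alpha> * t, \<alpha> * s)"
      proof -
        have "sqrt \<bar>l\<bar> = sqrt \<delta> * sqrt \<bar>l / \<delta>\<bar>" using \<delta>(2) by (simp add: real_sqrt_mult[symmetric] abs_divide)
        then show ?thesis using \<delta>(2) nz by (simp add: wkernel_apply right_diff_distrib abs_mult)
      qed
      finally show ?case by (simp add: q \<psi>'_def)
    qed
  qed measurable
  then show ?thesis by (simp add: \<psi>_def \<psi>'_def)
qed

section \<open>Kernels of Hilbert-Schmidt operators\<close>

lemma energy_lborel_pair:
  fixes K :: "'a::euclidean_space \<times> 'b::euclidean_space \<Rightarrow> complex"
  assumes [measurable]: "K \<in> borel_measurable borel"
  shows "energy lborel K = (\<integral>\<^sup>+x. energy lborel (\<lambda>y. K (x, y)) \<partial>lborel)"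
  unfolding energy_def by (rule nn_integral_lborel_pair) measurable

lemma L2_section:
  fixes K :: "'a::euclidean_space \<times> 'b::euclidean_space \<Rightarrow> complex"
  assumes "K \<in> L2 lborel"
  shows "AE x in lborel. (\<lambda>y. K (x, y)) \<in> L2 lborel"
proof -
  have [measurable]: "K \<in> borel_measurable borel" using L2_measurable[OF assms] by simp
  have "(\<integral>\<^sup>+x. energy lborel (\<lambda>y. K (x, y)) \<partial>lborel) \<noteq> \<infinity>"
    using assms energy_lborel_pair[of K] by (auto simp: L2_iff)
  then have "AE x in lborel. energy lborel (\<lambda>y. K (x, y)) \<noteq> \<infinity>"
    by (intro nn_integral_noteq_infinite) (auto simp: energy_def)
  then show ?thesis
  proof eventually_elim
    case (elim x)
    then have "energy lborel (\<lambda>y. K (x, y)) < \<infinity>" unfolding infinity_ennreal_def less_top[symmetric] .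
    moreover have "(\<lambda>y. K (x, y)) \<in> borel_measurable lborel" by measurable
    ultimately show ?case by (simp add: L2_iff)
  qed
qed

text \<open>The integral kernel of \<open>rank_one u v\<close>.\<close>

definition tensor :: "(real \<Rightarrow> complex) \<Rightarrow> (real \<Rightarrow> complex) \<Rightarrow> real \<times> real \<Rightarrow> complex" where
  "tensor u v r = u (fst r) * cnj (v (snd r))"

lemma tensor_measurable:
  assumes "u \<in> L2 lborel" "v \<in> L2 lborel" shows "tensor u v \<in> borel_measurable borel"
proof -
  have [measurable]: "u \<in> borel_measurable borel" "v \<in> borel_measurable borel"
    using L2_measurable[OF assms(1)] L2_measurable[OF assms(2)] by auto
  show ?thesis unfolding tensor_def by measurable
qed

lemma energy_tensor:
  assumes "u \<in> L2 lborel" "v \<in> L2 lborel"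
  shows "energy lborel (tensor u v) = energy lborel u * energy lborel v"
proof -
  have [measurable]: "u \<in> borel_measurable borel" "v \<in> borel_measurable borel"
    using L2_measurable[OF assms(1)] L2_measurable[OF assms(2)] by auto
  have "energy lborel (tensor u v) = (\<integral>\<^sup>+t. energy lborel (\<lambda>s. u t * cnj (v s)) \<partial>lborel)"
    using tensor_measurable[OF assms] by (subst energy_lborel_pair) (auto simp: tensor_def)
  also have "\<dots> = (\<integral>\<^sup>+t. ennreal ((cmod (u t))\<^sup>2) * energy lborel v \<partial>lborel)"
    by (simp add: energy_cmult energy_cnj)
  also have "\<dots> = energy lborel u * energy lborel v"
    unfolding energy_def by (rule nn_integral_multc) measurable
  finally show ?thesis .
qed

lemma tensor_L2:
  assumes "u \<in> L2 lborel" "v \<in> L2 lborel" shows "tensor u v \<in> L2 lborel"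
  using assms tensor_measurable[OF assms] unfolding L2_iff energy_tensor[OF assms]
  by (auto simp: ennreal_mult_less_top)

text \<open>Cauchy-Schwarz in s bounds the integral operator with kernel k, and Fubini turns its
  matrix coefficients into pairings of k with tensors. Operators and kernels are compared through
  these pairings.\<close>

lemma
  assumes k: "k \<in> L2 lborel" and \<phi>: "\<phi> \<in> L2 lborel"
  shows kernel_oper_L2: "(\<lambda>t. LINT s|lborel. k (t, s) * \<phi> s) \<in> L2 lborel"
    and inner_kernel_oper: "\<psi> \<in> L2 lborel \<Longrightarrow> inner_L2 lborel (\<lambda>t. LINT s|lborel. k (t, s) * \<phi> s) \<psi> = inner_L2 lborel k (tensor \<psi> \<phi>)"
proof -
  have [measurable]: "k \<in> borel_measurable borel" "\<phi> \<in> borel_measurable borel"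
    using L2_measurable[OF k] L2_measurable[OF \<phi>] by auto
  have "energy lborel (\<lambda>t. LINT s|lborel. k (t, s) * \<phi> s) \<le> (\<integral>\<^sup>+t. energy lborel (\<lambda>s. k (t, s)) * energy lborel \<phi> \<partial>lborel)"
    unfolding energy_def[of _ "\<lambda>t. LINT s|lborel. k (t, s) * \<phi> s"]
    by (intro nn_integral_mono Cauchy_Schwarz_integral) measurable
  also have "\<dots> = energy lborel k * energy lborel \<phi>"
  proof -
    have m: "(\<lambda>t. energy lborel (\<lambda>s. k (t, s))) \<in> borel_measurable lborel" unfolding energy_def by measurable
    have km: "k \<in> borel_measurable borel" by measurable
    show ?thesis unfolding energy_lborel_pair[OF km] by (rule nn_integral_multc[OF m])
  qed
  also have "\<dots> < \<infinity>" using k \<phi> by (simp add: L2_iff ennreal_mult_less_top)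
  finally show "(\<lambda>t. LINT s|lborel. k (t, s) * \<phi> s) \<in> L2 lborel" by (simp add: L2_iff)
  assume \<psi>: "\<psi> \<in> L2 lborel"
  have [measurable]: "\<psi> \<in> borel_measurable borel" using L2_measurable[OF \<psi>] by auto
  have i: "integrable lborel (\<lambda>r. k r * cnj (tensor \<psi> \<phi> r))"
    by (rule integrable_L2_inner[OF k tensor_L2[OF \<psi> \<phi>]])
  have "inner_L2 lborel k (tensor \<psi> \<phi>) = (LINT t|lborel. LINT s|lborel. k (t, s) * \<phi> s * cnj (\<psi> t))"
    unfolding inner_L2_def integrable_lborel_pair(3)[OF i, symmetric] by (simp add: tensor_def mult_ac)
  then show "inner_L2 lborel (\<lambda>t. LINT s|lborel. k (t, s) * \<phi> s) \<psi> = inner_L2 lborel k (tensor \<psi> \<phi>)"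
    by (simp add: inner_L2_def)
qed

text \<open>Totality of e is used twice: in t, for each of the countably many integrals against
  \<open>e i\<close>, and then in s for almost every t.\<close>

lemma tensor_total:
  assumes e: "orthonormal_basis e" and k: "k \<in> L2 lborel"
    and 0: "\<And>i j. inner_L2 lborel k (tensor (e j) (e i)) = 0"
  shows "AE r in lborel. k r = 0"
proof -
  have eL: "e i \<in> L2 lborel" for i using e by (simp add: orthonormal_basis_def)
  have tot: "AE t in lborel. \<phi> t = 0" if "\<phi> \<in> L2 lborel" "\<And>i. inner_L2 lborel \<phi> (e i) = 0" for \<phi>
    using e that by (simp add: orthonormal_basis_def)
  have [measurable]: "k \<in> borel_measurable borel" using L2_measurable[OF k] by auto
  have "AE t in lborel. (LINT s|lborel. k (t, s) * e i s) = 0" for i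
    by (rule tot[OF kernel_oper_L2[OF k eL]]) (simp add: inner_kernel_oper[OF k eL eL] 0)
  then have "AE t in lborel. \<forall>i. (LINT s|lborel. k (t, s) * e i s) = 0"
    unfolding AE_all_countable by (rule allI)
  then have "AE t in lborel. energy lborel (\<lambda>s. k (t, s)) = 0"
    using L2_section[OF k]
  proof eventually_elim
    case (elim t)
    \<comment> \<open>The integral pairs k with \<open>e i\<close> bilinearly, so it is the
      conjugate of an inner product with the conjugated section.\<close>
    have "AE s in lborel. cnj (k (t, s)) = 0"
    proof (rule tot[OF L2_cnj[OF elim(2)]])
      fix i
      have "inner_L2 lborel (\<lambda>s. cnj (k (t, s))) (e i) = cnj (LINT s|lborel. k (t, s) * e i s)"
        unfolding inner_L2_def by (subst Bochner_Integration.integral_cnj[symmetric]) simp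
      then show "inner_L2 lborel (\<lambda>s. cnj (k (t, s))) (e i) = 0" using elim(1) by simp
    qed
    then show ?case using L2_measurable[OF elim(2)] by (subst energy_eq_0_iff) auto
  qed
  then have "energy lborel k = 0"
    by (subst energy_lborel_pair) (simp_all add: nn_integral_0_iff_AE energy_def)
  then show ?thesis by (subst (asm) energy_eq_0_iff) auto
qed

section \<open>Coordinates on the Heisenberg group\<close>

definition coords :: "real \<times> real \<times> real \<Rightarrow> real^4^4" where
  "coords p = heis (fst p) (fst (snd p)) (snd (snd p))"

lemma borel_measurable_matrix:
  fixes F :: "'a \<Rightarrow> real^'n^'m"
  assumes "\<And>i j. (\<lambda>p. F p $ i $ j) \<in> borel_measurable M"
  shows "F \<in> borel_measurable M"
proof -
  have "(\<lambda>p. F p \<bullet> b) \<in> borel_measurable M" if "b \<in> Basis" for b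
  proof -
    have "(\<lambda>p. \<Sum>i\<in>UNIV. \<Sum>j\<in>UNIV. F p $ i $ j * b $ i $ j) \<in> borel_measurable M"
      using assms by measurable
    then show ?thesis by (simp add: inner_vec_def)
  qed
  then show ?thesis by (subst borel_measurable_euclidean_space) (rule ballI)
qed

lemma coords_measurable [measurable]: "coords \<in> borel_measurable borel"
proof (rule borel_measurable_matrix)
  have "\<forall>i j. (\<lambda>p. coords p $ i $ j) \<in> borel_measurable borel"
    unfolding forall_4 coords_def heis_def by simp
  then show "(\<lambda>p. coords p $ i $ j) \<in> borel_measurable borel" for i j by blast
qed

lemma haar_coords: "haar = distr lborel borel coords"
  unfolding haar_def coords_def[abs_def] by (simp add: case_prod_beta')

lemma sets_haar [measurable_cong, simp]: "sets haar = sets borel"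
  by (simp add: haar_def)

lemma borel_measurable_haar [simp]: "f \<in> borel_measurable haar \<longleftrightarrow> f \<in> borel_measurable borel"
  by (subst measurable_cong_sets[OF sets_haar refl]) (rule refl)

lemma energy_haar: "f \<in> borel_measurable borel \<Longrightarrow> energy haar f = energy lborel (\<lambda>p. f (coords p))"
  unfolding energy_def haar_coords by (subst nn_integral_distr) auto

lemma integrable_haar: "f \<in> borel_measurable borel \<Longrightarrow> integrable haar f \<longleftrightarrow> integrable lborel (\<lambda>p. f (coords p))"
  for f :: "_ \<Rightarrow> complex"
  unfolding haar_coords by (rule integrable_distr_eq) auto

lemma integral_haar: "f \<in> borel_measurable borel \<Longrightarrow> (LINT n|haar. f n) = (LINT p|lborel. f (coords p))"
  for f :: "_ \<Rightarrow> complex"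
  unfolding haar_coords by (rule integral_distr) auto

lemma L2_haar_measurable: "f \<in> L2 haar \<Longrightarrow> f \<in> borel_measurable borel"
  using L2_measurable[of f haar] by simp

lemma L2_haar: 
  assumes "f \<in> L2 haar" shows "(\<lambda>p. f (coords p)) \<in> L2 lborel"
proof -
  have [measurable]: "f \<in> borel_measurable borel" by (rule L2_haar_measurable[OF assms])
  have "(\<lambda>p. f (coords p)) \<in> borel_measurable lborel" by measurable
  then show ?thesis using assms energy_haar[of f] unfolding L2_iff by simp
qed

lemma inner_haar: "f \<in> borel_measurable borel \<Longrightarrow> g \<in> borel_measurable borel \<Longrightarrow>
   inner_L2 haar f g = inner_L2 lborel (\<lambda>p. f (coords p)) (\<lambda>p. g (coords p))"
  unfolding inner_L2_def
  by (rule integral_haar) (intro borel_measurable_times cnj_borel_measurable)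

lemma borel_measurable_entry [measurable]: "(\<lambda>n::real^'n^'m. n $ i $ j) \<in> borel_measurable borel"
  by (intro borel_measurable_continuous_onI continuous_intros)

lemma schroedinger_coords: "schroedinger \<xi> (coords p) \<phi> t =
    cis (2 * pi * \<xi> * snd (snd p)) * cis (- 2 * pi * \<xi> * fst (snd p) * t) * \<phi> (t - fst p)"
  unfolding coords_def by (rule schroedinger_heis)

text \<open>Fubini moves the integral in t outside; the integral over (y, z) becomes
  \<open>fourier_plane\<close>, and s = t - x turns the remaining convolution into an integral
  operator.\<close>

lemma heis_fourier_pairing:
  assumes G: "integrable lborel G" and \<phi>: "\<phi> \<in> L2 lborel" and \<psi>: "\<psi> \<in> L2 lborel"
  shows "(LINT p|lborel. G p * inner_L2 lborel (schroedinger \<xi> (coords p) \<phi>) \<psi>) =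
    inner_L2 lborel (\<lambda>t. LINT s|lborel. fourier_plane (\<lambda>p. G (t - s, p)) (\<xi> * t) \<xi> * \<phi> s) \<psi>"
proof -
  have [measurable]: "G \<in> borel_measurable borel" using G by (auto dest: borel_measurable_integrable)
  have [measurable]: "\<phi> \<in> borel_measurable borel" "\<psi> \<in> borel_measurable borel"
    using L2_measurable[OF \<phi>] L2_measurable[OF \<psi>] by auto
  define A where "A p t = G p * (cis (2 * pi * \<xi> * snd (snd p)) * cis (- 2 * pi * \<xi> * fst (snd p) * t) * \<phi> (t - fst p) * cnj (\<psi> t))" for p t
  have Am [measurable]: "(\<lambda>q. A (fst q) (snd q)) \<in> borel_measurable borel" unfolding A_def by measurable
  define c where "c = norm_L2 lborel \<phi> * norm_L2 lborel \<psi>"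
  have c0: "c \<ge> 0" by (simp add: c_def norm_L2_nonneg)
  \<comment> \<open>By translation invariance Cauchy-Schwarz bounds the matrix coefficient uniformly
    in x. As G is integrable, this gives the joint integrability of A that Fubini needs.\<close>
  have bnd: "(\<integral>\<^sup>+t. ennreal (cmod (\<phi> (t - x) * cnj (\<psi> t))) \<partial>lborel) \<le> ennreal c" for x
  proof -
    let ?X = "\<integral>\<^sup>+t. ennreal (cmod (\<phi> (t - x) * cnj (\<psi> t))) \<partial>lborel"
    have "energy lborel (\<lambda>t. \<phi> (t - x)) = energy lborel \<phi>"
      unfolding energy_def by (subst (2) nn_integral_real_affine[where c=1 and t="- x"]) auto
    then have "?X\<^sup>2 \<le> energy lborel \<phi> * energy lborel \<psi>"
      using Cauchy_Schwarz_nn[of "\<lambda>t. \<phi> (t - x)" lborel "\<lambda>t. cnj (\<psi> t)"] by (simp add: energy_cnj)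
    also have "\<dots> = ennreal (c\<^sup>2)"
      by (simp add: c_def energy_L2 \<phi> \<psi> power_mult_distrib ennreal_mult)
    finally have *: "?X\<^sup>2 \<le> ennreal (c\<^sup>2)" .
    then have "?X \<noteq> top" by (auto simp: top_unique power_eq_top_ennreal)
    then obtain x' where x': "?X = ennreal x'" "x' \<ge> 0" by (cases ?X) auto
    then have "x'\<^sup>2 \<le> c\<^sup>2" using * by (simp add: ennreal_power)
    then have "x' \<le> c" using c0 by (rule power2_le_imp_le)
    then show ?thesis by (simp add: x' ennreal_leI)
  qed
  have Aint: "integrable lborel (\<lambda>q. A (fst q) (snd q))"
  proof -
    have "(\<integral>\<^sup>+q. ennreal (cmod (A (fst q) (snd q))) \<partial>lborel) = (\<integral>\<^sup>+p. \<integral>\<^sup>+t. ennreal (cmod (A p t)) \<partial>lborel \<partial>lborel)"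
      by (subst nn_integral_lborel_pair) auto
    also have "\<dots> = (\<integral>\<^sup>+p. ennreal (cmod (G p)) * (\<integral>\<^sup>+t. ennreal (cmod (\<phi> (t - fst p) * cnj (\<psi> t))) \<partial>lborel) \<partial>lborel)"
      by (intro nn_integral_cong, subst nn_integral_cmult[symmetric]) (auto simp: A_def norm_mult ennreal_mult mult.assoc)
    also have "\<dots> \<le> (\<integral>\<^sup>+p. ennreal (cmod (G p)) * ennreal c \<partial>lborel)"
      by (intro nn_integral_mono mult_left_mono bnd) auto
    also have "\<dots> = (\<integral>\<^sup>+p. ennreal (cmod (G p)) \<partial>lborel) * ennreal c"
      by (rule nn_integral_multc) measurable
    also have "\<dots> < top" using G by (auto simp: integrable_iff_bounded ennreal_mult_less_top)
    finally show ?thesis by (simp add: integrable_iff_bounded)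
  qed
  have Aint': "integrable (lborel \<Otimes>\<^sub>M lborel) (case_prod A)"
    using Aint by (simp add: lborel_prod case_prod_beta')
  have "(LINT p|lborel. G p * inner_L2 lborel (schroedinger \<xi> (coords p) \<phi>) \<psi>) = (LINT p|lborel. LINT t|lborel. A p t)"
    by (simp add: inner_L2_def schroedinger_coords A_def)
  also have "\<dots> = (LINT t|lborel. LINT p|lborel. A p t)"
    by (rule lborel_pair.Fubini_integral[OF Aint', symmetric])
  also have "\<dots> = (LINT t|lborel. LINT x|lborel. LINT r|lborel. A (x, r) t)"
  proof (rule integral_cong_AE)
    show "AE t in lborel. (LINT p|lborel. A p t) = (LINT x|lborel. LINT r|lborel. A (x, r) t)"
      using lborel_pair.AE_integrable_snd[OF Aint'] by eventually_elim (rule integrable_lborel_pair(3)[symmetric])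
  qed (unfold A_def, measurable)
  also have "\<dots> = (LINT t|lborel. LINT x|lborel. fourier_plane (\<lambda>p. G (x, p)) (\<xi> * t) \<xi> * (\<phi> (t - x) * cnj (\<psi> t)))"
  proof (intro arg_cong[where f="integral\<^sup>L lborel"] ext)
    fix t x
    have "A (x, r) t = G (x, r) * cis (2 * pi * (\<xi> * snd r - \<xi> * t * fst r)) * (\<phi> (t - x) * cnj (\<psi> t))" for r
    proof -
      have "cis (2 * pi * (\<xi> * snd r - \<xi> * t * fst r)) = cis (2 * pi * \<xi> * snd r) * cis (- 2 * pi * \<xi> * fst r * t)"
        by (simp add: cis_mult algebra_simps)
      then show ?thesis by (simp only: A_def fst_conv snd_conv mult_ac)
    qed
    then show "(LINT r|lborel. A (x, r) t) = fourier_plane (\<lambda>p. G (x, p)) (\<xi> * t) \<xi> * (\<phi> (t - x) * cnj (\<psi> t))"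
      unfolding fourier_plane_def by simp
  qed
  also have "\<dots> = (LINT t|lborel. LINT s|lborel. fourier_plane (\<lambda>p. G (t - s, p)) (\<xi> * t) \<xi> * (\<phi> s * cnj (\<psi> t)))"
  proof (rule arg_cong[where f="integral\<^sup>L lborel"], rule ext)
    fix t
    show "(LINT x|lborel. fourier_plane (\<lambda>p. G (x, p)) (\<xi> * t) \<xi> * (\<phi> (t - x) * cnj (\<psi> t))) = (LINT s|lborel. fourier_plane (\<lambda>p. G (t - s, p)) (\<xi> * t) \<xi> * (\<phi> s * cnj (\<psi> t)))"
      by (subst lborel_integral_real_affine[where c="-1" and t=t]) auto
  qed
  also have "\<dots> = inner_L2 lborel (\<lambda>t. LINT s|lborel. fourier_plane (\<lambda>p. G (t - s, p)) (\<xi> * t) \<xi> * \<phi> s) \<psi>"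
    by (simp add: inner_L2_def mult.assoc[symmetric])
  finally show ?thesis .
qed

section \<open>Comparison with the operator-valued Plancherel transform\<close>

lemma heis_fourier_kernel:
  assumes g: "g \<in> L2 haar" and gi: "integrable haar g"
  shows "AE \<xi> in lborel. \<forall>\<phi>\<in>L2 lborel. heis_fourier g \<xi> \<phi> \<in> L2 lborel \<and>
    (\<forall>\<psi>\<in>L2 lborel. of_real (sqrt \<bar>\<xi>\<bar>) * inner_L2 lborel (heis_fourier g \<xi> \<phi>) \<psi> =
       inner_L2 lborel (\<lambda>r. wkernel (\<lambda>p. g (coords p)) (\<xi>, r)) (tensor \<psi> \<phi>))"
proof -
  define G where "G p = g (coords p)" for p
  have gm [measurable]: "g \<in> borel_measurable borel" by (rule L2_haar_measurable[OF g])
  have GL: "G \<in> L2 lborel" unfolding G_def by (rule L2_haar[OF g])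
  have Gi: "integrable lborel G" using gi unfolding G_def by (simp add: integrable_haar)
  have "AE \<xi> in lborel. (\<lambda>r. wkernel G (\<xi>, r)) \<in> L2 lborel" by (rule L2_section[OF wkernel_L2[OF GL Gi]])
  then have "AE \<xi> in lborel. \<forall>\<phi>\<in>L2 lborel. heis_fourier g \<xi> \<phi> \<in> L2 lborel \<and>
    (\<forall>\<psi>\<in>L2 lborel. of_real (sqrt \<bar>\<xi>\<bar>) * inner_L2 lborel (heis_fourier g \<xi> \<phi>) \<psi> =
       inner_L2 lborel (\<lambda>r. wkernel G (\<xi>, r)) (tensor \<psi> \<phi>))"
    using AE_lborel_singleton[of 0]
  proof eventually_elim
    case (elim \<xi>)
    define k where "k r = fourier_plane (\<lambda>p. G (fst r - snd r, p)) (\<xi> * fst r) \<xi>" for r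
    have Wk: "wkernel G (\<xi>, r) = of_real (sqrt \<bar>\<xi>\<bar>) * k r" for r by (cases r) (simp add: wkernel_apply k_def)
    \<comment> \<open>Away from \<xi> = 0 one can divide by the weight, which puts the unweighted
      kernel in L2.\<close>
    have "k = (\<lambda>r. of_real (1 / sqrt \<bar>\<xi>\<bar>) * wkernel G (\<xi>, r))" using elim(2) by (simp add: Wk fun_eq_iff)
    then have kL: "k \<in> L2 lborel"
      using L2_cmult[OF elim(1), of "of_real (1 / sqrt \<bar>\<xi>\<bar>)"] by (simp only:)
    show ?case
    proof
      fix \<phi> :: "real \<Rightarrow> complex" assume \<phi>: "\<phi> \<in> L2 lborel"
      have [measurable]: "\<phi> \<in> borel_measurable borel" using L2_measurable[OF \<phi>] by auto
      define P where "P \<zeta> \<longleftrightarrow> \<zeta> \<in> L2 lborel \<and>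
         (\<forall>\<psi>\<in>L2 lborel. inner_L2 lborel \<zeta> \<psi> = (LINT n|haar. g n * inner_L2 lborel (schroedinger \<xi> n \<phi>) \<psi>))" for \<zeta>
      have pair: "(LINT n|haar. g n * inner_L2 lborel (schroedinger \<xi> n \<phi>) \<psi>) = inner_L2 lborel k (tensor \<psi> \<phi>)"
        if \<psi>: "\<psi> \<in> L2 lborel" for \<psi>
      proof -
        have [measurable]: "\<psi> \<in> borel_measurable borel" using L2_measurable[OF \<psi>] by auto
        have "(\<lambda>n. g n * inner_L2 lborel (schroedinger \<xi> n \<phi>) \<psi>) \<in> borel_measurable borel"
          unfolding inner_L2_def schroedinger_def Let_def by measurable
        from integral_haar[OF this]
        have "(LINT n|haar. g n * inner_L2 lborel (schroedinger \<xi> n \<phi>) \<psi>)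
            = (LINT p|lborel. G p * inner_L2 lborel (schroedinger \<xi> (coords p) \<phi>) \<psi>)"
          by (simp add: G_def)
        also have "\<dots> = inner_L2 lborel (\<lambda>t. LINT s|lborel. k (t, s) * \<phi> s) \<psi>"
          unfolding k_def fst_conv snd_conv by (rule heis_fourier_pairing[OF Gi \<phi> \<psi>])
        also have "\<dots> = inner_L2 lborel k (tensor \<psi> \<phi>)" by (rule inner_kernel_oper[OF kL \<phi> \<psi>])
        finally show ?thesis .
      qed
      \<comment> \<open>Integration against the kernel is a witness, so the value chosen by
        \<open>heis_fourier\<close> satisfies P as well, and P prescribes all its inner
        products.\<close>
      have "P (\<lambda>t. LINT s|lborel. k (t, s) * \<phi> s)"
        unfolding P_def by (simp add: pair kernel_oper_L2[OF kL \<phi>] inner_kernel_oper[OF kL \<phi>])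
      then have "P (heis_fourier g \<xi> \<phi>)"
        unfolding heis_fourier_def P_def[symmetric] by (rule someI[of P])
      then show "heis_fourier g \<xi> \<phi> \<in> L2 lborel \<and>
        (\<forall>\<psi>\<in>L2 lborel. of_real (sqrt \<bar>\<xi>\<bar>) * inner_L2 lborel (heis_fourier g \<xi> \<phi>) \<psi> =
          inner_L2 lborel (\<lambda>r. wkernel G (\<xi>, r)) (tensor \<psi> \<phi>))"
        unfolding P_def Wk inner_L2_cmult_left by (simp add: pair)
    qed
  qed
  then show ?thesis unfolding G_def .
qed

text \<open>The basis chosen inside \<open>hs_norm_sq\<close>, so that each summand of the
  Hilbert-Schmidt norm is the energy of the image of one basis vector.\<close>

definition some_basis :: "nat \<Rightarrow> real \<Rightarrow> complex" where
  "some_basis = (SOME e. orthonormal_basis e)"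

lemma some_basis: "orthonormal_basis some_basis"
  unfolding some_basis_def by (rule someI_ex[OF orthonormal_basis_exists])

lemma some_basis_L2: "some_basis i \<in> L2 lborel"
  using some_basis unfolding orthonormal_basis_def by blast

lemma energy_some_basis: "energy lborel (some_basis i) = 1"
proof -
  have "inner_L2 lborel (some_basis i) (some_basis i) = (if i = i then 1 else 0)"
    using some_basis unfolding orthonormal_basis_def by blast
  then have "complex_of_real ((norm_L2 lborel (some_basis i))\<^sup>2) = 1"
    using inner_L2_self[of lborel "some_basis i"] by simp
  then have "(norm_L2 lborel (some_basis i))\<^sup>2 = 1" by (simp only: of_real_eq_1_iff)
  then show ?thesis by (simp only: energy_L2[OF some_basis_L2] ennreal_1)
qed

lemma energy_le_hs_norm_sq:
  assumes "T (some_basis i) \<in> L2 lborel"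
  shows "energy lborel (T (some_basis i)) \<le> hs_norm_sq T"
proof -
  have "(\<Sum>i\<in>{i}. ennreal ((norm_L2 lborel (T (some_basis i)))\<^sup>2)) \<le> (\<Sum>i. ennreal ((norm_L2 lborel (T (some_basis i)))\<^sup>2))"
    by (rule sum_le_suminf) auto
  then have "ennreal ((norm_L2 lborel (T (some_basis i)))\<^sup>2) \<le> (\<Sum>i. ennreal ((norm_L2 lborel (T (some_basis i)))\<^sup>2))"
    by simp
  then show ?thesis unfolding energy_L2[OF assms] hs_norm_sq_def some_basis_def[symmetric] .
qed

lemma energy_completion:
  assumes "f \<in> borel_measurable M"
  shows "energy (completion M) f = energy M f"
  unfolding energy_def using assms by (intro nn_integral_completion)

text \<open>Along the sequence from \<open>plancherel\<close>, each matrix coefficient converges in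
  L2 of \<xi> both to that of K and to the weighted one of T, so the two agree almost everywhere.
  The pairs (i, j) are countable and share one null set.\<close>

theorem ktransform_plancherel:
  assumes pl: "plancherel f T" and ktransform: "ktransform (\<lambda>p. f (coords p)) K"
  shows "AE \<xi> in lebesgue. \<forall>i j. inner_L2 lborel (\<lambda>r. K (\<xi>, r)) (tensor (some_basis j) (some_basis i)) =
     of_real (sqrt \<bar>\<xi>\<bar>) * inner_L2 lborel (T \<xi> (some_basis i)) (some_basis j)"
proof -
  let ?e = some_basis
  from pl have f: "f \<in> L2 haar" and T: "T \<in> hs_fields" by (auto simp: plancherel_def)
  from pl obtain g where g: "\<forall>n. g n \<in> L2 haar \<and> integrable haar (g n)"
    "(\<lambda>n. norm_L2 haar (\<lambda>x. g n x - f x)) \<longlonglongrightarrow> 0"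
    "(\<lambda>n. \<integral>\<^sup>+\<xi>. hs_norm_sq (\<lambda>\<phi> t. heis_fourier (g n) \<xi> \<phi> t - T \<xi> \<phi> t) * ennreal \<bar>\<xi>\<bar> \<partial>lebesgue) \<longlonglongrightarrow> 0"
    unfolding plancherel_def by (elim conjE exE) (rule that)
  have gL: "g n \<in> L2 haar" and gi: "integrable haar (g n)" for n using g(1) by auto
  define G where "G n p = g n (coords p)" for n p
  define F where "F p = f (coords p)" for p
  have [measurable]: "f \<in> borel_measurable borel" "g n \<in> borel_measurable borel" for n
    by (rule L2_haar_measurable[OF f] L2_haar_measurable[OF gL])+
  have GL: "G n \<in> L2 lborel" for n unfolding G_def by (rule L2_haar[OF gL])
  have FL: "F \<in> L2 lborel" unfolding F_def by (rule L2_haar[OF f])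
  have Gi: "integrable lborel (G n)" for n using gi[of n] unfolding G_def by (simp add: integrable_haar)
  have GF: "(\<lambda>n. energy lborel (\<lambda>p. G n p - F p)) \<longlonglongrightarrow> 0"
  proof -
    have "energy lborel (\<lambda>p. G n p - F p) = ennreal ((norm_L2 haar (\<lambda>x. g n x - f x))\<^sup>2)" for n
    proof -
      have "energy lborel (\<lambda>p. G n p - F p) = energy haar (\<lambda>x. g n x - f x)"
        unfolding G_def F_def by (rule energy_haar[symmetric]) measurable
      then show ?thesis by (simp only: energy_L2[OF L2_diff[OF gL f]])
    qed
    moreover have "(\<lambda>n. ennreal ((norm_L2 haar (\<lambda>x. g n x - f x))\<^sup>2)) \<longlonglongrightarrow> ennreal (0\<^sup>2)"
      by (intro tendsto_ennrealI tendsto_power g(2))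
    ultimately show ?thesis by simp
  qed
  obtain K' where K': "ktransform F K'" "(\<lambda>n. energy lborel (\<lambda>x. wkernel (G n) x - K' x)) \<longlonglongrightarrow> 0"
    by (rule ktransform_of_approx[OF FL GL Gi GF])
  have KL: "K \<in> L2 lborel" by (rule ktransform_L2(2)[OF ktransform])
  have [measurable]: "K \<in> borel_measurable borel" using L2_measurable[OF KL] by auto
  have [measurable]: "wkernel (G n) \<in> borel_measurable borel" for n using L2_measurable[OF wkernel_L2[OF GL Gi]] by auto
  have "AE x in lborel. K' x = K x" using ktransform_unique[OF K'(1) ktransform[folded F_def]] .
  then have "energy lborel (\<lambda>x. wkernel (G n) x - K' x) = energy lborel (\<lambda>x. wkernel (G n) x - K x)" for n
    by (intro energy_cong_AE) (auto elim!: eventually_mono)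
  with K'(2) have WK: "(\<lambda>n. energy lborel (\<lambda>x. wkernel (G n) x - K x)) \<longlonglongrightarrow> 0" by simp
  have em [measurable]: "?e i \<in> borel_measurable borel" for i using L2_measurable[OF some_basis_L2] by auto
  have tm [measurable]: "tensor (?e j) (?e i) \<in> borel_measurable borel" for i j
    by (rule tensor_measurable[OF some_basis_L2 some_basis_L2])
  have "AE \<xi> in lebesgue. inner_L2 lborel (\<lambda>r. K (\<xi>, r)) (tensor (?e j) (?e i)) =
     of_real (sqrt \<bar>\<xi>\<bar>) * inner_L2 lborel (T \<xi> (?e i)) (?e j)" for i j
  proof -
    define b where "b n \<xi> = inner_L2 lborel (\<lambda>r. wkernel (G n) (\<xi>, r)) (tensor (?e j) (?e i))" for n \<xi>
    define b0 where "b0 \<xi> = inner_L2 lborel (\<lambda>r. K (\<xi>, r)) (tensor (?e j) (?e i))" for \<xi>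
    define c where "c \<xi> = of_real (sqrt \<bar>\<xi>\<bar>) * inner_L2 lborel (T \<xi> (?e i)) (?e j)" for \<xi>
    have bm: "b n \<in> borel_measurable borel" for n unfolding b_def inner_L2_def by measurable
    have b0m: "b0 \<in> borel_measurable borel" unfolding b0_def inner_L2_def by measurable
    have bm': "b n \<in> borel_measurable lebesgue" "b0 \<in> borel_measurable lebesgue" for n
      using bm b0m by (auto intro: measurable_completion)
    \<comment> \<open>The coefficients of a field in \<open>hs_fields\<close> are required only to
      be Lebesgue measurable, so the comparison takes place on the completion.\<close>
    have cm: "c \<in> borel_measurable lebesgue"
    proof -
      have "(\<lambda>\<xi>. inner_L2 lborel (T \<xi> (?e i)) (?e j)) \<in> borel_measurable lebesgue"
        using T some_basis_L2 by (simp add: hs_fields_def)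
      moreover have "(\<lambda>\<xi>::real. complex_of_real (sqrt \<bar>\<xi>\<bar>)) \<in> borel_measurable lebesgue"
        by (rule measurable_completion) measurable
      ultimately show ?thesis unfolding c_def by (rule borel_measurable_times[rotated])
    qed
    \<comment> \<open>Cauchy-Schwarz on each section, against a tensor of energy 1.\<close>
    have e1: "energy lebesgue (\<lambda>\<xi>. b0 \<xi> - b n \<xi>) \<le> energy lborel (\<lambda>x. wkernel (G n) x - K x)" for n
    proof -
      have "energy lebesgue (\<lambda>\<xi>. b0 \<xi> - b n \<xi>) = energy lborel (\<lambda>\<xi>. b0 \<xi> - b n \<xi>)"
        by (rule energy_completion) (use bm b0m in measurable)
      also have "\<dots> \<le> (\<integral>\<^sup>+\<xi>. energy lborel (\<lambda>r. K (\<xi>, r) - wkernel (G n) (\<xi>, r)) \<partial>lborel)"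
        unfolding energy_def[of _ "\<lambda>\<xi>. b0 \<xi> - b n \<xi>"]
      proof (rule nn_integral_mono_AE, use L2_section[OF KL] L2_section[OF wkernel_L2[OF GL Gi, of n]] in eventually_elim)
        case (elim \<xi>)
        have "b0 \<xi> - b n \<xi> = inner_L2 lborel (\<lambda>r. K (\<xi>, r) - wkernel (G n) (\<xi>, r)) (tensor (?e j) (?e i))"
          unfolding b0_def b_def using elim by (simp add: inner_L2_diff_left tensor_L2 some_basis_L2)
        then have "ennreal ((cmod (b0 \<xi> - b n \<xi>))\<^sup>2) \<le> energy lborel (\<lambda>r. K (\<xi>, r) - wkernel (G n) (\<xi>, r)) * energy lborel (tensor (?e j) (?e i))"
          by (simp only:) (rule Cauchy_Schwarz_inner, measurable)
        then show ?case by (simp add: energy_tensor some_basis_L2 energy_some_basis)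
      qed
      also have "\<dots> = energy lborel (\<lambda>x. K x - wkernel (G n) x)"
        by (rule energy_lborel_pair[symmetric]) measurable
      finally show ?thesis by (subst energy_minus_commute)
    qed
    \<comment> \<open>One coefficient is bounded by the whole Hilbert-Schmidt norm, and the squared
      weight |\<xi>| is the density of the Plancherel measure.\<close>
    have e2: "energy lebesgue (\<lambda>\<xi>. b n \<xi> - c \<xi>) \<le> (\<integral>\<^sup>+\<xi>. hs_norm_sq (\<lambda>\<phi> t. heis_fourier (g n) \<xi> \<phi> t - T \<xi> \<phi> t) * ennreal \<bar>\<xi>\<bar> \<partial>lebesgue)" for n
      unfolding energy_def
    proof (rule nn_integral_mono_AE)
      have h: "AE \<xi> in lebesgue. hilbert_schmidt (T \<xi>)" using T by (simp add: hs_fields_def)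
      show "AE \<xi> in lebesgue. ennreal ((cmod (b n \<xi> - c \<xi>))\<^sup>2) \<le> hs_norm_sq (\<lambda>\<phi> t. heis_fourier (g n) \<xi> \<phi> t - T \<xi> \<phi> t) * ennreal \<bar>\<xi>\<bar>"
        using h AE_completion[OF heis_fourier_kernel[OF gL gi, of n]]
      proof eventually_elim
        case (elim \<xi>)
        let ?D = "\<lambda>\<phi> t. heis_fourier (g n) \<xi> \<phi> t - T \<xi> \<phi> t"
        have TL: "T \<xi> (?e i) \<in> L2 lborel"
          using elim(1) some_basis_L2 by (simp add: hilbert_schmidt_def bounded_oper_def)
        have HL: "heis_fourier (g n) \<xi> (?e i) \<in> L2 lborel" using elim(2) some_basis_L2 by blast
        have DL: "?D (?e i) \<in> L2 lborel" by (rule L2_diff[OF HL TL])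
        have "b n \<xi> = of_real (sqrt \<bar>\<xi>\<bar>) * inner_L2 lborel (heis_fourier (g n) \<xi> (?e i)) (?e j)"
          using elim(2) some_basis_L2 unfolding b_def G_def by auto
        then have "b n \<xi> - c \<xi> = of_real (sqrt \<bar>\<xi>\<bar>) * inner_L2 lborel (?D (?e i)) (?e j)"
          by (simp add: c_def inner_L2_diff_left[OF HL TL some_basis_L2] right_diff_distrib)
        then have "ennreal ((cmod (b n \<xi> - c \<xi>))\<^sup>2) = ennreal \<bar>\<xi>\<bar> * ennreal ((cmod (inner_L2 lborel (?D (?e i)) (?e j)))\<^sup>2)"
          by (simp add: norm_mult power_mult_distrib ennreal_mult)
        also have "\<dots> \<le> ennreal \<bar>\<xi>\<bar> * (energy lborel (?D (?e i)) * energy lborel (?e j))"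
          by (intro mult_left_mono Cauchy_Schwarz_inner) (use L2_measurable[OF DL] in auto)
        also have "\<dots> \<le> ennreal \<bar>\<xi>\<bar> * hs_norm_sq ?D"
          using energy_le_hs_norm_sq[where T="?D" and i=i, OF DL] by (auto simp: energy_some_basis intro: mult_left_mono)
        finally show ?case by (simp only: mult.commute)
      qed
    qed
    have le: "energy lebesgue (\<lambda>\<xi>. b0 \<xi> - c \<xi>) \<le> 2 * energy lborel (\<lambda>x. wkernel (G n) x - K x) +
       2 * (\<integral>\<^sup>+\<xi>. hs_norm_sq (\<lambda>\<phi> t. heis_fourier (g n) \<xi> \<phi> t - T \<xi> \<phi> t) * ennreal \<bar>\<xi>\<bar> \<partial>lebesgue)" for n
    proof -
      have "energy lebesgue (\<lambda>\<xi>. b0 \<xi> - c \<xi>) \<le> 2 * energy lebesgue (\<lambda>\<xi>. b0 \<xi> - b n \<xi>) + 2 * energy lebesgue (\<lambda>\<xi>. b n \<xi> - c \<xi>)"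
        by (rule energy_diff_triangle[OF bm'(2) bm'(1) cm])
      also have "\<dots> \<le> 2 * energy lborel (\<lambda>x. wkernel (G n) x - K x) +
       2 * (\<integral>\<^sup>+\<xi>. hs_norm_sq (\<lambda>\<phi> t. heis_fourier (g n) \<xi> \<phi> t - T \<xi> \<phi> t) * ennreal \<bar>\<xi>\<bar> \<partial>lebesgue)"
        by (intro add_mono mult_left_mono e1 e2) auto
      finally show ?thesis .
    qed
    have "(\<lambda>n. 2 * energy lborel (\<lambda>x. wkernel (G n) x - K x) +
       2 * (\<integral>\<^sup>+\<xi>. hs_norm_sq (\<lambda>\<phi> t. heis_fourier (g n) \<xi> \<phi> t - T \<xi> \<phi> t) * ennreal \<bar>\<xi>\<bar> \<partial>lebesgue)) \<longlonglongrightarrow> 2 * 0 + 2 * 0"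
      by (intro tendsto_add ennreal_tendsto_cmult WK g(3)) auto
    then have "energy lebesgue (\<lambda>\<xi>. b0 \<xi> - c \<xi>) \<le> 2 * 0 + 2 * 0"
      by (rule tendsto_lowerbound) (use le in auto)
    then have "energy lebesgue (\<lambda>\<xi>. b0 \<xi> - c \<xi>) = 0" by simp
    moreover have "(\<lambda>\<xi>. b0 \<xi> - c \<xi>) \<in> borel_measurable lebesgue"
      by (rule borel_measurable_diff[OF bm'(2) cm])
    ultimately have "AE \<xi> in lebesgue. b0 \<xi> - c \<xi> = 0" using energy_eq_0_iff by blast
    then show ?thesis unfolding b0_def c_def by simp
  qed
  then show ?thesis unfolding AE_all_countable by blast
qed

section \<open>Tilings of the line\<close>

lemma AE_lborel_affine:
  assumes "AE x in lborel. P x" and "c \<noteq> (0::real)"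
  shows "AE x in lborel. P (t + c * x)"
proof -
  obtain N where N: "{x \<in> space lborel. \<not> P x} \<subseteq> N" "N \<in> null_sets lborel"
    using assms(1) unfolding eventually_ae_filter by blast
  have [measurable]: "N \<in> sets borel" using N(2) by auto
  have "AE x in lborel. x \<notin> N" by (rule AE_not_in[OF N(2)])
  then have "AE x in lborel. t + c * x \<notin> N" by (intro AE_borel_affine assms(2)) measurable
  then show ?thesis by eventually_elim (use N(1) in auto)
qed

lemma AE_null_equal:
  assumes "null_equal I J" shows "AE x in lborel. x \<in> I \<longleftrightarrow> x \<in> J"
proof -
  have "AE x in lebesgue. x \<notin> sym_diff I J" by (rule AE_not_in) (use assms in \<open>simp add: null_equal_def\<close>)
  then have "AE x in lebesgue. x \<in> I \<longleftrightarrow> x \<in> J" by eventually_elim auto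
  then show ?thesis by (simp only: AE_completion_iff)
qed

text \<open>The bijection moves points only within a coset x + \<int>. Almost every coset meets J
  exactly where it meets (0, 1], that is once, and therefore meets S once. Countably many null sets
  account for all integer translates.\<close>

lemma translation_tiling:
  assumes "translation_congruent S {0<..1}"
  shows "AE x in lborel. \<exists>!n::int. x + of_int n \<in> S"
proof -
  obtain I J \<rho> and k :: "real \<Rightarrow> int" where IJ: "null_equal S I" "null_equal {0<..1} J"
    and \<rho>: "bij_betw \<rho> I J" "\<forall>\<xi>\<in>I. \<rho> \<xi> = \<xi> + of_int (k \<xi>)"
    using assms unfolding translation_congruent_def by blast
  have "AE x in lborel. \<forall>n::int. (x + of_int n \<in> S \<longleftrightarrow> x + of_int n \<in> I) \<and> (x + of_int n \<in> {0<..1} \<longleftrightarrow> x + of_int n \<in> J)"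
    unfolding AE_all_countable
  proof
    fix n :: int
    show "AE x in lborel. (x + of_int n \<in> S \<longleftrightarrow> x + of_int n \<in> I) \<and> (x + of_int n \<in> {0<..1} \<longleftrightarrow> x + of_int n \<in> J)"
      using AE_lborel_affine[OF AE_null_equal[OF IJ(1)], of 1 "of_int n"] AE_lborel_affine[OF AE_null_equal[OF IJ(2)], of 1 "of_int n"]
      by (simp add: add.commute)
  qed
  then show ?thesis
  proof eventually_elim
    case (elim x)
    then have S: "x + of_int n \<in> S \<longleftrightarrow> x + of_int n \<in> I" and J: "x + of_int n \<in> {0<..1} \<longleftrightarrow> x + of_int n \<in> J" for n :: int by auto
    have shift: "\<rho> (x + of_int n) = x + of_int (n + k (x + of_int n))" if "x + of_int n \<in> I" for n
      using \<rho>(2) that by simp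
    show ?case
    proof (rule ex_ex1I)
      \<comment> \<open>The interval contains its right end and not its left, so it is the ceiling
        that selects the representative.\<close>
      have "x + of_int (1 - \<lceil>x\<rceil>) \<in> {0<..1}" by simp linarith
      then have "x + of_int (1 - \<lceil>x\<rceil>) \<in> J" by (simp only: J)
      then obtain \<eta> where \<eta>: "\<eta> \<in> I" "\<rho> \<eta> = x + of_int (1 - \<lceil>x\<rceil>)" using \<rho>(1) by (auto simp: bij_betw_def)
      then have "\<eta> = x + of_int (1 - \<lceil>x\<rceil> - k \<eta>)" using \<rho>(2) by simp
      with \<eta>(1) S show "\<exists>n::int. x + of_int n \<in> S" by metis
    next
      fix n n' :: int assume "x + of_int n \<in> S" "x + of_int n' \<in> S"
      then have I: "x + of_int n \<in> I" "x + of_int n' \<in> I" using S by auto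
      then have "\<rho> (x + of_int n) \<in> J" "\<rho> (x + of_int n') \<in> J" using \<rho>(1) by (auto simp: bij_betw_def)
      then have "x + of_int (n + k (x + of_int n)) \<in> {0<..1}" "x + of_int (n' + k (x + of_int n')) \<in> {0<..1}"
        using shift I J by metis+
      then have "n + k (x + of_int n) = n' + k (x + of_int n')" by simp
      then have "\<rho> (x + of_int n) = \<rho> (x + of_int n')" using shift I by simp
      then have "x + of_int n = x + of_int n'" by (rule inj_onD[OF bij_betw_imp_inj_on[OF \<rho>(1)] _ I])
      then show "n = n'" by simp
    qed
  qed
qed

lemma two_powi_unique:
  assumes "(1::real)/2 < y" "y \<le> 1" "1/2 < 2 powi m * y" "2 powi m * y \<le> 1"
  shows "m = 0"
proof (rule ccontr)
  assume "m \<noteq> 0"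
  then consider "m \<ge> 1" | "m \<le> -1" by linarith
  then show False
  proof cases
    case 1
    then have "(2::real) powi 1 \<le> 2 powi m" by (rule power_int_increasing) auto
    then have "2 * y \<le> 2 powi m * y" using assms by (intro mult_right_mono) auto
    then show False using assms by linarith
  next
    case 2
    then have "(2::real) powi m \<le> 2 powi (-1)" by (rule power_int_increasing) auto
    then have "2 powi m * y \<le> 1/2 * y" using assms by (intro mult_right_mono) (auto simp: power_int_minus)
    then show False using assms by linarith
  qed
qed

lemma two_powi_exists:
  assumes "0 < y"
  shows "\<exists>m. (1::real)/2 < 2 powi m * y \<and> 2 powi m * y \<le> 1"
proof
  \<comment> \<open>After scaling, the binary logarithm lies in (-1, 0], which matches the half-open
    interval (1/2, 1].\<close>
  let ?m = "- \<lceil>log 2 y\<rceil>"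
  have "2 powi ?m * y = 2 powr (real_of_int ?m) * 2 powr (log 2 y)"
    using assms powr_real_of_int'[of 2 ?m] by simp
  also have "\<dots> = 2 powr (log 2 y - \<lceil>log 2 y\<rceil>)" by (simp only: powr_add[symmetric]) simp
  finally have eq: "2 powi ?m * y = 2 powr (log 2 y - \<lceil>log 2 y\<rceil>)" .
  have "2 powr (-1) < 2 powr (log 2 y - \<lceil>log 2 y\<rceil>)" by (rule powr_less_mono) linarith+
  moreover have "2 powr (log 2 y - \<lceil>log 2 y\<rceil>) \<le> 2 powr 0" by (rule powr_mono) linarith+
  ultimately show "1/2 < 2 powi ?m * y \<and> 2 powi ?m * y \<le> 1" by (simp add: eq powr_minus)
qed

text \<open>The argument for translations carried over to the orbits of multiplication by powers of
  2, with 0 left out. Membership in the reference set depends on |y| alone (\<open>D\<close>), so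
  both signs are treated together.\<close>

lemma dilation_tiling:
  assumes "dilation_congruent S ({-1..<-1/2} \<union> {1/2<..1})"
  shows "AE x in lborel. \<exists>!m::int. 2 powi m * x \<in> S"
proof -
  let ?D = "{-1..<-1/2} \<union> {1/2<..1::real}"
  have D: "y \<in> ?D \<longleftrightarrow> 1/2 < \<bar>y\<bar> \<and> \<bar>y\<bar> \<le> 1" for y by auto
  obtain I J \<rho> and k :: "real \<Rightarrow> int" where IJ: "null_equal S I" "null_equal ?D J"
    and \<rho>: "bij_betw \<rho> I J" "\<forall>\<xi>\<in>I. \<rho> \<xi> = 2 powi (k \<xi>) * \<xi>"
    using assms unfolding dilation_congruent_def by blast
  have "AE x in lborel. \<forall>n::int. (2 powi n * x \<in> S \<longleftrightarrow> 2 powi n * x \<in> I) \<and> (2 powi n * x \<in> ?D \<longleftrightarrow> 2 powi n * x \<in> J)"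
    unfolding AE_all_countable
  proof
    fix n :: int
    have "2 powi n \<noteq> (0::real)" by simp
    from AE_lborel_affine[OF AE_null_equal[OF IJ(1)] this, of 0] AE_lborel_affine[OF AE_null_equal[OF IJ(2)] this, of 0]
    show "AE x in lborel. (2 powi n * x \<in> S \<longleftrightarrow> 2 powi n * x \<in> I) \<and> (2 powi n * x \<in> ?D \<longleftrightarrow> 2 powi n * x \<in> J)"
      unfolding add_0 by (rule AE_conjI)
  qed
  then show ?thesis using AE_lborel_singleton[of 0]
  proof eventually_elim
    case (elim x)
    then have S: "2 powi n * x \<in> S \<longleftrightarrow> 2 powi n * x \<in> I" and J: "2 powi n * x \<in> ?D \<longleftrightarrow> 2 powi n * x \<in> J" for n :: int by blast+
    have shift: "\<rho> (2 powi n * x) = 2 powi (k (2 powi n * x) + n) * x" if "2 powi n * x \<in> I" for n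
      using \<rho>(2) that by (simp add: power_int_add)
    show ?case
    proof (rule ex_ex1I)
      obtain n0 where "1/2 < 2 powi n0 * \<bar>x\<bar>" "2 powi n0 * \<bar>x\<bar> \<le> 1" using two_powi_exists[of "\<bar>x\<bar>"] elim(2) by auto
      then have "2 powi n0 * x \<in> ?D" unfolding D by (simp add: abs_mult)
      then have "2 powi n0 * x \<in> J" by (simp only: J)
      then obtain \<eta> where \<eta>: "\<eta> \<in> I" "\<rho> \<eta> = 2 powi n0 * x" using \<rho>(1) by (auto simp: bij_betw_def)
      then have "2 powi k \<eta> * \<eta> = 2 powi n0 * x" using \<rho>(2) by simp
      then have "\<eta> = 2 powi (n0 - k \<eta>) * x" by (simp add: power_int_diff field_simps)
      with \<eta>(1) S show "\<exists>n::int. 2 powi n * x \<in> S" by metis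
    next
      fix n n' :: int assume "2 powi n * x \<in> S" "2 powi n' * x \<in> S"
      then have I: "2 powi n * x \<in> I" "2 powi n' * x \<in> I" using S by auto
      define p where "p = k (2 powi n * x) + n"
      define p' where "p' = k (2 powi n' * x) + n'"
      have "\<rho> (2 powi n * x) \<in> J" "\<rho> (2 powi n' * x) \<in> J" using \<rho>(1) I by (auto simp: bij_betw_def)
      then have "2 powi p * x \<in> ?D" "2 powi p' * x \<in> ?D"
        unfolding shift[OF I(1)] shift[OF I(2)] p_def[symmetric] p'_def[symmetric] by (simp_all only: J)
      then have pD: "1/2 < 2 powi p * \<bar>x\<bar>" "2 powi p * \<bar>x\<bar> \<le> 1" "1/2 < 2 powi p' * \<bar>x\<bar>" "2 powi p' * \<bar>x\<bar> \<le> 1"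
        unfolding D by (simp_all add: abs_mult)
      have "2 powi p = 2 powi (p - p') * (2 powi p' :: real)" by (simp add: power_int_diff)
      then have "p - p' = 0" using two_powi_unique[OF pD(3,4), of "p - p'"] pD(1,2) by (simp add: mult.assoc)
      then have "\<rho> (2 powi n * x) = \<rho> (2 powi n' * x)" using shift[OF I(1)] shift[OF I(2)] by (simp add: p_def p'_def)
      then have "2 powi n * x = 2 powi n' * x" by (rule inj_onD[OF bij_betw_imp_inj_on[OF \<rho>(1)] _ I])
      then have "(2::real) powi n = 2 powi n'" using elim(2) by simp
      then show "n = n'"
        using power_int_strict_increasing[of n n' "2::real"] power_int_strict_increasing[of n' n "2::real"]
        by (cases n n' rule: linorder_cases) simp_all
    qed
  qed
qed

lemma nn_integral_indicator_ex1:
  assumes "\<exists>!n. P n"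
  shows "(\<integral>\<^sup>+n. indicator {n. P n} n \<partial>count_space UNIV) = (1::ennreal)"
proof -
  obtain a where "{n. P n} = {a}" using assms by auto
  then show ?thesis by simp
qed

text \<open>Each fibre x + \<int> carries at most one nonzero term, so the square of the sum is the
  sum of the squares.\<close>

lemma energy_periodize_disjoint:
  assumes [measurable]: "B \<in> borel_measurable borel"
    and B: "AE x in lborel. \<exists>n0::int. \<forall>n. n \<noteq> n0 \<longrightarrow> B (x + of_int n) = 0"
  shows "energy lborel (periodize B) = energy lborel B"
proof -
  have "energy lborel B = (\<integral>\<^sup>+x. indicator {0..<1} x * (\<integral>\<^sup>+k. ennreal ((cmod (B (x + of_int k)))\<^sup>2) \<partial>count_space (UNIV :: int set)) \<partial>lborel)"
    unfolding energy_def by (rule nn_integral_periodize) measurable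
  also have "\<dots> = energy lborel (periodize B)"
    unfolding energy_def
  proof (rule nn_integral_cong_AE, use B in eventually_elim)
    fix x assume "\<exists>n0::int. \<forall>n. n \<noteq> n0 \<longrightarrow> B (x + of_int n) = 0"
    then obtain n0 :: int where n0: "\<And>n. n \<noteq> n0 \<Longrightarrow> B (x + of_int n) = 0" by blast
    have "(\<Sum>i. B (x + int_enum i)) = B (x + of_int n0)"
    proof -
      have "B (x + int_enum i) = (if i = int_encode n0 then B (x + of_int n0) else 0)" for i
        using n0[of "int_decode i"] by (cases "int_decode i = n0") (auto simp: int_encode_inverse)
      then show ?thesis using sums_single[of "int_encode n0" "\<lambda>_. B (x + of_int n0)"] by (simp add: sums_iff)
    qed
    moreover have "(\<integral>\<^sup>+k. ennreal ((cmod (B (x + of_int k)))\<^sup>2) \<partial>count_space (UNIV :: int set)) = ennreal ((cmod (B (x + of_int n0)))\<^sup>2)"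
    proof -
      have "ennreal ((cmod (B (x + of_int k)))\<^sup>2) = ennreal ((cmod (B (x + of_int n0)))\<^sup>2) * indicator {n0} k" for k
        using n0[of k] by (auto simp: indicator_def)
      then have "(\<integral>\<^sup>+k. ennreal ((cmod (B (x + of_int k)))\<^sup>2) \<partial>count_space (UNIV :: int set))
          = (\<integral>\<^sup>+k. ennreal ((cmod (B (x + of_int n0)))\<^sup>2) * indicator {n0} k \<partial>count_space UNIV)"
        by (rule nn_integral_cong)
      then show ?thesis by (simp add: nn_integral_cmult)
    qed
    ultimately show "indicator {0..<1} x * (\<integral>\<^sup>+k. ennreal ((cmod (B (x + of_int k)))\<^sup>2) \<partial>count_space (UNIV :: int set)) = ennreal ((cmod (periodize B x))\<^sup>2)"
      by (simp add: periodize_def indicator_def)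
  qed
  finally show ?thesis ..
qed

section \<open>Tensor products of Parseval frames\<close>

lemma parseval_frame_nn:
  assumes "parseval_frame M I F" "h \<in> L2 M"
  shows "(\<integral>\<^sup>+i. ennreal ((cmod (inner_L2 M h (F i)))\<^sup>2) \<partial>count_space I) = energy M h"
proof -
  have "((\<lambda>i. (cmod (inner_L2 M h (F i)))\<^sup>2) has_sum (norm_L2 M h)\<^sup>2) I"
    using assms unfolding parseval_frame_def by blast
  then show ?thesis by (subst (asm) has_sum_iff_nn_integral) (simp_all add: energy_L2[OF assms(2)])
qed

lemma parseval_frame_bij:
  assumes "parseval_frame M I F" "h \<in> L2 M" "bij_betw b I' I"
  shows "(\<integral>\<^sup>+i. ennreal ((cmod (inner_L2 M h (F (b i))))\<^sup>2) \<partial>count_space I') = energy M h"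
  using parseval_frame_nn[OF assms(1,2)]
    nn_integral_bij_count_space[OF assms(3), of "\<lambda>i. ennreal ((cmod (inner_L2 M h (F i)))\<^sup>2)"] by simp

text \<open>The frame V is applied in s, for almost every t, and the frame U in t to each
  coefficient function \<open>A j\<close>; Tonelli joins the two. The conjugate on
  \<open>V j\<close> undoes the one in \<open>tensor\<close>.\<close>

lemma parseval_tensor:
  fixes U :: "'i \<Rightarrow> real \<Rightarrow> complex" and V :: "'j::countable \<Rightarrow> real \<Rightarrow> complex"
  assumes k: "k \<in> L2 lborel" and U: "\<And>i. U i \<in> L2 lborel" and V: "\<And>j. V j \<in> L2 lborel"
    and PU: "\<And>h. h \<in> L2 lborel \<Longrightarrow> (\<integral>\<^sup>+i. ennreal ((cmod (inner_L2 lborel h (U i)))\<^sup>2) \<partial>count_space UNIV) = energy lborel h"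
    and PV: "\<And>h. h \<in> L2 lborel \<Longrightarrow> (\<integral>\<^sup>+j. ennreal ((cmod (inner_L2 lborel h (V j)))\<^sup>2) \<partial>count_space UNIV) = energy lborel h"
  shows "(\<integral>\<^sup>+j. \<integral>\<^sup>+i. ennreal ((cmod (inner_L2 lborel k (tensor (U i) (\<lambda>s. cnj (V j s)))))\<^sup>2) \<partial>count_space UNIV \<partial>count_space UNIV) = energy lborel k"
proof -
  have [measurable]: "k \<in> borel_measurable borel" using L2_measurable[OF k] by auto
  have [measurable]: "V j \<in> borel_measurable borel" for j using L2_measurable[OF V] by auto
  define A where "A j t = inner_L2 lborel (\<lambda>s. k (t, s)) (V j)" for j t
  have Aeq: "A j = (\<lambda>t. LINT s|lborel. k (t, s) * cnj (V j s))" for j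
    by (simp add: A_def inner_L2_def fun_eq_iff)
  have AL: "A j \<in> L2 lborel" for j
    unfolding Aeq by (rule kernel_oper_L2[OF k L2_cnj[OF V]])
  have Am: "A j \<in> borel_measurable lborel" for j by (rule L2_measurable[OF AL])
  have "inner_L2 lborel k (tensor (U i) (\<lambda>s. cnj (V j s))) = inner_L2 lborel (A j) (U i)" for i j
    unfolding Aeq by (rule inner_kernel_oper[OF k L2_cnj[OF V] U, symmetric])
  then have "(\<integral>\<^sup>+j. \<integral>\<^sup>+i. ennreal ((cmod (inner_L2 lborel k (tensor (U i) (\<lambda>s. cnj (V j s)))))\<^sup>2) \<partial>count_space UNIV \<partial>count_space UNIV)
     = (\<integral>\<^sup>+j. energy lborel (A j) \<partial>count_space UNIV)"
    by (simp add: PU[OF AL])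
  also have "\<dots> = (\<integral>\<^sup>+t. \<integral>\<^sup>+j. ennreal ((cmod (A j t))\<^sup>2) \<partial>count_space UNIV \<partial>lborel)"
    unfolding energy_def by (rule nn_integral_count_space_nn_integral[symmetric]) (use Am in measurable)
  also have "\<dots> = (\<integral>\<^sup>+t. energy lborel (\<lambda>s. k (t, s)) \<partial>lborel)"
    by (rule nn_integral_cong_AE, use L2_section[OF k] in eventually_elim) (simp add: A_def PV)
  also have "\<dots> = energy lborel k" by (rule energy_lborel_pair[symmetric]) measurable
  finally show ?thesis .
qed

lemma bij_lattice: "\<xi> \<noteq> 0 \<Longrightarrow> bij_betw (\<lambda>(n::int, j::int). (1 * of_int n, \<xi> * of_int j)) UNIV (lattice_Z 1 \<times> lattice_Z \<xi>)"
  by (auto simp: bij_betw_def inj_on_def lattice_Z_def image_iff)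

text \<open>Enumerates the lattice with the sign of the modulation reversed, because left
  translation modulates the first kernel variable with a minus sign.\<close>

lemma bij_lattice': "\<xi> \<noteq> 0 \<Longrightarrow> bij_betw (\<lambda>(n::int, j::int). (1 * of_int n, - \<xi> * of_int j)) UNIV (lattice_Z 1 \<times> lattice_Z \<xi>)"
proof -
  assume "\<xi> \<noteq> 0"
  moreover have "lattice_Z (- \<xi>) = lattice_Z \<xi>"
  proof (intro set_eqI iffI)
    fix y assume "y \<in> lattice_Z (- \<xi>)"
    then obtain j :: int where "y = \<xi> * of_int (- j)" by (auto simp: lattice_Z_def)
    then show "y \<in> lattice_Z \<xi>" unfolding lattice_Z_def by blast
  next
    fix y assume "y \<in> lattice_Z \<xi>"
    then obtain j :: int where "y = - \<xi> * of_int (- j)" by (auto simp: lattice_Z_def)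
    then show "y \<in> lattice_Z (- \<xi>)" unfolding lattice_Z_def by blast
  qed
  ultimately show ?thesis using bij_lattice[of "- \<xi>"] by simp
qed

section \<open>The group action in coordinates\<close>

lemma matrix_inv_eqI:
  fixes A B :: "real^'n^'n"
  assumes "A ** B = mat 1" "B ** A = mat 1"
  shows "matrix_inv A = B"
proof -
  have "A ** matrix_inv A = mat 1 \<and> matrix_inv A ** A = mat 1"
    unfolding matrix_inv_def by (rule someI[of _ B]) (simp add: assms)
  then have "matrix_inv A = matrix_inv A ** (A ** B)" by (simp add: assms)
  also have "\<dots> = B" using \<open>A ** matrix_inv A = mat 1 \<and> matrix_inv A ** A = mat 1\<close> by (simp add: matrix_mul_assoc)
  finally show ?thesis .
qed

lemma heis_0: "heis 0 0 0 = mat 1"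
  by (simp add: heis_def mat_def vec_eq_iff forall_4)

lemma matrix_inv_heis: "matrix_inv (heis x y z) = heis (- x) (- y) (- z + x * y)"
  by (rule matrix_inv_eqI) (simp_all add: heis_mult heis_0)

lemma bireg_coords:
  "bireg (heis k3 k2 k1) (heis m3 m2 0) f (coords p) =
     f (coords (fst p - k3 + m3, fst (snd p) - k2 + m2, snd (snd p) - k1 + k3 * k2 - k3 * fst (snd p) + (fst p - k3) * m2))"
  by (simp add: bireg_def left_reg_def right_reg_def coords_def matrix_inv_heis heis_mult algebra_simps)

text \<open>A family closed under products and inverses that contains \<open>dil_matrix a b\<close>,
  so that \<open>matrix_powi\<close> can be computed entry by entry.\<close>

definition diag4 :: "real \<Rightarrow> real \<Rightarrow> real \<Rightarrow> real^4^4" where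
  "diag4 p q r = vector [vector [p, 0, 0, 0], vector [0, q, 0, 0], vector [0, 0, r, 0], vector [0, 0, 0, 1]]"

lemma dil_matrix_diag4: "dil_matrix a b = diag4 2 b a"
  by (simp add: dil_matrix_def diag4_def)

lemma diag4_mult: "diag4 p q r ** diag4 p' q' r' = diag4 (p * p') (q * q') (r * r')"
  by (simp add: diag4_def matrix_matrix_mult_def vec_eq_iff forall_4 sum_4)

lemma diag4_1: "diag4 1 1 1 = mat 1"
  by (simp add: diag4_def mat_def vec_eq_iff forall_4)

lemma diag4_funpow: "(((**) (diag4 p q r)) ^^ n) (mat 1) = diag4 (p ^ n) (q ^ n) (r ^ n)"
  by (induction n) (simp_all add: diag4_1 diag4_mult)

lemma matrix_inv_diag4: "p \<noteq> 0 \<Longrightarrow> q \<noteq> 0 \<Longrightarrow> r \<noteq> 0 \<Longrightarrow> matrix_inv (diag4 p q r) = diag4 (inverse p) (inverse q) (inverse r)"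
  by (rule matrix_inv_eqI) (simp_all add: diag4_mult diag4_1)

lemma matrix_powi_diag4:
  "p \<noteq> 0 \<Longrightarrow> q \<noteq> 0 \<Longrightarrow> r \<noteq> 0 \<Longrightarrow> matrix_powi (diag4 p q r) m = diag4 (p powi m) (q powi m) (r powi m)"
  by (simp add: matrix_powi_def matrix_inv_diag4 diag4_funpow power_int_def)

text \<open>The coordinate y occurs in two entries, scaled by q in one and by p / r in the other; p
  = q * r makes them agree, and it turns the factor p / q of x into r.\<close>

lemma diag4_conj_heis:
  assumes "p * p' = 1" "q * q' = 1" "r * r' = 1" "p = q * r"
  shows "diag4 p q r ** heis x y z ** diag4 p' q' r' = heis (r * x) (q * y) (p * z)"
proof -
  have 1: "p * q' = r" using assms(2,4) by (simp add: mult_ac)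
  have 2: "p * r' = q" using assms(3,4) by (simp add: mult.assoc)
  show ?thesis using assms(1-3) 1 2
    by (simp add: diag4_def heis_def matrix_matrix_mult_def vec_eq_iff forall_4 sum_4 mult_ac)
qed

lemma dilation_coords:
  assumes "a \<noteq> 0" "b \<noteq> 0" "a * b = 2"
  shows "dilation (dil_matrix a b) m F (coords p) =
     of_real (2 powi (- m)) * F (coords (a powi (- m) * fst p, b powi (- m) * fst (snd p), 2 powi (- m) * snd (snd p)))"
proof -
  have "matrix_powi (dil_matrix a b) (- m) ** coords p ** matrix_powi (dil_matrix a b) m =
      heis (a powi (- m) * fst p) (b powi (- m) * fst (snd p)) (2 powi (- m) * snd (snd p))"
    unfolding dil_matrix_diag4 matrix_powi_diag4[OF zero_neq_numeral[symmetric] assms(2,1)] coords_def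
  proof (rule diag4_conj_heis)
    show "2 powi - m = b powi - m * a powi - m" using assms(3) by (simp add: power_int_mult_distrib[symmetric] mult.commute)
  qed (use assms in \<open>simp_all add: power_int_minus\<close>)
  moreover have "(4::real) powr (- of_int m / 2) = 2 powi (- m)"
  proof -
    have "(4::real) powr (- of_int m / 2) = (2 powr 2) powr (- of_int m / 2)" by simp
    also have "\<dots> = 2 powr (of_int (- m))" unfolding powr_powr by simp
    also have "\<dots> = 2 powi (- m)" by (rule powr_real_of_int') auto
    finally show ?thesis .
  qed
  ultimately show ?thesis by (simp add: dilation_def coords_def)
qed

lemma mult_matrix_measurable:
  "(\<lambda>n::real^4^4. A ** n ** B) \<in> borel_measurable borel"
  by (rule borel_measurable_matrix) (simp add: matrix_matrix_mult_def sum_4)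

lemma dilation_measurable:
  assumes [measurable]: "F \<in> borel_measurable borel"
  shows "dilation A m F \<in> borel_measurable borel"
proof -
  note [measurable] = mult_matrix_measurable
  show ?thesis unfolding dilation_def by measurable
qed

lemma bireg_measurable:
  assumes [measurable]: "F \<in> borel_measurable borel"
  shows "bireg u v F \<in> borel_measurable borel"
proof -
  note [measurable] = mult_matrix_measurable
  show ?thesis unfolding bireg_def left_reg_def right_reg_def by measurable
qed

section \<open>Unitarity of the dilations\<close>

text \<open>Polarization: U is linear, so preservation of energies gives equality of the real parts,
  and replacing g by i times g that of the imaginary parts.\<close>

lemma inner_isometry:
  fixes U :: "('a \<Rightarrow> complex) \<Rightarrow> 'b \<Rightarrow> complex"
  assumes U: "U = (\<lambda>f x. c * f (\<psi> x))" and \<psi>: "\<psi> \<in> measurable N M"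
    and iso: "\<And>f. f \<in> borel_measurable M \<Longrightarrow> energy N (U f) = energy M f"
    and f: "f \<in> L2 M" and g: "g \<in> L2 M"
  shows "inner_L2 N (U f) (U g) = inner_L2 M f g"
proof -
  have UL: "U h \<in> L2 N" if h: "h \<in> L2 M" for h
  proof -
    have m: "h \<in> borel_measurable M" by (rule L2_measurable[OF h])
    have "U h \<in> borel_measurable N" unfolding U
      by (intro borel_measurable_times measurable_compose[OF \<psi> m]) simp
    then show ?thesis using h iso[OF m] by (simp add: L2_iff)
  qed
  have norm: "(norm_L2 N (U h))\<^sup>2 = (norm_L2 M h)\<^sup>2" if h: "h \<in> L2 M" for h
    using iso[OF L2_measurable[OF h]] by (simp add: norm_L2_sq[OF L2_measurable[OF UL[OF h]]] norm_L2_sq[OF L2_measurable[OF h]])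
  have Re: "Re (inner_L2 N (U f) (U h)) = Re (inner_L2 M f h)" if h: "h \<in> L2 M" for h
  proof -
    have "(\<lambda>x. U f x + U h x) = U (\<lambda>x. f x + h x)" by (simp add: U ring_distribs)
    then show ?thesis
      unfolding Re_inner_polarization[OF UL[OF f] UL[OF h]] Re_inner_polarization[OF f h]
      by (simp only: norm[OF L2_add[OF f h]] norm[OF f] norm[OF h])
  qed
  show ?thesis
  proof (rule complex_eqI)
    show "Re (inner_L2 N (U f) (U g)) = Re (inner_L2 M f g)" by (rule Re[OF g])
    have "(\<lambda>x. \<i> * U g x) = U (\<lambda>x. \<i> * g x)" by (simp add: U mult_ac)
    then show "Im (inner_L2 N (U f) (U g)) = Im (inner_L2 M f g)"
      unfolding Im_inner_eq_Re by (simp only: Re[OF L2_cmult[OF g]])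
  qed
qed

text \<open>The adjoint of a dilation is the inverse dilation: h is the dilate of \<open>h'\<close>,
  and \<open>inner_isometry\<close> removes the dilation from both arguments. This moves a dilation
  from the frame element to the test function.\<close>

lemma inner_dilate:
  fixes \<alpha> \<beta> \<delta> :: real
  assumes h: "h \<in> L2 lborel" and g: "g \<in> L2 lborel"
    and nz: "\<alpha> \<noteq> 0" "\<beta> \<noteq> 0" and \<delta>: "\<delta> = \<alpha> * \<beta>" "\<delta> > 0"
  shows "inner_L2 lborel h (\<lambda>p. of_real \<delta> * g (\<alpha> * fst p, \<beta> * fst (snd p), \<delta> * snd (snd p))) =
    inner_L2 lborel (\<lambda>p. of_real (inverse \<delta>) * h (inverse \<alpha> * fst p, inverse \<beta> * fst (snd p), inverse \<delta> * snd (snd p))) g"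
proof -
  define U where "U = (\<lambda>(f :: real \<times> real \<times> real \<Rightarrow> complex) p. of_real \<delta> * f (\<alpha> * fst p, \<beta> * fst (snd p), \<delta> * snd (snd p)))"
  define h' where "h' p = of_real (inverse \<delta>) * h (inverse \<alpha> * fst p, inverse \<beta> * fst (snd p), inverse \<delta> * snd (snd p))" for p
  have [measurable]: "h \<in> borel_measurable borel" using L2_measurable[OF h] by auto
  have h'L: "h' \<in> L2 lborel"
  proof -
    have "inverse \<delta> = inverse \<alpha> * inverse \<beta>" using \<delta>(1) by simp
    moreover have "inverse \<delta> > 0" using \<delta>(2) by simp
    ultimately have "energy lborel h' = energy lborel h"
      unfolding h'_def by (intro energy_dilate) (use nz in simp_all)
    moreover have "h' \<in> borel_measurable lborel" unfolding h'_def by measurable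
    ultimately show ?thesis using h by (simp add: L2_iff)
  qed
  have Uh': "U h' = h" using nz \<delta>(2) by (simp add: U_def h'_def fun_eq_iff mult.assoc[symmetric])
  have "inner_L2 lborel (U h') (U g) = inner_L2 lborel h' g"
  proof (rule inner_isometry[OF U_def _ _ h'L g])
    show "energy lborel (U f) = energy lborel f" if "f \<in> borel_measurable lborel" for f
      unfolding U_def using that by (intro energy_dilate nz \<delta>) simp
  qed measurable
  then show ?thesis unfolding Uh' unfolding U_def h'_def .
qed

section \<open>Identification of the kernel\<close>

lemma inner_tensor:
  assumes "u \<in> L2 lborel" "v \<in> L2 lborel" "\<phi> \<in> L2 lborel" "\<psi> \<in> L2 lborel"
  shows "inner_L2 lborel (tensor u v) (tensor \<psi> \<phi>) = inner_L2 lborel \<phi> v * inner_L2 lborel u \<psi>"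
proof -
  have "(\<lambda>t. LINT s|lborel. tensor u v (t, s) * \<phi> s) = (\<lambda>t. inner_L2 lborel \<phi> v * u t)"
  proof
    fix t
    have "tensor u v (t, s) * \<phi> s = u t * (\<phi> s * cnj (v s))" for s by (simp add: tensor_def mult_ac)
    then have "(LINT s|lborel. tensor u v (t, s) * \<phi> s) = (LINT s|lborel. u t * (\<phi> s * cnj (v s)))"
      by (simp only:)
    then show "(LINT s|lborel. tensor u v (t, s) * \<phi> s) = inner_L2 lborel \<phi> v * u t"
      by (simp add: inner_L2_def)
  qed
  then show ?thesis
    using inner_kernel_oper[OF tensor_L2[OF assms(1,2)] assms(3,4)] by (simp only: inner_L2_cmult_left)
qed

text \<open>Both sides have the same pairings with the tensors of basis vectors, and these are
  total. The vectors u and v are quantified inside the almost-everywhere statement, so that families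
  depending on \<xi>, with no measurability in \<xi>, can be inserted.\<close>

lemma ktransform_rank_one:
  assumes pl: "plancherel f T" and ktransform: "ktransform (\<lambda>p. f (coords p)) K"
  shows "AE \<xi> in lborel. \<forall>u\<in>L2 lborel. \<forall>v\<in>L2 lborel. oper_eq (T \<xi>) (rank_one u v) \<longrightarrow>
     (AE r in lborel. K (\<xi>, r) = of_real (sqrt \<bar>\<xi>\<bar>) * tensor u v r)"
proof -
  have T: "AE \<xi> in lebesgue. hilbert_schmidt (T \<xi>)" using pl unfolding plancherel_def hs_fields_def by blast
  have KL: "K \<in> L2 lborel" by (rule ktransform_L2(2)[OF ktransform])
  have "AE \<xi> in lebesgue. \<forall>u\<in>L2 lborel. \<forall>v\<in>L2 lborel. oper_eq (T \<xi>) (rank_one u v) \<longrightarrow>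
     (AE r in lborel. K (\<xi>, r) = of_real (sqrt \<bar>\<xi>\<bar>) * tensor u v r)"
    using T ktransform_plancherel[OF pl ktransform] AE_completion[OF L2_section[OF KL]]
  proof eventually_elim
    case (elim \<xi>)
    show ?case
    proof (intro ballI impI)
      fix u v assume u: "u \<in> L2 lborel" and v: "v \<in> L2 lborel" and eq: "oper_eq (T \<xi>) (rank_one u v)"
      let ?D = "\<lambda>r. K (\<xi>, r) - of_real (sqrt \<bar>\<xi>\<bar>) * tensor u v r"
      have tL: "(\<lambda>r. of_real (sqrt \<bar>\<xi>\<bar>) * tensor u v r) \<in> L2 lborel" by (rule L2_cmult[OF tensor_L2[OF u v]])
      have "AE r in lborel. ?D r = 0"
      proof (rule tensor_total[OF some_basis L2_diff[OF elim(3) tL]])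
        fix i j
        have Te: "T \<xi> (some_basis i) \<in> L2 lborel"
          using elim(1) some_basis_L2 unfolding hilbert_schmidt_def bounded_oper_def by blast
        have ae: "AE t in lborel. T \<xi> (some_basis i) t = inner_L2 lborel (some_basis i) v * u t"
          using eq some_basis_L2 unfolding oper_eq_def rank_one_def by blast
        have "inner_L2 lborel (T \<xi> (some_basis i)) (some_basis j) = inner_L2 lborel (\<lambda>t. inner_L2 lborel (some_basis i) v * u t) (some_basis j)"
          by (rule inner_L2_cong_AE[OF L2_measurable[OF Te] L2_measurable[OF L2_cmult[OF u]]
                L2_measurable[OF some_basis_L2] L2_measurable[OF some_basis_L2] ae]) simp
        also have "\<dots> = inner_L2 lborel (tensor u v) (tensor (some_basis j) (some_basis i))"
          by (simp only: inner_tensor[OF u v some_basis_L2 some_basis_L2] inner_L2_cmult_left)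
        finally show "inner_L2 lborel ?D (tensor (some_basis j) (some_basis i)) = 0"
          using elim(2) by (simp only: inner_L2_diff_left[OF elim(3) tL tensor_L2[OF some_basis_L2 some_basis_L2]] inner_L2_cmult_left) simp
      qed
      then show "AE r in lborel. K (\<xi>, r) = of_real (sqrt \<bar>\<xi>\<bar>) * tensor u v r" by eventually_elim simp
    qed
  qed
  then show ?thesis by (simp only: AE_completion_iff)
qed

lemma AE_plane_shift:
  fixes P :: "real \<times> real \<Rightarrow> bool"
  assumes "AE r in lborel. P r"
  shows "AE r in lborel. P (fst r - A, snd r - C)"
proof -
  obtain N where N: "{x \<in> space lborel. \<not> P x} \<subseteq> N" "N \<in> null_sets lborel"
    using assms unfolding eventually_ae_filter by blast
  have [measurable]: "N \<in> sets borel" using N(2) by auto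
  have "(\<integral>\<^sup>+r. indicator N (fst r - A, snd r - C) \<partial>lborel) = (\<integral>\<^sup>+r. indicator N r \<partial>lborel)"
    using nn_integral_shear[of "indicator N" "- A" 0 "- C"] by simp
  also have "\<dots> = 0" using N(2) by (simp add: null_sets_def)
  finally have "AE r in lborel. indicator N (fst r - A, snd r - C) = (0::ennreal)"
    by (subst (asm) nn_integral_0_iff_AE) auto
  then show ?thesis by eventually_elim (use N(1) in \<open>auto simp: indicator_def split: if_splits\<close>)
qed

section \<open>The frame identity\<close>

text \<open>The square of the constant is 1 / \<delta> times the Jacobian of the kernel variables;
  the remaining 1 / \<delta> is absorbed by substituting \<delta> * l for l. Only the set S is then
  left dilated.\<close>

lemma energy_dilated_sections:
  fixes \<alpha> \<beta> \<delta> :: real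
  assumes [measurable]: "K \<in> borel_measurable borel" "S \<in> sets borel"
    and nz: "\<alpha> \<noteq> 0" "\<beta> \<noteq> 0" and \<delta>: "\<delta> = \<alpha> * \<beta>" "\<delta> > 0"
  shows "(\<integral>\<^sup>+l. indicator S l * energy lborel (\<lambda>r. of_real (sqrt \<delta> / \<bar>\<beta>\<bar>) * K (l / \<delta>, \<alpha> * fst r, \<alpha> * snd r)) \<partial>lborel)
    = (\<integral>\<^sup>+l. indicator S (\<delta> * l) * energy lborel (\<lambda>r. K (l, r)) \<partial>lborel)"
proof -
  have Em [measurable]: "(\<lambda>l. energy lborel (\<lambda>r. K (l, r))) \<in> borel_measurable borel" unfolding energy_def by measurable
  have sec: "energy lborel (\<lambda>r. of_real (sqrt \<delta> / \<bar>\<beta>\<bar>) * K (l / \<delta>, \<alpha> * fst r, \<alpha> * snd r)) = ennreal (inverse \<delta>) * energy lborel (\<lambda>r. K (l / \<delta>, r))" for l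
  proof -
    have "(sqrt \<delta> / \<bar>\<beta>\<bar>)\<^sup>2 = inverse \<delta> * \<bar>\<alpha> * \<alpha>\<bar>"
    proof -
      have "(sqrt \<delta> / \<bar>\<beta>\<bar>)\<^sup>2 = \<delta> / \<beta>\<^sup>2" using \<delta>(2) by (simp add: power_divide)
      also have "\<dots> = \<alpha> / \<beta>" by (simp add: \<delta>(1) power2_eq_square)
      also have "\<dots> = inverse \<delta> * \<bar>\<alpha> * \<alpha>\<bar>" using nz by (simp add: \<delta>(1) field_simps)
      finally show ?thesis .
    qed
    then have "energy lborel (\<lambda>r. of_real (sqrt \<delta> / \<bar>\<beta>\<bar>) * K (l / \<delta>, \<alpha> * fst r, \<alpha> * snd r))
       = ennreal (inverse \<delta> * \<bar>\<alpha> * \<alpha>\<bar>) * energy lborel (\<lambda>r. K (l / \<delta>, \<alpha> * fst r, \<alpha> * snd r))"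
      by (subst energy_cmult) (simp_all only: norm_of_real power2_abs, measurable)
    also have "\<dots> = ennreal (inverse \<delta>) * (ennreal \<bar>\<alpha> * \<alpha>\<bar> * energy lborel (\<lambda>r. K (l / \<delta>, \<alpha> * fst r, \<alpha> * snd r)))"
      using \<delta>(2) by (simp add: ennreal_mult mult.assoc)
    also have "ennreal \<bar>\<alpha> * \<alpha>\<bar> * energy lborel (\<lambda>r. K (l / \<delta>, \<alpha> * fst r, \<alpha> * snd r)) = energy lborel (\<lambda>r. K (l / \<delta>, r))"
      using nn_integral_scale[OF _ nz(1) nz(1), of "\<lambda>r. ennreal ((cmod (K (l / \<delta>, r)))\<^sup>2)"] by (simp add: energy_def)
    finally show ?thesis .
  qed
  have "(\<integral>\<^sup>+l. indicator S l * energy lborel (\<lambda>r. of_real (sqrt \<delta> / \<bar>\<beta>\<bar>) * K (l / \<delta>, \<alpha> * fst r, \<alpha> * snd r)) \<partial>lborel)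
    = (\<integral>\<^sup>+l. indicator S l * (ennreal (inverse \<delta>) * energy lborel (\<lambda>r. K (l / \<delta>, r))) \<partial>lborel)"
    by (simp only: sec)
  also have "\<dots> = ennreal \<delta> * (\<integral>\<^sup>+l. indicator S (\<delta> * l) * (ennreal (inverse \<delta>) * energy lborel (\<lambda>r. K (l, r))) \<partial>lborel)"
    using \<delta>(2) by (subst nn_integral_real_affine[where c=\<delta> and t=0]) auto
  also have "\<dots> = (\<integral>\<^sup>+l. ennreal \<delta> * (indicator S (\<delta> * l) * (ennreal (inverse \<delta>) * energy lborel (\<lambda>r. K (l, r)))) \<partial>lborel)"
    by (rule nn_integral_cmult[symmetric]) measurable
  also have "\<dots> = (\<integral>\<^sup>+l. indicator S (\<delta> * l) * energy lborel (\<lambda>r. K (l, r)) \<partial>lborel)"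
  proof (rule nn_integral_cong)
    fix l
    have "ennreal \<delta> * ennreal (inverse \<delta>) = 1" using \<delta>(2) by (simp add: ennreal_mult[symmetric])
    then have "ennreal \<delta> * (indicator S (\<delta> * l) * (ennreal (inverse \<delta>) * x)) = indicator S (\<delta> * l) * x" for x
      by (simp add: indicator_def mult.assoc[symmetric])
    then show "ennreal \<delta> * (indicator S (\<delta> * l) * (ennreal (inverse \<delta>) * energy lborel (\<lambda>r. K (l, r)))) = indicator S (\<delta> * l) * energy lborel (\<lambda>r. K (l, r))" .
  qed
  finally show ?thesis .
qed

text \<open>Counting measure on a countable type is sigma-finite. Needed to interchange the outer
  sum with the integral over l while the inner sum is still present.\<close>

lemma borel_measurable_nn_integral_countable:
  fixes f :: "'i::countable \<Rightarrow> 'a \<Rightarrow> ennreal"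
  assumes "\<And>i. f i \<in> borel_measurable M"
  shows "(\<lambda>x. \<integral>\<^sup>+i. f i x \<partial>count_space UNIV) \<in> borel_measurable M"
proof -
  have "(\<lambda>q. f (snd q) (fst q)) \<in> borel_measurable (M \<Otimes>\<^sub>M count_space UNIV)"
    by (rule measurable_compose_countable[where g=snd and f="\<lambda>i q. f i (fst q)"])
       (auto intro: measurable_compose[OF measurable_fst assms])
  then show ?thesis
    by (intro sigma_finite_measure.borel_measurable_nn_integral[OF sigma_finite_measure_count_space])
       (simp add: case_prod_beta')
qed

lemma parseval_frame_L2: "parseval_frame M I F \<Longrightarrow> i \<in> I \<Longrightarrow> F i \<in> L2 M"
  by (simp add: parseval_frame_def)

text \<open>The sum over \<open>k1\<close> is Parseval's identity for the Fourier series in the central frequency, the sums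
  over \<open>i\<close> and \<open>j\<close> are the tensor product of the two Gabor frames.\<close>

lemma lattice_frame_identity:
  fixes F H :: "real \<times> real \<times> real \<Rightarrow> complex" and S :: "real set" and u v :: "real \<Rightarrow> real \<Rightarrow> complex"
  assumes H: "ktransform H K" and F: "ktransform F KF"
    and tile: "AE x in lborel. \<exists>!n::int. x + of_int n \<in> S"
    and S [measurable]: "S \<in> sets borel"
    and off: "AE l in lborel. l \<notin> S \<longrightarrow> (AE r in lborel. KF (l, r) = 0)"
    and on: "AE l in lborel. l \<in> S \<longrightarrow> l \<noteq> 0 \<and>
        (AE r in lborel. KF (l, r) = of_real (sqrt \<bar>l\<bar>) * tensor (u l) (v l) r) \<and>
        parseval_frame lborel (lattice_Z 1 \<times> lattice_Z l) (gabor (\<lambda>t. of_real (\<bar>l\<bar> powr (1/4)) * u l t)) \<and>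
        parseval_frame lborel (lattice_Z 1 \<times> lattice_Z l) (gabor (\<lambda>t. of_real (\<bar>l\<bar> powr (1/4)) * cnj (v l t)))"
  defines "\<tau> \<equiv> \<lambda>(k1::int) (i :: int \<times> int) (j :: int \<times> int) p.
     F (fst p - of_int (fst i) + of_int (fst j), fst (snd p) - of_int (snd i) + of_int (snd j),
        snd (snd p) - of_int k1 + of_int (fst i) * of_int (snd i) - of_int (fst i) * fst (snd p) + (fst p - of_int (fst i)) * of_int (snd j))"
  shows "(\<integral>\<^sup>+j. \<integral>\<^sup>+i. \<integral>\<^sup>+k1. ennreal ((cmod (inner_L2 lborel H (\<tau> k1 i j)))\<^sup>2) \<partial>count_space UNIV \<partial>count_space UNIV \<partial>count_space UNIV)
     = (\<integral>\<^sup>+l. indicator S l * energy lborel (\<lambda>r. K (l, r)) \<partial>lborel)"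
proof -
  \<comment> \<open>The kernel of a translate of F, without the phase of the central
    parameter.\<close>
  define M where "M i j q = cis (2 * pi * fst q * (snd (snd q) * of_int (snd j) - fst (snd q) * of_int (snd i))) *
     KF (fst q, fst (snd q) - of_int (fst i), snd (snd q) - of_int (fst j))" for i j :: "int \<times> int" and q
  \<comment> \<open>The phase of k1 depends on l alone and stays outside the fibre integral. The
    inner products with the frame elements are therefore Fourier integrals of \<open>B i j\<close>
    at integer frequencies.\<close>
  define B where "B i j l = (LINT r|lborel. K (l, r) * cnj (M i j (l, r)))" for i j l
  have KL: "K \<in> L2 lborel" and KFL: "KF \<in> L2 lborel" by (rule ktransform_L2(2)[OF H] ktransform_L2(2)[OF F])+
  have [measurable]: "K \<in> borel_measurable borel" "KF \<in> borel_measurable borel"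
    using L2_measurable[OF KL] L2_measurable[OF KFL] by auto
  have Mm [measurable]: "M i j \<in> borel_measurable borel" for i j unfolding M_def by measurable
  have Bm [measurable]: "B i j \<in> borel_measurable borel" for i j unfolding B_def by measurable
  have PTtau: "ktransform (\<tau> k1 i j) (\<lambda>q. cis (2 * pi * fst q * of_int k1) * M i j q)" for k1 i j
  proof -
    have "cis (2 * pi * fst q * (of_int k1 + snd (snd q) * of_int (snd j) - fst (snd q) * of_int (snd i))) =
       cis (2 * pi * fst q * of_int k1) * cis (2 * pi * fst q * (snd (snd q) * of_int (snd j) - fst (snd q) * of_int (snd i)))"
      for q :: "real \<times> real \<times> real"
      by (simp add: cis_mult algebra_simps)
    then show ?thesis
      using ktransform_translate[OF F, of "of_int (fst i)" "of_int (fst j)" "of_int (snd i)" "of_int (snd j)" "of_int k1"]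
      unfolding \<tau>_def M_def by (simp only: mult.assoc)
  qed
  have M_L2: "M i j \<in> L2 lborel" for i j using ktransform_L2(2)[OF PTtau[of 0 i j]] by simp
  have KMi: "integrable lborel (\<lambda>q. K q * cnj (M i j q))" for i j by (rule integrable_L2_inner[OF KL M_L2])
  \<comment> \<open>A product of two L2 functions, integrated over the fibre, is integrable in l,
    which is what \<open>periodize_Parseval\<close> asks for.\<close>
  have Bi: "integrable lborel (B i j)" for i j
    unfolding B_def by (rule integrable_lborel_pair(2)[OF KMi])
  have inner_B: "inner_L2 lborel H (\<tau> k1 i j) = (LINT l|lborel. B i j l * cis (- 2 * pi * of_int k1 * l))" for k1 i j
  proof -
    have i: "integrable lborel (\<lambda>q. K q * cnj (cis (2 * pi * fst q * of_int k1) * M i j q))"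
      by (rule integrable_L2_inner[OF KL ktransform_L2(2)[OF PTtau]])
    have "inner_L2 lborel H (\<tau> k1 i j) = (LINT q|lborel. K q * cnj (cis (2 * pi * fst q * of_int k1) * M i j q))"
      using ktransform_inner[OF H PTtau] unfolding inner_L2_def by (rule sym)
    also have "\<dots> = (LINT l|lborel. LINT r|lborel. K (l, r) * cnj (cis (2 * pi * l * of_int k1) * M i j (l, r)))"
      unfolding integrable_lborel_pair(3)[OF i, symmetric] by simp
    also have "\<dots> = (LINT l|lborel. LINT r|lborel. K (l, r) * cnj (M i j (l, r)) * cis (- 2 * pi * of_int k1 * l))"
      by (simp add: cis_cnj mult_ac)
    also have "\<dots> = (LINT l|lborel. B i j l * cis (- 2 * pi * of_int k1 * l))"
      unfolding B_def by simp
    finally show ?thesis .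
  qed
  have off': "AE l in lborel. l \<notin> S \<longrightarrow> (\<forall>i j. B i j l = 0)"
    using off
  proof eventually_elim
    case (elim l)
    show ?case
    proof (intro impI allI)
      fix i j :: "int \<times> int" assume "l \<notin> S"
      with elim have "AE r in lborel. KF (l, r) = 0" by blast
      then have "AE r in lborel. KF (l, fst r - of_int (fst i), snd r - of_int (fst j)) = 0" by (rule AE_plane_shift)
      then have "AE r in lborel. K (l, r) * cnj (M i j (l, r)) = 0" by eventually_elim (simp add: M_def)
      then show "B i j l = 0" unfolding B_def by (rule integral_eq_zero_AE)
    qed
  qed
  have on': "AE l in lborel. l \<in> S \<longrightarrow>
     (\<integral>\<^sup>+j. \<integral>\<^sup>+i. ennreal ((cmod (B i j l))\<^sup>2) \<partial>count_space UNIV \<partial>count_space UNIV) = energy lborel (\<lambda>r. K (l, r))"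
    using on L2_section[OF KL]
  proof eventually_elim
    case (elim l)
    show ?case
    proof
      assume "l \<in> S"
      with elim(1) have l0: "l \<noteq> 0" and ker: "AE r in lborel. KF (l, r) = of_real (sqrt \<bar>l\<bar>) * tensor (u l) (v l) r"
        and pu: "parseval_frame lborel (lattice_Z 1 \<times> lattice_Z l) (gabor (\<lambda>t. of_real (\<bar>l\<bar> powr (1/4)) * u l t))"
        and pv: "parseval_frame lborel (lattice_Z 1 \<times> lattice_Z l) (gabor (\<lambda>t. of_real (\<bar>l\<bar> powr (1/4)) * cnj (v l t)))"
        by blast+
      \<comment> \<open>The minus sign belongs to the modulation in t. Reversing it only permutes
        the Gabor system.\<close>
      define \<beta> where "\<beta> = (\<lambda>(n::int, j::int). (1 * real_of_int n, - l * real_of_int j))"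
      define \<gamma> where "\<gamma> = (\<lambda>(n::int, j::int). (1 * real_of_int n, l * real_of_int j))"
      have b: "bij_betw \<beta> UNIV (lattice_Z 1 \<times> lattice_Z l)" "bij_betw \<gamma> UNIV (lattice_Z 1 \<times> lattice_Z l)"
        unfolding \<beta>_def \<gamma>_def using bij_lattice[OF l0] bij_lattice'[OF l0] by blast+
      define U where "U i = gabor (\<lambda>t. of_real (\<bar>l\<bar> powr (1/4)) * u l t) (\<beta> i)" for i
      define V where "V j = gabor (\<lambda>t. of_real (\<bar>l\<bar> powr (1/4)) * cnj (v l t)) (\<gamma> j)" for j
      have UL: "U i \<in> L2 lborel" for i
        unfolding U_def by (rule parseval_frame_L2[OF pu bij_betw_apply[OF b(1) UNIV_I]])
      have VL: "V j \<in> L2 lborel" for j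
        unfolding V_def by (rule parseval_frame_L2[OF pv bij_betw_apply[OF b(2) UNIV_I]])
      \<comment> \<open>A translate of the rank-one kernel is a tensor product of two Gabor atoms,
        with translations by integers and modulations by integer multiples of l.\<close>
      have Bt: "B i j l = inner_L2 lborel (\<lambda>r. K (l, r)) (tensor (U i) (\<lambda>s. cnj (V j s)))" for i j
      proof -
        \<comment> \<open>The two quarter powers in the Gabor windows multiply to the weight sqrt
          |l| of the kernel.\<close>
        have quarter: "complex_of_real (\<bar>l\<bar> powr (1/4)) * complex_of_real (\<bar>l\<bar> powr (1/4)) = of_real (sqrt \<bar>l\<bar>)"
          by (simp add: powr_add[symmetric] powr_half_sqrt flip: of_real_mult)
        have "AE r in lborel. M i j (l, r) = tensor (U i) (\<lambda>s. cnj (V j s)) r"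
          using AE_plane_shift[OF ker, of "of_int (fst i)" "of_int (fst j)"]
        proof eventually_elim
          case (elim r)
          have "tensor (U i) (\<lambda>s. cnj (V j s)) r =
             (cis (2 * pi * (- l * of_int (snd i)) * fst r) * cis (2 * pi * (l * of_int (snd j)) * snd r)) *
             ((complex_of_real (\<bar>l\<bar> powr (1/4)) * complex_of_real (\<bar>l\<bar> powr (1/4))) *
              (u l (fst r - of_int (fst i)) * cnj (v l (snd r - of_int (fst j)))))"
            by (simp add: tensor_def U_def V_def gabor_def \<beta>_def \<gamma>_def case_prod_beta mult_ac)
          also have "cis (2 * pi * (- l * of_int (snd i)) * fst r) * cis (2 * pi * (l * of_int (snd j)) * snd r)
             = cis (2 * pi * l * (snd r * of_int (snd j) - fst r * of_int (snd i)))"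
            by (simp add: cis_mult algebra_simps)
          also note quarter
          finally show ?case by (simp add: M_def elim tensor_def)
        qed
        then show ?thesis unfolding B_def inner_L2_def
          by (intro integral_cong_AE) (use tensor_measurable[OF UL L2_cnj[OF VL]] in \<open>auto elim!: eventually_mono\<close>)
      qed
      show "(\<integral>\<^sup>+j. \<integral>\<^sup>+i. ennreal ((cmod (B i j l))\<^sup>2) \<partial>count_space UNIV \<partial>count_space UNIV) = energy lborel (\<lambda>r. K (l, r))"
        unfolding Bt
      proof (rule parseval_tensor[OF elim(2) UL VL])
        fix h :: "real \<Rightarrow> complex" assume h: "h \<in> L2 lborel"
        show "(\<integral>\<^sup>+i. ennreal ((cmod (inner_L2 lborel h (U i)))\<^sup>2) \<partial>count_space UNIV) = energy lborel h"
          unfolding U_def by (rule parseval_frame_bij[OF pu h b(1)])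
        show "(\<integral>\<^sup>+j. ennreal ((cmod (inner_L2 lborel h (V j)))\<^sup>2) \<partial>count_space UNIV) = energy lborel h"
          unfolding V_def by (rule parseval_frame_bij[OF pv h b(2)])
      qed
    qed
  qed
  \<comment> \<open>Parseval gives the energy of the periodization of \<open>B i j\<close>. As
    \<open>B i j\<close> vanishes off S and almost every coset of \<int> meets S once, periodization
    loses no energy.\<close>
  have per: "(\<integral>\<^sup>+k1. ennreal ((cmod (inner_L2 lborel H (\<tau> k1 i j)))\<^sup>2) \<partial>count_space UNIV) = energy lborel (B i j)" for i j
  proof -
    have "AE l in lborel. \<forall>n::int. l + of_int n \<notin> S \<longrightarrow> B i j (l + of_int n) = 0"
      unfolding AE_all_countable
    proof
      fix n :: int
      have "AE l in lborel. l \<notin> S \<longrightarrow> B i j l = 0" using off' by eventually_elim blast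
      from AE_lborel_affine[OF this, of 1 "of_int n"]
      show "AE l in lborel. l + of_int n \<notin> S \<longrightarrow> B i j (l + of_int n) = 0" by (simp add: add.commute)
    qed
    with tile have "AE l in lborel. \<exists>n0::int. \<forall>n. n \<noteq> n0 \<longrightarrow> B i j (l + of_int n) = 0"
    proof eventually_elim
      case (elim l)
      then obtain n0 :: int where "\<And>n. l + of_int n \<in> S \<Longrightarrow> n = n0" by blast
      with elim(2) show ?case by blast
    qed
    then show ?thesis unfolding inner_B periodize_Parseval[OF Bi] by (intro energy_periodize_disjoint) measurable
  qed
  have "(\<integral>\<^sup>+j. \<integral>\<^sup>+i. \<integral>\<^sup>+k1. ennreal ((cmod (inner_L2 lborel H (\<tau> k1 i j)))\<^sup>2) \<partial>count_space UNIV \<partial>count_space UNIV \<partial>count_space UNIV)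
     = (\<integral>\<^sup>+j. \<integral>\<^sup>+i. \<integral>\<^sup>+l. ennreal ((cmod (B i j l))\<^sup>2) \<partial>lborel \<partial>count_space UNIV \<partial>count_space UNIV)"
    by (simp only: per energy_def)
  also have "\<dots> = (\<integral>\<^sup>+j. \<integral>\<^sup>+l. \<integral>\<^sup>+i. ennreal ((cmod (B i j l))\<^sup>2) \<partial>count_space UNIV \<partial>lborel \<partial>count_space UNIV)"
    by (intro nn_integral_cong nn_integral_count_space_nn_integral[symmetric]) auto
  also have "\<dots> = (\<integral>\<^sup>+l. \<integral>\<^sup>+j. \<integral>\<^sup>+i. ennreal ((cmod (B i j l))\<^sup>2) \<partial>count_space UNIV \<partial>count_space UNIV \<partial>lborel)"
    by (rule nn_integral_count_space_nn_integral[symmetric]) (auto intro!: borel_measurable_nn_integral_countable)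
  also have "\<dots> = (\<integral>\<^sup>+l. indicator S l * energy lborel (\<lambda>r. K (l, r)) \<partial>lborel)"
  proof (rule nn_integral_cong_AE, use on' off' in eventually_elim)
    fix l assume "l \<in> S \<longrightarrow> (\<integral>\<^sup>+j. \<integral>\<^sup>+i. ennreal ((cmod (B i j l))\<^sup>2) \<partial>count_space UNIV \<partial>count_space UNIV) = energy lborel (\<lambda>r. K (l, r))"
      and "l \<notin> S \<longrightarrow> (\<forall>i j. B i j l = 0)"
    then show "(\<integral>\<^sup>+j. \<integral>\<^sup>+i. ennreal ((cmod (B i j l))\<^sup>2) \<partial>count_space UNIV \<partial>count_space UNIV) = indicator S l * energy lborel (\<lambda>r. K (l, r))"
    proof (cases "l \<in> S")
      case False
      with \<open>l \<notin> S \<longrightarrow> (\<forall>i j. B i j l = 0)\<close> have "B i j l = 0" for i j by blast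
      with False show ?thesis by (simp only:) simp
    qed simp
  qed
  finally show ?thesis .
qed

section \<open>Indexing the system and assembling the frame\<close>

lemma heis_eq_iff: "heis x y z = heis x' y' z' \<longleftrightarrow> x = x' \<and> y = y' \<and> z = z'"
  by (auto simp: heis_def vec_eq_iff forall_4)

text \<open>The components are ordered so that the iterated sums over m, j, i, k1 have the central
  parameter innermost, as in \<open>lattice_frame_identity\<close>.\<close>

definition frame_index :: "int \<times> (int \<times> int) \<times> (int \<times> int) \<times> int \<Rightarrow> int \<times> (real^4^4) \<times> (real^4^4)" where
  "frame_index = (\<lambda>(m, j, i, k1). (m, heis (of_int (fst i)) (of_int (snd i)) (of_int k1), heis (of_int (fst j)) (of_int (snd j)) 0))"

lemma bij_frame_index: "bij_betw frame_index UNIV (UNIV \<times> Lambda)"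
proof (rule bij_betw_imageI)
  show "inj frame_index"
    by (auto simp: inj_def frame_index_def heis_eq_iff prod_eq_iff)
  show "range frame_index = UNIV \<times> Lambda"
  proof (intro equalityI subsetI)
    fix x assume "x \<in> range frame_index"
    then show "x \<in> UNIV \<times> Lambda" by (auto simp: frame_index_def Lambda_def) blast+
  next
    fix x :: "int \<times> (real^4^4) \<times> (real^4^4)" assume "x \<in> UNIV \<times> Lambda"
    then obtain m and k1 k2 k3 m2 m3 :: int where "x = (m, heis (of_int k3) (of_int k2) (of_int k1), heis (of_int m3) (of_int m2) 0)"
      by (auto simp: Lambda_def)
    then have "x = frame_index (m, (m3, m2), (k3, k2), k1)" by (simp add: frame_index_def)
    then show "x \<in> range frame_index" by blast
  qed
qed

text \<open>The zero operator is of rank-one form with zero vectors, so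
  \<open>ktransform_rank_one\<close> applies to it.\<close>

lemma ktransform_off_support:
  assumes "plancherel f T" "ktransform (\<lambda>p. f (coords p)) K"
    and "AE \<xi> in lebesgue. \<xi> \<notin> S \<longrightarrow> oper_eq (T \<xi>) (\<lambda>\<phi> t. 0)"
  shows "AE l in lborel. l \<notin> S \<longrightarrow> (AE r in lborel. K (l, r) = 0)"
proof -
  have "AE \<xi> in lborel. \<xi> \<notin> S \<longrightarrow> oper_eq (T \<xi>) (\<lambda>\<phi> t. 0)" using assms(3) by (simp only: AE_completion_iff)
  with ktransform_rank_one[OF assms(1,2)] show ?thesis
  proof eventually_elim
    case (elim l)
    have "rank_one (\<lambda>t. 0) (\<lambda>t. 0) = (\<lambda>\<phi> t. 0)" by (simp add: rank_one_def)
    with elim have "l \<notin> S \<longrightarrow> (AE r in lborel. K (l, r) = of_real (sqrt \<bar>l\<bar>) * tensor (\<lambda>t. 0) (\<lambda>t. 0) r)"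
      using L2_zero by metis
    then show ?case by (simp add: tensor_def)
  qed
qed

theorem theorem3:
  fixes a b :: real and S :: "real set"
    and f :: "real^4^4 \<Rightarrow> complex" and Pf :: "real \<Rightarrow> oper"
    and u v :: "real \<Rightarrow> real \<Rightarrow> complex"
  assumes "a \<noteq> 0" and "b \<noteq> 0" and "a * b = 2"
    and "S \<in> sets lebesgue" and "0 \<notin> S" and "S \<subseteq> {-1..1}"
    and "dilation_congruent S ({-1..<-1/2} \<union> {1/2<..1})"
    and "translation_congruent S {0<..1}"
    and "f \<in> H_space S" and "plancherel f Pf"
    and "\<forall>\<xi>\<in>S. u \<xi> \<in> L2 lborel \<and> v \<xi> \<in> L2 lborel"
    and "AE \<xi> in lebesgue. \<xi> \<in> S \<longrightarrow> oper_eq (Pf \<xi>) (rank_one (u \<xi>) (v \<xi>))"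
    and "AE \<xi> in lebesgue. \<xi> \<in> S \<longrightarrow>
           parseval_frame lborel (lattice_Z 1 \<times> lattice_Z \<xi>)
             (gabor (\<lambda>t. of_real (\<bar>\<xi>\<bar> powr (1/4)) * u \<xi> t))"
    and "AE \<xi> in lebesgue. \<xi> \<in> S \<longrightarrow>
           parseval_frame lborel (lattice_Z 1 \<times> lattice_Z \<xi>)
             (gabor (\<lambda>t. of_real (\<bar>\<xi>\<bar> powr (1/4)) * cnj (v \<xi> t)))"
  shows "parseval_frame haar (UNIV \<times> Lambda)
           (\<lambda>(m :: int, \<gamma>, \<eta>). dilation (dil_matrix a b) m (bireg \<gamma> \<eta> f))"
proof -
  have fL: "f \<in> L2 haar" using assms(10) unfolding plancherel_def by blast
  have [measurable]: "f \<in> borel_measurable borel" by (rule L2_haar_measurable[OF fL])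
  define F where "F p = f (coords p)" for p
  obtain KF where KF: "ktransform F KF" using ktransform_exists[OF L2_haar[OF fL]] unfolding F_def by blast
  \<comment> \<open>A Borel representative: integrals are taken over \<open>lborel\<close>, while S
    is only Lebesgue measurable. Both tilings survive, as only countably many translates and dilates
    of a null set are involved.\<close>
  define S' where "S' = main_part lborel S"
  have S'm [measurable]: "S' \<in> sets borel" using main_part_sets[OF assms(4)] by (simp add: S'_def)
  have SS': "AE x in lborel. x \<in> S \<longleftrightarrow> x \<in> S'"
    using AE_notin_null_part[OF assms(4)] main_part_null_part_Un[OF assms(4)]
    unfolding S'_def by (auto elim!: eventually_mono)
  have tile: "AE x in lborel. \<exists>!n::int. x + of_int n \<in> S'"
  proof -
    have "AE x in lborel. \<forall>n::int. x + of_int n \<in> S \<longleftrightarrow> x + of_int n \<in> S'"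
      unfolding AE_all_countable
    proof
      fix n :: int
      show "AE x in lborel. x + of_int n \<in> S \<longleftrightarrow> x + of_int n \<in> S'"
        using AE_lborel_affine[OF SS', of 1 "of_int n"] by (simp add: add.commute)
    qed
    with translation_tiling[OF assms(8)] show ?thesis by eventually_elim simp
  qed
  have dtile: "AE x in lborel. \<exists>!m::int. 2 powi m * x \<in> S'"
  proof -
    have "AE x in lborel. \<forall>n::int. 2 powi n * x \<in> S \<longleftrightarrow> 2 powi n * x \<in> S'"
      unfolding AE_all_countable
    proof
      fix n :: int
      show "AE x in lborel. 2 powi n * x \<in> S \<longleftrightarrow> 2 powi n * x \<in> S'"
        using AE_lborel_affine[OF SS', of "2 powi n" 0] by simp
    qed
    with dilation_tiling[OF assms(7)] show ?thesis by eventually_elim simp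
  qed
  \<comment> \<open>The field that witnesses membership in \<open>H_space S\<close> need not be
    \<open>Pf\<close>. Both are tied to the same kernel KF: \<open>T0\<close> makes it vanish off S,
    \<open>Pf\<close> gives its form on S.\<close>
  obtain T0 where T0: "plancherel f T0" "AE \<xi> in lebesgue. \<xi> \<notin> S \<longrightarrow> oper_eq (T0 \<xi>) (\<lambda>\<phi> t. 0)"
    using assms(9) unfolding H_space_def by blast
  have off: "AE l in lborel. l \<notin> S' \<longrightarrow> (AE r in lborel. KF (l, r) = 0)"
    using SS' ktransform_off_support[OF T0(1) KF[unfolded F_def] T0(2)] by eventually_elim blast
  have on: "AE l in lborel. l \<in> S' \<longrightarrow> l \<noteq> 0 \<and>
        (AE r in lborel. KF (l, r) = of_real (sqrt \<bar>l\<bar>) * tensor (u l) (v l) r) \<and>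
        parseval_frame lborel (lattice_Z 1 \<times> lattice_Z l) (gabor (\<lambda>t. of_real (\<bar>l\<bar> powr (1/4)) * u l t)) \<and>
        parseval_frame lborel (lattice_Z 1 \<times> lattice_Z l) (gabor (\<lambda>t. of_real (\<bar>l\<bar> powr (1/4)) * cnj (v l t)))"
    using SS' ktransform_rank_one[OF assms(10) KF[unfolded F_def]] assms(12,13,14)[unfolded AE_completion_iff]
  proof eventually_elim
    case (elim l)
    show ?case
    proof
      assume "l \<in> S'"
      then have lS: "l \<in> S" using elim(1) by blast
      then have uv: "u l \<in> L2 lborel" "v l \<in> L2 lborel" using assms(11) by blast+
      have "AE r in lborel. KF (l, r) = of_real (sqrt \<bar>l\<bar>) * tensor (u l) (v l) r"
        using elim(2) uv elim(3) lS by blast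
      moreover have "l \<noteq> 0" using lS assms(5) by metis
      ultimately show "l \<noteq> 0 \<and>
        (AE r in lborel. KF (l, r) = of_real (sqrt \<bar>l\<bar>) * tensor (u l) (v l) r) \<and>
        parseval_frame lborel (lattice_Z 1 \<times> lattice_Z l) (gabor (\<lambda>t. of_real (\<bar>l\<bar> powr (1/4)) * u l t)) \<and>
        parseval_frame lborel (lattice_Z 1 \<times> lattice_Z l) (gabor (\<lambda>t. of_real (\<bar>l\<bar> powr (1/4)) * cnj (v l t)))"
        using elim(4,5) lS by blast
    qed
  qed
  define \<tau> where "\<tau> k1 i j p = F (fst p - of_int (fst i) + of_int (fst j), fst (snd p) - of_int (snd i) + of_int (snd j),
        snd (snd p) - of_int k1 + of_int (fst i) * of_int (snd i) - of_int (fst i) * fst (snd p) + (fst p - of_int (fst i)) * of_int (snd j))"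
    for k1 :: int and i j :: "int \<times> int" and p
  have \<tau>L: "\<tau> k1 i j \<in> L2 lborel" for k1 i j
    unfolding \<tau>_def by (rule ktransform_L2(1)[OF ktransform_translate[OF KF]])
  define G where "G = (\<lambda>(m :: int, \<gamma>, \<eta>). dilation (dil_matrix a b) m (bireg \<gamma> \<eta> f))"
  \<comment> \<open>\<open>dilation\<close> acts in coordinates with the exponent - m; once moved to
    the test function it appears with the exponent m.\<close>
  define \<alpha> where "\<alpha> m = a powi m" for m
  define \<beta> where "\<beta> m = b powi m" for m
  define \<delta> where "\<delta> m = (2::real) powi m" for m
  have nz: "\<alpha> m \<noteq> 0" "\<beta> m \<noteq> 0" and \<delta>: "\<delta> m = \<alpha> m * \<beta> m" "\<delta> m > 0" for m
    using assms(1,2) by (simp_all add: \<alpha>_def \<beta>_def \<delta>_def power_int_mult_distrib[symmetric] assms(3))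
  have inv: "inverse (\<alpha> (- m)) = \<alpha> m" "inverse (\<beta> (- m)) = \<beta> m" "inverse (\<delta> (- m)) = \<delta> m" for m
    by (simp_all add: \<alpha>_def \<beta>_def \<delta>_def power_int_minus)
  have Gm: "G (frame_index (m, j, i, k1)) \<in> borel_measurable borel" for m j i k1
    unfolding G_def frame_index_def by (simp add: dilation_measurable bireg_measurable)
  have Gemb: "G (frame_index (m, j, i, k1)) (coords p) =
      of_real (\<delta> (- m)) * \<tau> k1 i j (\<alpha> (- m) * fst p, \<beta> (- m) * fst (snd p), \<delta> (- m) * snd (snd p))" for m j i k1 p
    unfolding G_def frame_index_def \<alpha>_def \<beta>_def \<delta>_def \<tau>_def F_def
    by (simp add: dilation_coords[OF assms(1,2,3)] bireg_coords)
  have GL: "G (frame_index (m, j, i, k1)) \<in> L2 haar" for m j i k1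
  proof -
    have "energy haar (G (frame_index (m, j, i, k1))) = energy lborel (\<tau> k1 i j)"
      unfolding energy_haar[OF Gm] Gemb
      by (rule energy_dilate) (use L2_measurable[OF \<tau>L] nz \<delta> in auto)
    then show ?thesis using \<tau>L[of k1 i j] Gm by (simp add: L2_iff)
  qed
  have sum: "(\<integral>\<^sup>+x. ennreal ((cmod (inner_L2 haar h (G x)))\<^sup>2) \<partial>count_space (UNIV \<times> Lambda)) = energy haar h" if h: "h \<in> L2 haar" for h
  proof -
    define H where "H p = h (coords p)" for p
    have hm [measurable]: "h \<in> borel_measurable borel" by (rule L2_haar_measurable[OF h])
    have H_eq: "H = (\<lambda>p. h (coords p))" by (rule ext) (rule H_def)
    have HL: "H \<in> L2 lborel" unfolding H_def by (rule L2_haar[OF h])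
    obtain K where K: "ktransform H K" using ktransform_exists[OF HL] by blast
    have Km [measurable]: "K \<in> borel_measurable borel" using L2_measurable[OF ktransform_L2(2)[OF K]] by auto
    have Em [measurable]: "(\<lambda>l. energy lborel (\<lambda>r. K (l, r))) \<in> borel_measurable borel" unfolding energy_def by measurable
    define Hm where "Hm m p = of_real (\<delta> m) * H (\<alpha> m * fst p, \<beta> m * fst (snd p), \<delta> m * snd (snd p))" for m p
    have PTm: "ktransform (Hm m) (\<lambda>q. of_real (sqrt (\<delta> m) / \<bar>\<beta> m\<bar>) * K (fst q / \<delta> m, \<alpha> m * fst (snd q), \<alpha> m * snd (snd q)))" for m
      unfolding Hm_def by (rule ktransform_dilate[OF K nz \<delta>])
    \<comment> \<open>With the dilation on the side of h, the frame elements no longer depend on m,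
      and one lattice identity serves for every m.\<close>
    have inner: "inner_L2 haar h (G (frame_index (m, j, i, k1))) = inner_L2 lborel (Hm m) (\<tau> k1 i j)" for m j i k1
    proof -
      have "inner_L2 haar h (G (frame_index (m, j, i, k1))) = inner_L2 lborel H (\<lambda>p. of_real (\<delta> (- m)) * \<tau> k1 i j (\<alpha> (- m) * fst p, \<beta> (- m) * fst (snd p), \<delta> (- m) * snd (snd p)))"
        by (simp only: inner_haar[OF hm Gm] Gemb H_eq)
      also have "\<dots> = inner_L2 lborel (Hm m) (\<tau> k1 i j)"
        unfolding inner_dilate[OF HL \<tau>L nz \<delta>] inv Hm_def ..
      finally show ?thesis .
    qed
    have lat: "(\<integral>\<^sup>+j. \<integral>\<^sup>+i. \<integral>\<^sup>+k1. ennreal ((cmod (inner_L2 lborel (Hm m) (\<tau> k1 i j)))\<^sup>2) \<partial>count_space UNIV \<partial>count_space UNIV \<partial>count_space UNIV)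
        = (\<integral>\<^sup>+l. indicator S' (\<delta> m * l) * energy lborel (\<lambda>r. K (l, r)) \<partial>lborel)" for m
    proof -
      have "(\<integral>\<^sup>+j. \<integral>\<^sup>+i. \<integral>\<^sup>+k1. ennreal ((cmod (inner_L2 lborel (Hm m) (\<tau> k1 i j)))\<^sup>2) \<partial>count_space UNIV \<partial>count_space UNIV \<partial>count_space UNIV)
        = (\<integral>\<^sup>+l. indicator S' l * energy lborel (\<lambda>r. of_real (sqrt (\<delta> m) / \<bar>\<beta> m\<bar>) * K (l / \<delta> m, \<alpha> m * fst r, \<alpha> m * snd r)) \<partial>lborel)"
        unfolding \<tau>_def lattice_frame_identity[OF PTm KF tile S'm off on] by simp
      also have "\<dots> = (\<integral>\<^sup>+l. indicator S' (\<delta> m * l) * energy lborel (\<lambda>r. K (l, r)) \<partial>lborel)"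
        by (rule energy_dilated_sections[OF Km S'm nz \<delta>])
      finally show ?thesis .
    qed
    have "(\<integral>\<^sup>+x. ennreal ((cmod (inner_L2 haar h (G x)))\<^sup>2) \<partial>count_space (UNIV \<times> Lambda))
      = (\<integral>\<^sup>+x. ennreal ((cmod (inner_L2 haar h (G (frame_index x))))\<^sup>2) \<partial>count_space UNIV)"
      by (rule nn_integral_bij_count_space[OF bij_frame_index, symmetric])
    also have "\<dots> = (\<integral>\<^sup>+m. \<integral>\<^sup>+j. \<integral>\<^sup>+i. \<integral>\<^sup>+k1. ennreal ((cmod (inner_L2 haar h (G (frame_index (m, j, i, k1)))))\<^sup>2)
        \<partial>count_space UNIV \<partial>count_space UNIV \<partial>count_space UNIV \<partial>count_space UNIV)"
      by (simp only: nn_integral_fst_count_space[symmetric])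
    also have "\<dots> = (\<integral>\<^sup>+m. \<integral>\<^sup>+l. indicator S' (\<delta> m * l) * energy lborel (\<lambda>r. K (l, r)) \<partial>lborel \<partial>count_space UNIV)"
      by (simp only: inner lat)
    also have "\<dots> = (\<integral>\<^sup>+l. \<integral>\<^sup>+m. indicator S' (\<delta> m * l) * energy lborel (\<lambda>r. K (l, r)) \<partial>count_space UNIV \<partial>lborel)"
      by (rule nn_integral_count_space_nn_integral[symmetric]) auto
    also have "\<dots> = (\<integral>\<^sup>+l. energy lborel (\<lambda>r. K (l, r)) \<partial>lborel)"
    proof (rule nn_integral_cong_AE, use dtile in eventually_elim)
      case (elim l)
      \<comment> \<open>Exactly one power of 2 carries l into S', so the sum over m counts the
        energy of each fibre once.\<close>
      have "(\<integral>\<^sup>+m. indicator S' (\<delta> m * l) \<partial>count_space UNIV) = (1::ennreal)"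
        using nn_integral_indicator_ex1[OF elim] by (simp add: \<delta>_def indicator_def)
      then show ?case by (simp add: nn_integral_multc)
    qed
    also have "\<dots> = energy lborel K" by (rule energy_lborel_pair[OF Km, symmetric])
    also have "\<dots> = energy lborel H" by (rule ktransform_energy[OF K])
    also have "\<dots> = energy haar h" unfolding H_def by (rule energy_haar[symmetric]) measurable
    finally show ?thesis .
  qed
  have cnt: "countable (UNIV \<times> Lambda :: (int \<times> (real^4^4) \<times> (real^4^4)) set)"
    using bij_betw_imp_surj_on[OF bij_frame_index] by (metis countable_image uncountable_def countableI_type)
  have "parseval_frame haar (UNIV \<times> Lambda) G"
    unfolding parseval_frame_def
  proof (intro conjI ballI cnt)
    fix x :: "int \<times> (real^4^4) \<times> (real^4^4)" assume "x \<in> UNIV \<times> Lambda"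
    then obtain m j i k1 where "x = frame_index (m, j, i, k1)"
      using bij_betw_imp_surj_on[OF bij_frame_index] by (metis imageE prod.collapse)
    then show "G x \<in> L2 haar" using GL by simp
  next
    fix h assume h: "h \<in> L2 haar"
    show "((\<lambda>x. (cmod (inner_L2 haar h (G x)))\<^sup>2) has_sum (norm_L2 haar h)\<^sup>2) (UNIV \<times> Lambda)"
      by (subst has_sum_iff_nn_integral) (simp_all add: sum[OF h] energy_L2[OF h])
  qed
  then show ?thesis unfolding G_def .
qed

end
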